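(* Let $M$ be a finite dimensional $kE$-module, $1\le r\le n$, and let $U\subset\mathbb V$ be an $r$-plane. Let $\ell$ be an integer, $1\le\ell\le(p-1)r$. \begin{enumerate} \item If $M$ has constant $r$-$\operatorname{Soc}^\ell$-rank, then $\mathcal{K}er^\ell(M)$ is an algebraic vector bundle on $\operatorname{Grass}(r,\mathbb V)$ and $\operatorname{rk}\mathcal{K}er^\ell(M)=\dim\operatorname{Soc}^\ell_U(M)$. \item If $M$ has constant $r$-$\operatorname{Rad}^\ell$-rank, then $\mathcal{I}m^\ell(M)$ is an algebraic vector bundle on $\operatorname{Grass}(r,\mathbb V)$ and $\operatorname{rk}\mathcal{I}m^\ell(M)=\dim\operatorname{Rad}^\ell_U(M)$. \end{enumerate}
   Context: $k$ is an algebraically closed field of characteristic $p>0$, $E$ an elementary abelian $p$-group of rank $n\ge1$, $\mathbb V\subset\operatorname{Rad}(kE)$ a linear subspace with basis $x_1,\dots,x_n$ such that $\mathbb V\hookrightarrow\operatorname{Rad}(kE)\to\operatorname{Rad}(kE)/\operatorname{Rad}^2(kE)$ is an isomorphism; so $kE=k[x_1,\dots,x_n]/(x_i^p)$. An $r$-plane is an $r$-dimensional subspace. For an $r$-plane $U\subset\mathbb V$, $\operatorname{Rad}^\ell_U(M)$ is the span of all $u_1\cdots u_\ell m$ with $u_i\in U$, $m\in M$, and $\operatorname{Soc}^\ell_U(M)=\{m\in M:u_1\cdots u_\ell m=0\ \forall u_i\in U\}$. $M$ has constant $r$-$\operatorname{Rad}^\ell$-rank (resp. constant $r$-$\operatorname{Soc}^\ell$-rank)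 if $\dim\operatorname{Rad}^\ell_U(M)$ (resp. $\dim\operatorname{Soc}^\ell_U(M)$) is independent of the $r$-plane $U\subset\mathbb V$. An algebraic vector bundle means a locally free coherent sheaf. $\operatorname{Grass}(r,\mathbb V)$ is the Grassmannian of $r$-planes in $\mathbb V$, with structure sheaf $\mathcal O_{Gr}$, identified via the basis with $M^o_{n,r}/\mathrm{GL}_r$, where $M^o_{n,r}$ is the variety of $n\times r$ matrices of rank $r$ (a matrix represents the span of its columns). For $\Sigma=\{i_1<\dots<i_r\}\subset\{1,\dots,n\}$, $\mathcal U_\Sigma\subset\operatorname{Grass}(r,\mathbb V)$ is the affine open subset of those $U$ represented by matrices whose $\Sigma$-submatrix (rows indexed by $\Sigma$) is invertible; each such $U$ has a unique representative with $\Sigma$-submatrix the identity, and $k[\mathcal U_\Sigma]=k[Y^\Sigma_{i,j}]_{i\notin\Sigma,1\le j\le r}$ where $Y^\Sigma_{i,j}$ is the $(i,j)$ entry of this representative. Also put $Y^\Sigma_{i_j,j}=1$ and $Y^\Sigma_{i_{j'},j}=0$ for $j'\ne j$. Let $\theta^\Sigma_j:M\otimes k[\mathcal U_\Sigma]\to M\otimes k[\mathcal U_\Sigma]$, $\theta^\Sigma_j(m\otimes f)=\sum_{i=1}^n x_im\otimes Y^\Sigma_{i,j}f$ for $1\le j\le r$. Then $\mathcal{K}er^\ell(M)$ and $\mathcal{I}m^\ell(M)$ are the unique subsheaves of $M\otimes\mathcal O_{Gr}$ whose restrictions to each $\mathcal U_\Sigma$ are (the sheaves associated to) $\bigcap_{1\le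 j_1,\dots,j_\ell\le r}\ker(\theta^\Sigma_{j_1}\cdots\theta^\Sigma_{j_\ell})$ and $\sum_{1\le j_1,\dots,j_\ell\le r}\operatorname{im}(\theta^\Sigma_{j_1}\cdots\theta^\Sigma_{j_\ell})$ respectively. *)

theory Defs
  imports
    "HOL-Library.Poly_Mapping"
    "HOL-Library.FuncSet"
    "HOL-Library.Cardinality"
    "HOL-Computational_Algebra.Computational_Algebra"
    "Jordan_Normal_Form.DL_Submatrix"
begin

section \<open>The group algebra of an elementary abelian group\<close>

text \<open>
  Groups are written additively, so that for a finite abelian group \<open>'e\<close> the type
  \<open>'e \<Rightarrow>\<^sub>0 'k\<close>, with its convolution product, is the group algebra of \<open>'e\<close> over \<open>'k\<close>.
  The names of the locale of modules over a commutative ring are qualified because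
  HOL-Algebra has a locale of the same name.
\<close>

definition elementary_abelian :: "'e::{ab_group_add,finite} itself \<Rightarrow> nat \<Rightarrow> nat \<Rightarrow> bool" where
  "elementary_abelian _ p n \<longleftrightarrow>
     prime p \<and> (\<forall>g::'e. (\<Sum>i<p. g) = 0) \<and> CARD('e) = p ^ n"

definition alg_scale ::
    "'k::comm_ring_1 \<Rightarrow> ('e::ab_group_add \<Rightarrow>\<^sub>0 'k) \<Rightarrow> ('e \<Rightarrow>\<^sub>0 'k)" where
  "alg_scale c a = Poly_Mapping.single 0 c * a"

definition restr_scale ::
    "(('e::ab_group_add \<Rightarrow>\<^sub>0 'k::comm_ring_1) \<Rightarrow> 'm \<Rightarrow> 'm) \<Rightarrow> 'k \<Rightarrow> 'm \<Rightarrow> 'm" where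
  "restr_scale act c m = act (Poly_Mapping.single 0 c) m"

definition is_ideal :: "'a::comm_ring_1 set \<Rightarrow> bool" where
  "is_ideal I \<longleftrightarrow> Modules.module.subspace (*) I"

definition is_maximal_ideal :: "'a::comm_ring_1 set \<Rightarrow> bool" where
  "is_maximal_ideal I \<longleftrightarrow>
     is_ideal I \<and> I \<noteq> UNIV \<and> (\<forall>J. is_ideal J \<and> I \<subseteq> J \<longrightarrow> J = I \<or> J = UNIV)"

definition Rad :: "'a::comm_ring_1 set" where
  "Rad = \<Inter>{I. is_maximal_ideal I}"

definition Rad2 :: "'a::comm_ring_1 set" where
  "Rad2 = Modules.module.span (*) {a * b |a b. a \<in> Rad \<and> b \<in> Rad}"

text \<open>
  \<open>coset J a\<close> is the class of \<open>a\<close> modulo \<open>J\<close>; \<open>coset Rad2 ` Rad\<close> is the underlying set of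
  \<open>Rad/Rad\<^sup>2\<close>.
\<close>

definition coset :: "'a::ab_group_add set \<Rightarrow> 'a \<Rightarrow> 'a set" where
  "coset J a = {b. b - a \<in> J}"

definition fin_dim_module ::
    "(('e::ab_group_add \<Rightarrow>\<^sub>0 'k::field) \<Rightarrow> 'm::ab_group_add \<Rightarrow> 'm) \<Rightarrow> bool" where
  "fin_dim_module act \<longleftrightarrow> Modules.module act \<and>
     (\<exists>B. finite B \<and> Modules.module.span (restr_scale act) B = UNIV)"

definition planes :: "('e::ab_group_add \<Rightarrow>\<^sub>0 'k::field) set \<Rightarrow> nat \<Rightarrow> ('e \<Rightarrow>\<^sub>0 'k) set set" where
  "planes V r = {U. U \<subseteq> V \<and> Modules.module.subspace alg_scale U \<and>
                    vector_space.dim alg_scale U = r}"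

definition RadU ::
    "(('e::ab_group_add \<Rightarrow>\<^sub>0 'k::field) \<Rightarrow> 'm::ab_group_add \<Rightarrow> 'm) \<Rightarrow> nat \<Rightarrow> ('e \<Rightarrow>\<^sub>0 'k) set \<Rightarrow> 'm set" where
  "RadU act l U = Modules.module.span (restr_scale act)
     {act (prod_list us) m |us m. length us = l \<and> set us \<subseteq> U}"

definition SocU ::
    "(('e::ab_group_add \<Rightarrow>\<^sub>0 'k::field) \<Rightarrow> 'm::ab_group_add \<Rightarrow> 'm) \<Rightarrow> nat \<Rightarrow> ('e \<Rightarrow>\<^sub>0 'k) set \<Rightarrow> 'm set" where
  "SocU act l U = {m. \<forall>us. length us = l \<and> set us \<subseteq> U \<longrightarrow> act (prod_list us) m = 0}"

definition constant_Rad_rank ::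
    "(('e::ab_group_add \<Rightarrow>\<^sub>0 'k::field) \<Rightarrow> 'm::ab_group_add \<Rightarrow> 'm) \<Rightarrow> ('e \<Rightarrow>\<^sub>0 'k) set \<Rightarrow> nat \<Rightarrow> nat \<Rightarrow> bool" where
  "constant_Rad_rank act V r l \<longleftrightarrow> (\<forall>U\<in>planes V r. \<forall>U'\<in>planes V r.
     vector_space.dim (restr_scale act) (RadU act l U) =
     vector_space.dim (restr_scale act) (RadU act l U'))"

definition constant_Soc_rank ::
    "(('e::ab_group_add \<Rightarrow>\<^sub>0 'k::field) \<Rightarrow> 'm::ab_group_add \<Rightarrow> 'm) \<Rightarrow> ('e \<Rightarrow>\<^sub>0 'k) set \<Rightarrow> nat \<Rightarrow> nat \<Rightarrow> bool" where
  "constant_Soc_rank act V r l \<longleftrightarrow> (\<forall>U\<in>planes V r. \<forall>U'\<in>planes V r.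
     vector_space.dim (restr_scale act) (SocU act l U) =
     vector_space.dim (restr_scale act) (SocU act l U'))"


section \<open>The Grassmannian as a variety, and sheaves on it\<close>

text \<open>
  The Grassmannian is treated as a classical variety over an algebraically closed field:
  its points are the \<open>r\<close>-planes, and a section of a sheaf over \<open>W\<close> is a function on \<open>W\<close>
  (extended by \<open>undefined\<close>) with values in the field for the structure sheaf, and in the
  module \<open>M\<close> (the type \<open>'m\<close>) for \<open>M \<otimes> \<O>\<close>. The basis and the rows and columns of
  matrices are indexed from 0.
\<close>

locale grassmannian =
  fixes V :: "('e::ab_group_add \<Rightarrow>\<^sub>0 'k::field) set"
    and x :: "nat \<Rightarrow> 'e \<Rightarrow>\<^sub>0 'k"
    and n r :: nat
begin

abbreviation Gr :: "('e \<Rightarrow>\<^sub>0 'k) set set" where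
  "Gr \<equiv> planes V r"

definition represents :: "'k mat \<Rightarrow> ('e \<Rightarrow>\<^sub>0 'k) set \<Rightarrow> bool" where
  "represents A U \<longleftrightarrow> A \<in> carrier_mat n r \<and>
     U = Modules.module.span alg_scale ((\<lambda>j. \<Sum>i<n. alg_scale (A $$ (i, j)) (x i)) ` {..<r})"

definition index_sets :: "nat set set" where
  "index_sets = {S. S \<subseteq> {..<n} \<and> card S = r}"

definition chart :: "nat set \<Rightarrow> ('e \<Rightarrow>\<^sub>0 'k) set set" where
  "chart S = {U \<in> Gr. \<exists>A. represents A U \<and> invertible_mat (submatrix A S UNIV)}"

definition Y :: "nat set \<Rightarrow> nat \<Rightarrow> nat \<Rightarrow> ('e \<Rightarrow>\<^sub>0 'k) set \<Rightarrow> 'k" where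
  "Y S i j U = (THE A. represents A U \<and> submatrix A S UNIV = 1\<^sub>m r) $$ (i, j)"

text \<open>
  The coordinate ring of a chart, as a ring of functions. The coordinates \<open>Y S i j\<close> with
  \<open>i \<notin> S\<close> identify the chart with an affine space over an infinite field, so this is the
  polynomial ring in them.
\<close>

inductive_set coord_ring :: "nat set \<Rightarrow> (('e \<Rightarrow>\<^sub>0 'k) set \<Rightarrow> 'k) set" for S where
  const: "(\<lambda>U\<in>chart S. c) \<in> coord_ring S"
| coord: "i < n \<Longrightarrow> i \<notin> S \<Longrightarrow> j < r \<Longrightarrow> (\<lambda>U\<in>chart S. Y S i j U) \<in> coord_ring S"
| add: "f \<in> coord_ring S \<Longrightarrow> g \<in> coord_ring S \<Longrightarrow> (\<lambda>U\<in>chart S. f U + g U) \<in> coord_ring S"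
| mult: "f \<in> coord_ring S \<Longrightarrow> g \<in> coord_ring S \<Longrightarrow> (\<lambda>U\<in>chart S. f U * g U) \<in> coord_ring S"

definition principal_open :: "nat set \<Rightarrow> (('e \<Rightarrow>\<^sub>0 'k) set \<Rightarrow> 'k) \<Rightarrow> ('e \<Rightarrow>\<^sub>0 'k) set set" where
  "principal_open S g = {U \<in> chart S. g U \<noteq> 0}"

definition zopen :: "('e \<Rightarrow>\<^sub>0 'k) set set \<Rightarrow> bool" where
  "zopen W \<longleftrightarrow> W \<subseteq> Gr \<and>
     (\<forall>S\<in>index_sets. \<forall>P\<in>W \<inter> chart S. \<exists>g\<in>coord_ring S. P \<in> principal_open S g \<and> principal_open S g \<subseteq> W)"

definition \<O> :: "('e \<Rightarrow>\<^sub>0 'k) set set \<Rightarrow> (('e \<Rightarrow>\<^sub>0 'k) set \<Rightarrow> 'k) set" where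
  "\<O> W = {f \<in> extensional W. \<forall>S\<in>index_sets. \<forall>P\<in>W \<inter> chart S.
     \<exists>W'. zopen W' \<and> P \<in> W' \<and> W' \<subseteq> W \<inter> chart S \<and>
       (\<exists>a\<in>coord_ring S. \<exists>b\<in>coord_ring S. \<forall>Q\<in>W'. b Q \<noteq> 0 \<and> f Q = a Q / b Q)}"

text \<open>
  For a ring \<open>R\<close> of functions on \<open>D\<close>, the tensor product \<open>M \<otimes> R\<close> over the field embeds into
  the \<open>M\<close>-valued functions on \<open>D\<close>; \<open>tensor act R D\<close> is its image. As \<open>M\<close> is
  finite-dimensional, \<open>W \<mapsto> M \<otimes> \<O> W\<close> is already a sheaf.
\<close>

definition tensor ::
    "(('e \<Rightarrow>\<^sub>0 'k) \<Rightarrow> 'm::ab_group_add \<Rightarrow> 'm) \<Rightarrow> (('e \<Rightarrow>\<^sub>0 'k) set \<Rightarrow> 'k) set \<Rightarrow>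
     ('e \<Rightarrow>\<^sub>0 'k) set set \<Rightarrow> (('e \<Rightarrow>\<^sub>0 'k) set \<Rightarrow> 'm) set" where
  "tensor act R D = {\<lambda>P\<in>D. \<Sum>a<N. restr_scale act (f a P) (m a) |(N::nat) f m. \<forall>a<N. f a \<in> R}"

abbreviation M\<O> ::
    "(('e \<Rightarrow>\<^sub>0 'k) \<Rightarrow> 'm::ab_group_add \<Rightarrow> 'm) \<Rightarrow> ('e \<Rightarrow>\<^sub>0 'k) set set \<Rightarrow> (('e \<Rightarrow>\<^sub>0 'k) set \<Rightarrow> 'm) set" where
  "M\<O> act W \<equiv> tensor act (\<O> W) W"

definition section_add ::
    "('e \<Rightarrow>\<^sub>0 'k) set set \<Rightarrow> (('e \<Rightarrow>\<^sub>0 'k) set \<Rightarrow> 'a::ab_group_add) \<Rightarrow>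
     (('e \<Rightarrow>\<^sub>0 'k) set \<Rightarrow> 'a) \<Rightarrow> (('e \<Rightarrow>\<^sub>0 'k) set \<Rightarrow> 'a)" where
  "section_add W s t = (\<lambda>P\<in>W. s P + t P)"

definition section_scale ::
    "('k \<Rightarrow> 'a \<Rightarrow> 'a) \<Rightarrow> ('e \<Rightarrow>\<^sub>0 'k) set set \<Rightarrow> (('e \<Rightarrow>\<^sub>0 'k) set \<Rightarrow> 'k) \<Rightarrow>
     (('e \<Rightarrow>\<^sub>0 'k) set \<Rightarrow> 'a) \<Rightarrow> (('e \<Rightarrow>\<^sub>0 'k) set \<Rightarrow> 'a)" where
  "section_scale scale W f s = (\<lambda>P\<in>W. scale (f P) (s P))"

text \<open>
  Sub-\<open>\<O>\<close>-modules of \<open>M \<otimes> \<O>\<close>. The value on sets that are not open is normalised, so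
  that a subsheaf is determined by its sections over open sets.
\<close>

definition subsheaf ::
    "(('e \<Rightarrow>\<^sub>0 'k) \<Rightarrow> 'm::ab_group_add \<Rightarrow> 'm) \<Rightarrow>
     (('e \<Rightarrow>\<^sub>0 'k) set set \<Rightarrow> (('e \<Rightarrow>\<^sub>0 'k) set \<Rightarrow> 'm) set) \<Rightarrow> bool" where
  "subsheaf act F \<longleftrightarrow>
     (\<forall>W. \<not> zopen W \<longrightarrow> F W = {}) \<and>
     (\<forall>W. zopen W \<longrightarrow>
        F W \<subseteq> M\<O> act W \<and>
        (\<lambda>P\<in>W. 0) \<in> F W \<and>
        (\<forall>s\<in>F W. \<forall>t\<in>F W. section_add W s t \<in> F W) \<and>
        (\<forall>f\<in>\<O> W. \<forall>s\<in>F W. section_scale (restr_scale act) W f s \<in> F W) \<and>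
        (\<forall>W'. zopen W' \<and> W' \<subseteq> W \<longrightarrow> (\<forall>s\<in>F W. restrict s W' \<in> F W')) \<and>
        (\<forall>s\<in>M\<O> act W. (\<forall>P\<in>W. \<exists>W'. zopen W' \<and> P \<in> W' \<and> W' \<subseteq> W \<and> restrict s W' \<in> F W')
            \<longrightarrow> s \<in> F W))"

text \<open>
  Sections over \<open>W\<close> of the sheaf associated to a module \<open>N\<close> of \<open>M\<close>-valued functions over
  the coordinate ring \<open>A\<close> of an affine open set containing \<open>W\<close>.
\<close>

definition assoc_sheaf ::
    "(('e \<Rightarrow>\<^sub>0 'k) \<Rightarrow> 'm::ab_group_add \<Rightarrow> 'm) \<Rightarrow> (('e \<Rightarrow>\<^sub>0 'k) set \<Rightarrow> 'k) set \<Rightarrow>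
     (('e \<Rightarrow>\<^sub>0 'k) set \<Rightarrow> 'm) set \<Rightarrow> ('e \<Rightarrow>\<^sub>0 'k) set set \<Rightarrow> (('e \<Rightarrow>\<^sub>0 'k) set \<Rightarrow> 'm) set" where
  "assoc_sheaf act A N W = {s \<in> extensional W. \<forall>P\<in>W. \<exists>W'. zopen W' \<and> P \<in> W' \<and> W' \<subseteq> W \<and>
     (\<exists>t\<in>N. \<exists>f\<in>A. \<forall>Q\<in>W'. f Q \<noteq> 0 \<and> s Q = restr_scale act (inverse (f Q)) (t Q))}"

definition theta ::
    "(('e \<Rightarrow>\<^sub>0 'k) \<Rightarrow> 'm::ab_group_add \<Rightarrow> 'm) \<Rightarrow> nat set \<Rightarrow> nat \<Rightarrow>
     (('e \<Rightarrow>\<^sub>0 'k) set \<Rightarrow> 'm) \<Rightarrow> (('e \<Rightarrow>\<^sub>0 'k) set \<Rightarrow> 'm)" where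
  "theta act S j s = (\<lambda>U\<in>chart S. \<Sum>i<n. restr_scale act (Y S i j U) (act (x i) (s U)))"

definition theta_tuples :: "nat \<Rightarrow> nat list set" where
  "theta_tuples l = {js. length js = l \<and> set js \<subseteq> {..<r}}"

definition Ker_module ::
    "(('e \<Rightarrow>\<^sub>0 'k) \<Rightarrow> 'm::ab_group_add \<Rightarrow> 'm) \<Rightarrow> nat \<Rightarrow> nat set \<Rightarrow> (('e \<Rightarrow>\<^sub>0 'k) set \<Rightarrow> 'm) set" where
  "Ker_module act l S = {s \<in> tensor act (coord_ring S) (chart S).
     \<forall>js\<in>theta_tuples l. foldr (theta act S) js s = (\<lambda>U\<in>chart S. 0)}"

definition Im_module ::
    "(('e \<Rightarrow>\<^sub>0 'k) \<Rightarrow> 'm::ab_group_add \<Rightarrow> 'm) \<Rightarrow> nat \<Rightarrow> nat set \<Rightarrow> (('e \<Rightarrow>\<^sub>0 'k) set \<Rightarrow> 'm) set" where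
  "Im_module act l S = {\<lambda>U\<in>chart S. \<Sum>js\<in>theta_tuples l. foldr (theta act S) js (t js) U |t.
     \<forall>js\<in>theta_tuples l. t js \<in> tensor act (coord_ring S) (chart S)}"

definition glued_sheaf ::
    "(('e \<Rightarrow>\<^sub>0 'k) \<Rightarrow> 'm::ab_group_add \<Rightarrow> 'm) \<Rightarrow> (nat set \<Rightarrow> (('e \<Rightarrow>\<^sub>0 'k) set \<Rightarrow> 'm) set) \<Rightarrow>
     ('e \<Rightarrow>\<^sub>0 'k) set set \<Rightarrow> (('e \<Rightarrow>\<^sub>0 'k) set \<Rightarrow> 'm) set" where
  "glued_sheaf act N = (THE F. subsheaf act F \<and>
     (\<forall>S\<in>index_sets. \<forall>W. zopen W \<and> W \<subseteq> chart S \<longrightarrow>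
        F W = assoc_sheaf act (coord_ring S) (N S) W))"

definition Ker_sheaf ::
    "(('e \<Rightarrow>\<^sub>0 'k) \<Rightarrow> 'm::ab_group_add \<Rightarrow> 'm) \<Rightarrow> nat \<Rightarrow>
     ('e \<Rightarrow>\<^sub>0 'k) set set \<Rightarrow> (('e \<Rightarrow>\<^sub>0 'k) set \<Rightarrow> 'm) set" where
  "Ker_sheaf act l = glued_sheaf act (Ker_module act l)"

definition Im_sheaf ::
    "(('e \<Rightarrow>\<^sub>0 'k) \<Rightarrow> 'm::ab_group_add \<Rightarrow> 'm) \<Rightarrow> nat \<Rightarrow>
     ('e \<Rightarrow>\<^sub>0 'k) set set \<Rightarrow> (('e \<Rightarrow>\<^sub>0 'k) set \<Rightarrow> 'm) set" where
  "Im_sheaf act l = glued_sheaf act (Im_module act l)"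

text \<open>An isomorphism of sheaves of \<open>\<O>\<close>-modules on \<open>W\<close> from \<open>\<O>\<^sup>d\<close> to \<open>F\<close>.\<close>

definition iso_free ::
    "(('e \<Rightarrow>\<^sub>0 'k) \<Rightarrow> 'm::ab_group_add \<Rightarrow> 'm) \<Rightarrow>
     (('e \<Rightarrow>\<^sub>0 'k) set set \<Rightarrow> (('e \<Rightarrow>\<^sub>0 'k) set \<Rightarrow> 'm) set) \<Rightarrow> ('e \<Rightarrow>\<^sub>0 'k) set set \<Rightarrow> nat \<Rightarrow>
     (('e \<Rightarrow>\<^sub>0 'k) set set \<Rightarrow> (nat \<Rightarrow> ('e \<Rightarrow>\<^sub>0 'k) set \<Rightarrow> 'k) \<Rightarrow> ('e \<Rightarrow>\<^sub>0 'k) set \<Rightarrow> 'm) \<Rightarrow> bool" where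
  "iso_free act F W d \<phi> \<longleftrightarrow> (\<forall>W'. zopen W' \<and> W' \<subseteq> W \<longrightarrow>
     bij_betw (\<phi> W') ({..<d} \<rightarrow>\<^sub>E \<O> W') (F W') \<and>
     (\<forall>f\<in>{..<d} \<rightarrow>\<^sub>E \<O> W'. \<forall>g\<in>{..<d} \<rightarrow>\<^sub>E \<O> W'.
        \<phi> W' (\<lambda>i\<in>{..<d}. section_add W' (f i) (g i)) = section_add W' (\<phi> W' f) (\<phi> W' g)) \<and>
     (\<forall>a\<in>\<O> W'. \<forall>f\<in>{..<d} \<rightarrow>\<^sub>E \<O> W'.
        \<phi> W' (\<lambda>i\<in>{..<d}. section_scale (*) W' a (f i)) =
        section_scale (restr_scale act) W' a (\<phi> W' f)) \<and>
     (\<forall>W''. zopen W'' \<and> W'' \<subseteq> W' \<longrightarrow> (\<forall>f\<in>{..<d} \<rightarrow>\<^sub>E \<O> W'.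
        \<phi> W'' (\<lambda>i\<in>{..<d}. restrict (f i) W'') = restrict (\<phi> W' f) W'')))"

definition locally_free ::
    "(('e \<Rightarrow>\<^sub>0 'k) \<Rightarrow> 'm::ab_group_add \<Rightarrow> 'm) \<Rightarrow>
     (('e \<Rightarrow>\<^sub>0 'k) set set \<Rightarrow> (('e \<Rightarrow>\<^sub>0 'k) set \<Rightarrow> 'm) set) \<Rightarrow> bool" where
  "locally_free act F \<longleftrightarrow> (\<forall>P\<in>Gr. \<exists>W d \<phi>. zopen W \<and> P \<in> W \<and> iso_free act F W d \<phi>)"

definition has_rank ::
    "(('e \<Rightarrow>\<^sub>0 'k) \<Rightarrow> 'm::ab_group_add \<Rightarrow> 'm) \<Rightarrow>
     (('e \<Rightarrow>\<^sub>0 'k) set set \<Rightarrow> (('e \<Rightarrow>\<^sub>0 'k) set \<Rightarrow> 'm) set) \<Rightarrow> nat \<Rightarrow> bool" where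
  "has_rank act F d \<longleftrightarrow> (\<forall>P\<in>Gr. \<exists>W \<phi>. zopen W \<and> P \<in> W \<and> iso_free act F W d \<phi>)"

definition section_span ::
    "(('e \<Rightarrow>\<^sub>0 'k) \<Rightarrow> 'm::ab_group_add \<Rightarrow> 'm) \<Rightarrow> ('e \<Rightarrow>\<^sub>0 'k) set set \<Rightarrow>
     (('e \<Rightarrow>\<^sub>0 'k) set \<Rightarrow> 'm) set \<Rightarrow> (('e \<Rightarrow>\<^sub>0 'k) set \<Rightarrow> 'm) set" where
  "section_span act D B =
     {\<lambda>P\<in>D. \<Sum>s\<in>B. restr_scale act (c s P) (s P) |c. \<forall>s\<in>B. c s \<in> \<O> D}"

text \<open>
  Coherence: over the members of a cover by affine open sets, \<open>F\<close> is the sheaf associated to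
  a finitely generated module over the coordinate ring. For a subsheaf of \<open>M \<otimes> \<O>\<close> that
  module can be taken to be a submodule of the module of sections of \<open>M \<otimes> \<O>\<close>, and the
  cover can be refined to one by principal open subsets of charts.
\<close>

definition coherent ::
    "(('e \<Rightarrow>\<^sub>0 'k) \<Rightarrow> 'm::ab_group_add \<Rightarrow> 'm) \<Rightarrow>
     (('e \<Rightarrow>\<^sub>0 'k) set set \<Rightarrow> (('e \<Rightarrow>\<^sub>0 'k) set \<Rightarrow> 'm) set) \<Rightarrow> bool" where
  "coherent act F \<longleftrightarrow> (\<forall>P\<in>Gr. \<exists>S\<in>index_sets. \<exists>g\<in>coord_ring S.
     P \<in> principal_open S g \<and>
     (\<exists>B. finite B \<and> B \<subseteq> M\<O> act (principal_open S g) \<and>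
        (\<forall>W. zopen W \<and> W \<subseteq> principal_open S g \<longrightarrow>
           F W = assoc_sheaf act (\<O> (principal_open S g))
                   (section_span act (principal_open S g) B) W)))"

definition algebraic_vector_bundle ::
    "(('e \<Rightarrow>\<^sub>0 'k) \<Rightarrow> 'm::ab_group_add \<Rightarrow> 'm) \<Rightarrow>
     (('e \<Rightarrow>\<^sub>0 'k) set set \<Rightarrow> (('e \<Rightarrow>\<^sub>0 'k) set \<Rightarrow> 'm) set) \<Rightarrow> bool" where
  "algebraic_vector_bundle act F \<longleftrightarrow> subsheaf act F \<and> locally_free act F \<and> coherent act F"

end

end

theory Submission
  imports Defs "Jordan_Normal_Form.Determinant"
begin

text \<open>
  On each chart, \<open>Rad\<close> and \<open>Soc\<close> at the plane \<open>U\<close> are the image and the kernel of matrices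
  whose entries are polynomials in the coordinates of \<open>U\<close>. Gauss-Jordan elimination at a point
  \<open>P\<close>, carried out with regular functions near \<open>P\<close>, yields as many independent rows as the
  rank at \<open>P\<close>; since the rank does not change, these rows stay a basis of the row space
  nearby, and they (for \<open>Rad\<close>), or the solutions read off from them (for \<open>Soc\<close>), form a local
  frame. Because the frame is in reduced echelon form, the coefficients of a section are among
  its coordinates in a fixed basis of \<open>M\<close>, hence regular. It follows that the glued sheaf
  consists of all regular sections with values in the fibres \<open>Rad\<close> (or \<open>Soc\<close>).
\<close>

section \<open>Gauss-Jordan elimination over rings of functions\<close>

text \<open>The sheaves are definite descriptions, so existence and uniqueness both need proof; a
  description by fibres settles both once it agrees with the prescribed modules on the charts. For
  the kernel this is a pointwise matter: vanishing of a product of thetas is tested at each plane.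
  For the image it is the real obstacle. A section whose values lie in the fibrewise images need not
  come from the module: for multiplication by y^2 on the affine line, the function y takes values in
  the fibrewise image but is no multiple of y^2 near 0. Constant rank therefore already enters in
  identifying the image sheaf, not only in proving it free, and elimination must record how its rows
  arise from the original ones, with coefficients regular near the point. Openness and regularity
  stay abstract during elimination so that the same argument, over a one-point space where every
  function counts as regular, also gives ordinary row reduction; this is what finds a chart around a
  given plane.\<close>

locale regular_functions =
  fixes opn :: "'p set \<Rightarrow> bool" and reg :: "'p set \<Rightarrow> ('p \<Rightarrow> 'k::field) \<Rightarrow> bool"
  assumes reg_const: "opn D \<Longrightarrow> reg D (\<lambda>Q. c)"
    and reg_add: "reg D f \<Longrightarrow> reg D g \<Longrightarrow> reg D (\<lambda>Q. f Q + g Q)"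
    and reg_mult: "reg D f \<Longrightarrow> reg D g \<Longrightarrow> reg D (\<lambda>Q. f Q * g Q)"
    and reg_mono: "reg D f \<Longrightarrow> opn D' \<Longrightarrow> D' \<subseteq> D \<Longrightarrow> reg D' f"
    and opn_nonzero: "reg D f \<Longrightarrow> opn {Q\<in>D. f Q \<noteq> 0}"
    and reg_inverse: "reg D f \<Longrightarrow> reg {Q\<in>D. f Q \<noteq> 0} (\<lambda>Q. inverse (f Q))"
begin

lemma reg_sum:
  assumes "opn D" "\<And>i. i \<in> I \<Longrightarrow> reg D (f i)"
  shows "reg D (\<lambda>Q. \<Sum>i\<in>I. f i Q)"
  using assms(2)
proof (induction I rule: infinite_finite_induct)
  case (insert i I)
  then show ?case by (simp add: reg_add)
qed (simp_all add: reg_const assms(1))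

lemma reg_diff:
  assumes "opn D" "reg D f" "reg D g"
  shows "reg D (\<lambda>Q. f Q - g Q)"
  using reg_add[OF assms(2) reg_mult[OF reg_const[OF assms(1), of "- 1"] assms(3)]] by simp

text \<open>\<open>A\<close> serves both as the set of pivot columns and as the index set of the
  rows: each row bears the name of its pivot, so the last clause says that the pivot columns form an
  identity matrix. \<open>\<gamma>\<close> is the record of row operations.\<close>

definition reduced_rows ::
    "'i set \<Rightarrow> 'c set \<Rightarrow> ('i \<Rightarrow> 'c \<Rightarrow> 'p \<Rightarrow> 'k) \<Rightarrow> 'p set \<Rightarrow> 'c set \<Rightarrow>
     ('c \<Rightarrow> 'c \<Rightarrow> 'p \<Rightarrow> 'k) \<Rightarrow> ('c \<Rightarrow> 'i \<Rightarrow> 'p \<Rightarrow> 'k) \<Rightarrow> bool" where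
  "reduced_rows I C v D A \<rho> \<gamma> \<longleftrightarrow> A \<subseteq> C \<and>
     (\<forall>a\<in>A. \<forall>c\<in>C. reg D (\<rho> a c)) \<and> (\<forall>a\<in>A. \<forall>i\<in>I. reg D (\<gamma> a i)) \<and>
     (\<forall>Q\<in>D. \<forall>a\<in>A. \<forall>c\<in>C. \<rho> a c Q = (\<Sum>i\<in>I. \<gamma> a i Q * v i c Q)) \<and>
     (\<forall>Q\<in>D. \<forall>a\<in>A. \<forall>b\<in>A. \<rho> a b Q = (if a = b then 1 else 0))"

text \<open>
  Gauss-Jordan elimination near a point \<open>P\<close>. The rows \<open>\<rho> a\<close> are combinations of the rows
  \<open>v i\<close> on a neighbourhood, but the converse is only claimed at \<open>P\<close>, where the rank of \<open>v\<close>
  is \<open>card A\<close>; nearby it can be larger.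
\<close>

lemma local_elimination:
  assumes "finite I" "finite C" "opn D" "P \<in> D"
    and "\<And>i c. i \<in> I \<Longrightarrow> c \<in> C \<Longrightarrow> reg D (v i c)"
  shows "\<exists>D' A \<rho> \<gamma>. opn D' \<and> P \<in> D' \<and> D' \<subseteq> D \<and> reduced_rows I C v D' A \<rho> \<gamma> \<and>
     (\<forall>i\<in>I. \<forall>c\<in>C. v i c P = (\<Sum>a\<in>A. v i a P * \<rho> a c P))"
  using assms(1,5)
proof (induction I)
  case empty
  show ?case
    by (rule exI[of _ D], rule exI[of _ "{}"]) (simp add: assms(3,4) reduced_rows_def)
next
  case (insert i0 I)
  then obtain D' A \<rho> \<gamma> where D': "opn D'" "P \<in> D'" "D' \<subseteq> D"
    and red: "reduced_rows I C v D' A \<rho> \<gamma>"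
    and span: "\<forall>i\<in>I. \<forall>c\<in>C. v i c P = (\<Sum>a\<in>A. v i a P * \<rho> a c P)"
    by auto
  from red have A: "A \<subseteq> C"
    and r\<rho>: "\<And>a c. a \<in> A \<Longrightarrow> c \<in> C \<Longrightarrow> reg D' (\<rho> a c)"
    and r\<gamma>: "\<And>a i. a \<in> A \<Longrightarrow> i \<in> I \<Longrightarrow> reg D' (\<gamma> a i)"
    and comb: "\<And>Q a c. Q \<in> D' \<Longrightarrow> a \<in> A \<Longrightarrow> c \<in> C \<Longrightarrow> \<rho> a c Q = (\<Sum>i\<in>I. \<gamma> a i Q * v i c Q)"
    and unit: "\<And>Q a b. Q \<in> D' \<Longrightarrow> a \<in> A \<Longrightarrow> b \<in> A \<Longrightarrow> \<rho> a b Q = (if a = b then 1 else 0)"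
    unfolding reduced_rows_def by auto
  have fin: "finite A" using A assms(2) by (rule finite_subset)
  have rv: "reg D' (v i c)" if "i \<in> insert i0 I" "c \<in> C" for i c
    using insert.prems[OF that] D' reg_mono by blast
  \<comment> \<open>The row \<open>i0\<close> with its entries in the pivot columns cleared; by
    \<open>unit\<close> they vanish on all of \<open>D'\<close>, not only at
    \<open>P\<close>.\<close>
  define w where "w c Q = v i0 c Q - (\<Sum>a\<in>A. v i0 a Q * \<rho> a c Q)" for c Q
  have rw: "reg D' (w c)" if "c \<in> C" for c
    unfolding w_def using that A D'
    by (intro reg_diff reg_sum reg_mult rv r\<rho>) auto
  have wA: "w b Q = 0" if "Q \<in> D'" "b \<in> A" for b Q
    using that fin unit by (simp add: w_def if_distrib[of "(*) _"] cong: if_cong)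
  define \<gamma>0 where "\<gamma>0 a i = (if i = i0 then (\<lambda>Q. 0) else \<gamma> a i)" for a i
  have r\<gamma>0: "reg D' (\<gamma>0 a i)" if "a \<in> A" "i \<in> insert i0 I" for a i
    using that r\<gamma> D' by (auto simp: \<gamma>0_def reg_const)
  have comb0: "\<rho> a c Q = (\<Sum>i\<in>insert i0 I. \<gamma>0 a i Q * v i c Q)"
    if "Q \<in> D'" "a \<in> A" "c \<in> C" for Q a c
  proof -
    have "(\<Sum>i\<in>insert i0 I. \<gamma>0 a i Q * v i c Q) = (\<Sum>i\<in>I. \<gamma>0 a i Q * v i c Q)"
      using insert.hyps by (simp add: \<gamma>0_def)
    also have "\<dots> = (\<Sum>i\<in>I. \<gamma> a i Q * v i c Q)"
      using insert.hyps by (intro sum.cong) (auto simp: \<gamma>0_def)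
    finally show ?thesis using comb that by simp
  qed
  show ?case
  proof (cases "\<forall>c\<in>C. w c P = 0")
    \<comment> \<open>The remainder may be nonzero at points near \<open>P\<close>; it is dropped
      all the same, since only the rank at \<open>P\<close> is to be captured.\<close>
    case True
    then have "v i c P = (\<Sum>a\<in>A. v i a P * \<rho> a c P)" if "i \<in> insert i0 I" "c \<in> C" for i c
      using that span by (auto simp: w_def)
    moreover have "reduced_rows (insert i0 I) C v D' A \<rho> \<gamma>0"
      unfolding reduced_rows_def using A r\<rho> r\<gamma>0 comb0 unit by blast
    ultimately show ?thesis
      using D' by blast
  next
    case False
    then obtain c0 where c0: "c0 \<in> C" "w c0 P \<noteq> 0" by blast
    then have c0A: "c0 \<notin> A" using wA D' by blast
    \<comment> \<open>The neighbourhood shrinks only here, to where division by the new pivot is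
      possible.\<close>
    define D'' where "D'' = {Q\<in>D'. w c0 Q \<noteq> 0}"
    have D'': "opn D''" "P \<in> D''" "D'' \<subseteq> D'"
      using opn_nonzero[OF rw[OF c0(1)]] D' c0 by (auto simp: D''_def)
    have mono: "reg D'' f" if "reg D' f" for f
      using that D'' reg_mono by blast
    define \<rho>0 where "\<rho>0 c Q = inverse (w c0 Q) * w c Q" for c Q
    \<comment> \<open>Back substitution: the new row is normalised and then subtracted from the old
      rows so as to clear column \<open>c0\<close> there. \<open>\<gamma>1\<close> and
      \<open>\<gamma>'\<close> repeat these operations on the coefficients.\<close>
    define \<rho>' where "\<rho>' a c Q = (if a = c0 then \<rho>0 c Q else \<rho> a c Q - \<rho> a c0 Q * \<rho>0 c Q)"
      for a c Q
    define \<gamma>1 where "\<gamma>1 i Q =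
      inverse (w c0 Q) * ((if i = i0 then 1 else 0) - (\<Sum>a\<in>A. v i0 a Q * \<gamma>0 a i Q))" for i Q
    define \<gamma>' where "\<gamma>' a i Q = (if a = c0 then \<gamma>1 i Q else \<gamma>0 a i Q - \<rho> a c0 Q * \<gamma>1 i Q)"
      for a i Q
    have rinv: "reg D'' (\<lambda>Q. inverse (w c0 Q))"
      unfolding D''_def by (rule reg_inverse[OF rw[OF c0(1)]])
    have r\<rho>0: "reg D'' (\<rho>0 c)" if "c \<in> C" for c
      unfolding \<rho>0_def using that by (intro reg_mult rinv mono rw)
    have r\<gamma>1: "reg D'' (\<gamma>1 i)" if "i \<in> insert i0 I" for i
      unfolding \<gamma>1_def using that A D''(1)
      by (intro reg_mult reg_diff reg_const rinv reg_sum mono rv r\<gamma>0) auto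
    have n1: "reg D'' (\<rho>' a c)" if a: "a \<in> insert c0 A" and c: "c \<in> C" for a c
    proof (cases "a = c0")
      case True
      then have "\<rho>' a c = \<rho>0 c" by (simp add: \<rho>'_def fun_eq_iff)
      with r\<rho>0[OF c] show ?thesis by simp
    next
      case False
      then have "\<rho>' a c = (\<lambda>Q. \<rho> a c Q - \<rho> a c0 Q * \<rho>0 c Q)" by (simp add: \<rho>'_def fun_eq_iff)
      moreover have "reg D'' (\<lambda>Q. \<rho> a c Q - \<rho> a c0 Q * \<rho>0 c Q)"
        using False a c c0(1) by (intro reg_diff reg_mult r\<rho>0 mono r\<rho> D''(1)) auto
      ultimately show ?thesis by simp
    qed
    have n2: "reg D'' (\<gamma>' a i)" if a: "a \<in> insert c0 A" and i: "i \<in> insert i0 I" for a i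
    proof (cases "a = c0")
      case True
      then have "\<gamma>' a i = \<gamma>1 i" by (simp add: \<gamma>'_def fun_eq_iff)
      with r\<gamma>1[OF i] show ?thesis by simp
    next
      case False
      then have "\<gamma>' a i = (\<lambda>Q. \<gamma>0 a i Q - \<rho> a c0 Q * \<gamma>1 i Q)" by (simp add: \<gamma>'_def fun_eq_iff)
      moreover have "reg D'' (\<lambda>Q. \<gamma>0 a i Q - \<rho> a c0 Q * \<gamma>1 i Q)"
        using False a i c0(1) by (intro reg_diff reg_mult r\<gamma>1 mono r\<rho> r\<gamma>0 D''(1)) auto
      ultimately show ?thesis by simp
    qed
    have n3: "\<rho>' a c Q = (\<Sum>i\<in>insert i0 I. \<gamma>' a i Q * v i c Q)"
      if "Q \<in> D''" "a \<in> insert c0 A" "c \<in> C" for Q a c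
    proof -
      have Q: "Q \<in> D'" using that D'' by blast
      have *: "(\<Sum>i\<in>insert i0 I. \<gamma>1 i Q * v i c Q) = \<rho>0 c Q"
      proof -
        have "(\<Sum>i\<in>insert i0 I. \<gamma>1 i Q * v i c Q) = inverse (w c0 Q) *
          ((\<Sum>i\<in>insert i0 I. (if i = i0 then 1 else 0) * v i c Q)
           - (\<Sum>i\<in>insert i0 I. (\<Sum>a\<in>A. v i0 a Q * \<gamma>0 a i Q) * v i c Q))"
          unfolding sum_subtractf[symmetric] sum_distrib_left \<gamma>1_def
          by (intro sum.cong refl) (simp only: left_diff_distrib mult.assoc)
        also have "(\<Sum>i\<in>insert i0 I. (if i = i0 then 1 else 0) * v i c Q) = v i0 c Q"
          using insert.hyps by (simp add: if_distrib[of "\<lambda>y. y * _"] cong: if_cong)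
        also have "(\<Sum>i\<in>insert i0 I. (\<Sum>a\<in>A. v i0 a Q * \<gamma>0 a i Q) * v i c Q)
           = (\<Sum>a\<in>A. v i0 a Q * (\<Sum>i\<in>insert i0 I. \<gamma>0 a i Q * v i c Q))"
          unfolding sum_distrib_right sum_distrib_left by (subst sum.swap) (simp add: mult.assoc)
        also have "\<dots> = (\<Sum>a\<in>A. v i0 a Q * \<rho> a c Q)"
          using comb0[OF Q _ that(3)] by simp
        finally show ?thesis by (simp add: \<rho>0_def w_def)
      qed
      show ?thesis
      proof (cases "a = c0")
        case True
        then show ?thesis using * by (simp add: \<rho>'_def \<gamma>'_def)
      next
        case False
        then have "a \<in> A" using that by blast
        have "(\<Sum>i\<in>insert i0 I. \<gamma>' a i Q * v i c Q) = (\<Sum>i\<in>insert i0 I. \<gamma>0 a i Q * v i c Q)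
            - \<rho> a c0 Q * (\<Sum>i\<in>insert i0 I. \<gamma>1 i Q * v i c Q)"
          using False
          by (simp add: \<gamma>'_def left_diff_distrib sum_subtractf sum_distrib_left mult.assoc
              del: sum.insert)
        also have "\<dots> = \<rho> a c Q - \<rho> a c0 Q * \<rho>0 c Q"
          unfolding * comb0[OF Q \<open>a \<in> A\<close> that(3)] ..
        finally show ?thesis using False by (simp add: \<rho>'_def)
      qed
    qed
    have n4: "\<rho>' a b Q = (if a = b then 1 else 0)"
      if "Q \<in> D''" "a \<in> insert c0 A" "b \<in> insert c0 A" for Q a b
    proof -
      have Q: "Q \<in> D'" "w c0 Q \<noteq> 0" using that by (auto simp: D''_def)
      have "\<rho>0 b Q = (if b = c0 then 1 else 0)"
        using Q wA that(3) by (auto simp: \<rho>0_def)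
      then show ?thesis
        using that(2,3) c0A unit[OF Q(1)] by (cases "a = c0"; cases "b = c0") (simp_all add: \<rho>'_def)
    qed
    have "reduced_rows (insert i0 I) C v D'' (insert c0 A) \<rho>' \<gamma>'"
      unfolding reduced_rows_def by (intro conjI ballI n1 n2 n3 n4) (use A c0(1) in auto)
    moreover have "v i c P = (\<Sum>a\<in>insert c0 A. v i a P * \<rho>' a c P)"
      if "i \<in> insert i0 I" "c \<in> C" for i c
    proof -
      have "(\<Sum>a\<in>insert c0 A. v i a P * \<rho>' a c P)
          = v i c0 P * \<rho>0 c P + (\<Sum>a\<in>A. v i a P * (\<rho> a c P - \<rho> a c0 P * \<rho>0 c P))"
        using c0A fin by (auto simp: \<rho>'_def intro!: sum.cong)
      \<comment> \<open>The last bracket is the remainder of row \<open>i\<close> in column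
        \<open>c0\<close>: it is \<open>w c0 P\<close> for \<open>i = i0\<close> and vanishes for
        the earlier rows by \<open>span\<close>.\<close>
      also have "\<dots> = (\<Sum>a\<in>A. v i a P * \<rho> a c P)
          + (v i c0 P - (\<Sum>a\<in>A. v i a P * \<rho> a c0 P)) * \<rho>0 c P"
        by (simp add: algebra_simps sum_subtractf sum_distrib_left)
      also have "\<dots> = v i c P"
      proof (cases "i = i0")
        case True
        have "w c0 P * \<rho>0 c P = w c P" using c0 by (simp add: \<rho>0_def)
        then show ?thesis using True by (simp add: w_def)
      next
        case False
        then have "i \<in> I" using that by blast
        with span that(2) c0(1) show ?thesis by simp
      qed
      finally show ?thesis by simp
    qed
    ultimately show ?thesis
      using D' D'' by blast
  qed
qed

end

section \<open>Echelon bases and matrices\<close>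

text \<open>The rows of a reduced echelon matrix, as vectors with respect to a basis \<open>B\<close>.\<close>

definition echelon ::
    "('k::field \<Rightarrow> 'v::ab_group_add \<Rightarrow> 'v) \<Rightarrow> 'v set \<Rightarrow> 'v set \<Rightarrow> ('v \<Rightarrow> 'v) \<Rightarrow> bool" where
  "echelon scale B A y \<longleftrightarrow> \<not> Modules.module.dependent scale B \<and> finite B \<and> A \<subseteq> B \<and>
     (\<forall>a\<in>A. y a \<in> Modules.module.span scale B) \<and>
     (\<forall>a\<in>A. \<forall>b\<in>A. Modules.module.representation scale B (y a) b = (if a = b then 1 else 0))"

context vector_space
begin

text \<open>Coefficients are attached to indices, not to vectors, so repeated values of
  \<open>f\<close> do no harm.\<close>

lemma span_image_finite:
  assumes "finite I"
  shows "span (f ` I) = range (\<lambda>g. \<Sum>i\<in>I. g i *s f i)"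
proof
  show "span (f ` I) \<subseteq> range (\<lambda>g. \<Sum>i\<in>I. g i *s f i)"
  proof
    fix v assume "v \<in> span (f ` I)"
    then show "v \<in> range (\<lambda>g. \<Sum>i\<in>I. g i *s f i)"
    proof (induction rule: span_induct_alt)
      case base
      show ?case by (intro range_eqI[of _ _ "\<lambda>i. 0"]) simp
    next
      case (step c u v)
      then obtain i g where i: "i \<in> I" "u = f i" and g: "v = (\<Sum>i\<in>I. g i *s f i)" by auto
      have "(\<Sum>j\<in>I. (if j = i then c else 0) *s f j) = c *s f i"
        using i assms by (simp add: if_distrib[of "\<lambda>c. c *s _"] cong: if_cong)
      then show ?case
        unfolding i g by (intro range_eqI[of _ _ "\<lambda>j. (if j = i then c else 0) + g j"])
          (simp add: scale_left_distrib sum.distrib)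
    qed
  qed
next
  show "range (\<lambda>g. \<Sum>i\<in>I. g i *s f i) \<subseteq> span (f ` I)"
    by (clarify, intro span_sum span_scale span_base imageI)
qed

text \<open>Only \<open>y a\<close> contributes to the coordinate at the pivot \<open>a\<close>, so
  the coefficients of a combination can be read off in the ambient basis.\<close>

lemma echelon_representation:
  assumes "echelon scale B A y" "a \<in> A"
  shows "representation B (\<Sum>b\<in>A. g b *s y b) a = g a"
proof -
  have "finite A" using assms finite_subset by (auto simp: echelon_def)
  then show ?thesis
    using assms by (simp add: echelon_def representation_sum representation_scale span_scale
        if_distrib[of "(*) _"] cong: if_cong)
qed

lemma echelon_span:
  assumes "echelon scale B A y" "v \<in> span (y ` A)"
  shows "v = (\<Sum>a\<in>A. representation B v a *s y a)"
proof -
  have "finite A" using assms finite_subset by (auto simp: echelon_def)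
  then obtain g where "v = (\<Sum>a\<in>A. g a *s y a)" using assms(2) by (auto simp: span_image_finite)
  with echelon_representation[OF assms(1)] show ?thesis by simp
qed

text \<open>Pivot coordinates give independence, and also injectivity of \<open>y\<close> on
  \<open>A\<close>, so that no row is counted twice.\<close>

lemma dim_echelon:
  assumes "echelon scale B A y"
  shows "dim (span (y ` A)) = card A"
proof -
  have fin: "finite A" using assms finite_subset by (auto simp: echelon_def)
  have inj: "inj_on y A"
    using assms unfolding echelon_def inj_on_def by (metis zero_neq_one)
  have "\<not> dependent (y ` A)"
  proof (rule independent_if_scalars_zero)
    fix f v assume 0: "(\<Sum>v\<in>y ` A. f v *s v) = 0" and "v \<in> y ` A"
    then obtain a where a: "a \<in> A" "v = y a" by blast
    from 0 have "(\<Sum>b\<in>A. f (y b) *s y b) = 0" by (simp add: sum.reindex[OF inj])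
    with echelon_representation[OF assms a(1), of "\<lambda>b. f (y b)"] a(2) show "f v = 0"
      by (simp add: representation_zero)
  qed (use fin in simp)
  then show ?thesis by (simp add: dim_eq_card_independent card_image[OF inj])
qed

text \<open>Row reduction of a basis of \<open>U\<close>, obtained from local elimination over a
  single point. The pivots are what matters: they are coordinates onto which \<open>U\<close>
  projects isomorphically, and hence name a chart.\<close>

lemma echelon_basis:
  assumes "\<not> dependent B" "finite B" "U \<subseteq> span B" "subspace U"
  obtains A y where "echelon scale B A y" "span (y ` A) = U" "y ` A \<subseteq> U"
proof -
  \<comment> \<open>On the one-point type \<open>unit\<close> all sets count as open and all
    functions as regular, so the axioms are trivial; the point \<open>()\<close> takes the place of
    \<open>P\<close>.\<close>
  have triv: "regular_functions (\<lambda>_ :: unit set. True) (\<lambda>_ (_ :: unit \<Rightarrow> 'a). True)"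
    by (rule regular_functions.intro) (rule TrueI)+
  obtain J where J: "J \<subseteq> U" "\<not> dependent J" "U \<subseteq> span J" using basis_exists[of U] by metis
  have finJ: "finite J" using independent_span_bound[of B J] assms J by blast
  define v where "v u b = (\<lambda>_ :: unit. representation B u b)" for u b
  from regular_functions.local_elimination
    [of _ _ J B UNIV "()" v, OF triv finJ assms(2) TrueI UNIV_I TrueI]
  obtain A \<rho> \<gamma> D' where "() \<in> D'"
    and red: "regular_functions.reduced_rows (\<lambda>_ (_ :: unit \<Rightarrow> 'a). True) J B v D' A \<rho> \<gamma>"
    and v: "\<forall>u\<in>J. \<forall>b\<in>B. v u b () = (\<Sum>a\<in>A. v u a () * \<rho> a b ())"
    by blast
  then have A: "A \<subseteq> B"
    and comb: "\<And>a b. a \<in> A \<Longrightarrow> b \<in> B \<Longrightarrow> \<rho> a b () = (\<Sum>u\<in>J. \<gamma> a u () * v u b ())"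
    and unit: "\<And>a b. a \<in> A \<Longrightarrow> b \<in> A \<Longrightarrow> \<rho> a b () = (if a = b then 1 else 0)"
    by (auto simp: regular_functions.reduced_rows_def[OF triv])
  have rB: "(\<Sum>b\<in>B. representation B u b *s b) = u" if "u \<in> U" for u
    using sum_representation_eq[of B u B] assms that by blast
  define y where "y a = (\<Sum>u\<in>J. \<gamma> a u () *s u)" for a
  have yU: "y a \<in> U" for a
    using J assms(4) by (auto simp: y_def intro!: subspace_sum subspace_scale)
  have ry: "representation B (y a) b = \<rho> a b ()" if "a \<in> A" "b \<in> B" for a b
  proof -
    have "u \<in> span B" if "u \<in> J" for u using that J assms by blast
    then show ?thesis
      using comb[OF that] assms(1)
      by (simp add: y_def representation_sum representation_scale span_scale v_def)
  qed
  have ech: "echelon scale B A y"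
    using assms A ry unit yU unfolding echelon_def by (auto simp: subset_iff)
  have "u \<in> span (y ` A)" if u: "u \<in> J" for u
  proof -
    have "u = (\<Sum>b\<in>B. representation B u b *s b)" using u J rB by auto
    also have "\<dots> = (\<Sum>b\<in>B. (\<Sum>a\<in>A. representation B u a * representation B (y a) b) *s b)"
      using v u by (intro sum.cong refl) (simp add: v_def ry)
    also have "\<dots> = (\<Sum>a\<in>A. representation B u a *s (\<Sum>b\<in>B. representation B (y a) b *s b))"
      by (simp add: scale_sum_left scale_sum_right) (rule sum.swap)
    also have "\<dots> = (\<Sum>a\<in>A. representation B u a *s y a)" by (simp add: rB yU)
    finally have "u = (\<Sum>a\<in>A. representation B u a *s y a)" .
    moreover have "(\<Sum>a\<in>A. representation B u a *s y a) \<in> span (y ` A)"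
      by (intro span_sum span_scale span_base imageI)
    ultimately show ?thesis by simp
  qed
  then have "U \<subseteq> span (y ` A)" using J span_minimal[of J "span (y ` A)"] by auto
  moreover have "span (y ` A) \<subseteq> U" using yU assms(4) by (intro span_minimal) auto
  ultimately show thesis using that[OF ech] yU by blast
qed

end

lemma vector_space_alg_scale: "vector_space (alg_scale :: 'k::field \<Rightarrow> ('e::ab_group_add \<Rightarrow>\<^sub>0 'k) \<Rightarrow> _)"
  by unfold_locales
    (simp_all add: alg_scale_def algebra_simps single_add mult_single flip: mult.assoc)

interpretation alg: vector_space "alg_scale :: 'k::field \<Rightarrow> ('e::ab_group_add \<Rightarrow>\<^sub>0 'k) \<Rightarrow> _"
  by (rule vector_space_alg_scale)

section \<open>Inverses of square matrices over a field\<close>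

lemma invertible_mat_imp_det_nonzero:
  fixes A :: "'a::field mat"
  assumes "A \<in> carrier_mat m m" "invertible_mat A"
  shows "det A \<noteq> 0"
proof -
  from assms obtain B where B: "A * B = 1\<^sub>m m" "B * A = 1\<^sub>m (dim_row B)"
    by (auto simp: invertible_mat_def inverts_mat_def)
  from arg_cong[OF B(1), of dim_col] arg_cong[OF B(2), of dim_col] assms(1)
  have "B \<in> carrier_mat m m" by auto
  from det_mult[OF assms(1) this] B(1) show ?thesis by auto
qed

text \<open>The adjugate formula is chosen because its entries are polynomials in those of
  \<open>A\<close>, divided by one determinant; this is the form that coordinate changes between
  charts need.\<close>

lemma det_nonzero_inverse:
  fixes A :: "'a::field mat"
  assumes "A \<in> carrier_mat m m" "det A \<noteq> 0"
  defines "B \<equiv> inverse (det A) \<cdot>\<^sub>m adj_mat A"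
  shows "B \<in> carrier_mat m m" "A * B = 1\<^sub>m m" "B * A = 1\<^sub>m m"
proof -
  show "B \<in> carrier_mat m m" using adj_mat[OF assms(1)] by (simp add: B_def)
  have *: "inverse (det A) \<cdot>\<^sub>m (det A \<cdot>\<^sub>m 1\<^sub>m m) = 1\<^sub>m m"
    using assms(2) by (intro eq_matI) auto
  show "A * B = 1\<^sub>m m"
    using adj_mat[OF assms(1)] by (simp add: B_def mult_smult_distrib[OF assms(1)] *)
  show "B * A = 1\<^sub>m m"
    using assms(1) adj_mat[OF assms(1)] by (simp add: B_def mult_smult_assoc_mat[of _ m m] *)
qed

lemma det_nonzero_imp_invertible_mat:
  fixes A :: "'a::field mat"
  assumes "A \<in> carrier_mat m m" "det A \<noteq> 0"
  shows "invertible_mat A"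
  using assms(1) det_nonzero_inverse[OF assms] unfolding invertible_mat_def inverts_mat_def
  by (metis carrier_matD square_mat.simps)

section \<open>Points and charts of the Grassmannian\<close>

locale grassmannian_basis = grassmannian V x n r
  for V :: "('e::ab_group_add \<Rightarrow>\<^sub>0 'k::field) set" and x :: "nat \<Rightarrow> 'e \<Rightarrow>\<^sub>0 'k" and n r :: nat +
  assumes inj_x: "inj_on x {..<n}"
    and indep_x: "\<not> alg.dependent (x ` {..<n})"
    and V_eq: "V = alg.span (x ` {..<n})"
begin

section \<open>Matrices representing a plane\<close>

definition column :: "'k mat \<Rightarrow> nat \<Rightarrow> 'e \<Rightarrow>\<^sub>0 'k" where
  "column A j = (\<Sum>i<n. alg_scale (A $$ (i, j)) (x i))"

lemma represents_iff:
  "represents A U \<longleftrightarrow> A \<in> carrier_mat n r \<and> U = alg.span (column A ` {..<r})"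
  by (simp add: represents_def column_def[abs_def])

lemma representation_column:
  assumes "i < n"
  shows "alg.representation (x ` {..<n}) (column A j) (x i) = A $$ (i, j)"
proof -
  have eq: "x i = x i' \<longleftrightarrow> i = i'" if "i' < n" for i'
    using inj_x assms that by (auto simp: inj_on_def)
  have "alg.representation (x ` {..<n}) (column A j) (x i)
      = (\<Sum>i'<n. alg.representation (x ` {..<n}) (alg_scale (A $$ (i', j)) (x i')) (x i))"
    unfolding column_def
    by (subst alg.representation_sum[OF indep_x]) (auto intro: alg.span_scale alg.span_base)
  also have "\<dots> = (\<Sum>i'<n. A $$ (i', j) * (if i = i' then 1 else 0))"
    using eq by (intro sum.cong refl)
      (simp add: alg.representation_scale[OF indep_x] alg.representation_basis[OF indep_x] alg.span_base)
  also have "\<dots> = A $$ (i, j)" using assms by (simp add: if_distrib[of "(*) _"] cong: if_cong)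
  finally show ?thesis .
qed

lemma column_mult:
  assumes "A \<in> carrier_mat n r" "G \<in> carrier_mat r r" "j < r"
  shows "column (A * G) j = (\<Sum>k<r. alg_scale (G $$ (k, j)) (column A k))"
proof -
  have "column (A * G) j = (\<Sum>i<n. \<Sum>k<r. alg_scale (A $$ (i, k) * G $$ (k, j)) (x i))"
    using assms by (auto simp: column_def times_mat_def scalar_prod_def alg.scale_sum_left
        lessThan_atLeast0 intro!: sum.cong)
  also have "\<dots> = (\<Sum>k<r. alg_scale (G $$ (k, j)) (column A k))"
    by (subst sum.swap) (simp add: column_def alg.scale_sum_right mult.commute)
  finally show ?thesis .
qed

lemma column_eq_imp_eq:
  assumes "A \<in> carrier_mat n r" "B \<in> carrier_mat n r" "\<And>j. j < r \<Longrightarrow> column A j = column B j"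
  shows "A = B"
  using assms representation_column by (intro eq_matI) (auto, metis)

text \<open>Each column of \<open>B\<close> lies in the span of the columns of \<open>A\<close>, and
  \<open>G\<close> collects the coefficients. What later arguments need about \<open>G\<close> comes
  from comparing submatrices on the rows \<open>S\<close>.\<close>

lemma represents_unique_upto:
  assumes "represents A U" "represents B U"
  obtains G where "G \<in> carrier_mat r r" "B = A * G"
proof -
  have "\<forall>j\<in>{..<r}. \<exists>g. column B j = (\<Sum>k<r. alg_scale (g k) (column A k))"
  proof
    fix j assume "j \<in> {..<r}"
    then have "column B j \<in> U"
      using assms(2) by (auto simp: represents_iff intro: alg.span_base)
    then show "\<exists>g. column B j = (\<Sum>k<r. alg_scale (g k) (column A k))"
      using assms(1) by (auto simp: represents_iff alg.span_image_finite)
  qed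
  then obtain g where g: "\<And>j. j < r \<Longrightarrow> column B j = (\<Sum>k<r. alg_scale (g j k) (column A k))"
    by (metis lessThan_iff)
  define G where "G = mat r r (\<lambda>(k, j). g j k)"
  have G: "G \<in> carrier_mat r r" by (simp add: G_def)
  have "B = A * G"
    using assms G column_mult[of A G] g
    by (intro column_eq_imp_eq) (auto simp: represents_iff G_def intro!: mult_carrier_mat[of _ n r])
  with G show thesis by (rule that)
qed

text \<open>Column spans can only shrink under right multiplication; writing \<open>A\<close> as
  \<open>(A * G) * H\<close> gives the reverse inclusion.\<close>

lemma represents_mult:
  assumes "represents A U" "G \<in> carrier_mat r r" "H \<in> carrier_mat r r" "G * H = 1\<^sub>m r"
  shows "represents (A * G) U"
proof -
  have A: "A \<in> carrier_mat n r" and U: "U = alg.span (column A ` {..<r})"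
    using assms by (auto simp: represents_iff)
  have sub: "alg.span (column (B * F) ` {..<r}) \<subseteq> alg.span (column B ` {..<r})"
    if "B \<in> carrier_mat n r" "F \<in> carrier_mat r r" for B F
  proof -
    have "column (B * F) j \<in> alg.span (column B ` {..<r})" if "j < r" for j
      unfolding column_mult[OF \<open>B \<in> carrier_mat n r\<close> \<open>F \<in> carrier_mat r r\<close> that]
      by (intro alg.span_sum alg.span_scale alg.span_base imageI)
    then show ?thesis by (intro alg.span_minimal) auto
  qed
  have AG: "A * G \<in> carrier_mat n r" using A assms by simp
  have "A * G * H = A" using A assms by (simp add: assoc_mult_mat[of A n r G r H r])
  with sub[OF AG assms(3)] sub[OF A assms(2)] U AG show ?thesis by (simp add: represents_iff)
qed

text \<open>The first equation has the shape of the row count in \<open>dim_submatrix\<close>, which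
  is how it is used below.\<close>

lemma index_sets_card:
  assumes "S \<in> index_sets"
  shows "card {i. i < n \<and> i \<in> S} = r" "finite S" "card S = r"
proof -
  have "{i. i < n \<and> i \<in> S} = S" using assms by (auto simp: index_sets_def)
  then show "card {i. i < n \<and> i \<in> S} = r" "finite S" "card S = r"
    using assms finite_subset by (auto simp: index_sets_def)
qed

lemma pick_index_set:
  assumes "S \<in> index_sets" "i < r"
  shows "pick S i \<in> S" "pick S i < n"
  using assms pick_in_set[of i S] index_sets_card[OF assms(1)] by (auto simp: index_sets_def)

lemma pick_image:
  assumes "S \<in> index_sets"
  shows "pick S ` {..<r} = S"
proof
  show sub: "pick S ` {..<r} \<subseteq> S" using pick_index_set[OF assms] by auto
  have "strict_mono_on {..<r} (pick S)"
    using index_sets_card[OF assms] by (auto simp: strict_mono_on_def intro!: pick_mono)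
  then have "card (pick S ` {..<r}) = r" by (simp add: card_image strict_mono_on_imp_inj_on)
  then show "S \<subseteq> pick S ` {..<r}"
    using sub index_sets_card[OF assms] by (metis card_subset_eq order_refl)
qed

lemma submatrix_carrier:
  assumes "S \<in> index_sets" "A \<in> carrier_mat n r"
  shows "submatrix A S UNIV \<in> carrier_mat r r"
proof (rule carrier_matI)
  show "dim_row (submatrix A S UNIV) = r"
    unfolding dim_submatrix carrier_matD(1)[OF assms(2)] by (rule index_sets_card(1)[OF assms(1)])
  show "dim_col (submatrix A S UNIV) = r"
    unfolding dim_submatrix carrier_matD(2)[OF assms(2)] by simp
qed

lemma submatrix_entry:
  assumes "S \<in> index_sets" "A \<in> carrier_mat n r" "i < r" "j < r"
  shows "submatrix A S UNIV $$ (i, j) = A $$ (pick S i, j)"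
proof -
  have "i < card {i. i < dim_row A \<and> i \<in> S}"
    unfolding carrier_matD(1)[OF assms(2)] index_sets_card(1)[OF assms(1)] by (rule assms(3))
  moreover have "j < card {j. j < dim_col A \<and> j \<in> UNIV}"
    unfolding carrier_matD(2)[OF assms(2)] using assms(4) by simp
  ultimately have "submatrix A S UNIV $$ (i, j) = A $$ (pick S i, pick UNIV j)"
    by (rule submatrix_index)
  then show ?thesis by (simp only: pick_UNIV)
qed

lemma submatrix_mult:
  assumes "S \<in> index_sets" "A \<in> carrier_mat n r" "G \<in> carrier_mat r r"
  shows "submatrix (A * G) S UNIV = submatrix A S UNIV * G"
proof (rule eq_matI)
  have AG: "A * G \<in> carrier_mat n r" using assms by simp
  show "dim_row (submatrix (A * G) S UNIV) = dim_row (submatrix A S UNIV * G)"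
    "dim_col (submatrix (A * G) S UNIV) = dim_col (submatrix A S UNIV * G)"
    using submatrix_carrier[OF assms(1) AG] submatrix_carrier[OF assms(1,2)] assms(3) by auto
  fix i j assume "i < dim_row (submatrix A S UNIV * G)" "j < dim_col (submatrix A S UNIV * G)"
  then have ij: "i < r" "j < r" using submatrix_carrier[OF assms(1,2)] assms(3) by auto
  then show "submatrix (A * G) S UNIV $$ (i, j) = (submatrix A S UNIV * G) $$ (i, j)"
    using submatrix_carrier[OF assms(1,2)] assms(2,3) pick_index_set[OF assms(1)]
    by (simp add: submatrix_entry[OF assms(1) AG] submatrix_entry[OF assms(1,2)]
        scalar_prod_def)
qed

text \<open>The matrix inside the definition of \<open>Y\<close>, named so that whole matrices can
  be compared instead of single coordinates.\<close>

definition normal_form :: "nat set \<Rightarrow> ('e \<Rightarrow>\<^sub>0 'k) set \<Rightarrow> 'k mat" where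
  "normal_form S U = (THE A. represents A U \<and> submatrix A S UNIV = 1\<^sub>m r)"

lemma Y_normal_form: "Y S i j U = normal_form S U $$ (i, j)"
  by (simp add: Y_def normal_form_def)

text \<open>Another such matrix is \<open>A * G\<close>; restricted to the rows \<open>S\<close>,
  where both matrices are the identity, this equation forces \<open>G\<close> to be the
  identity.\<close>

lemma normal_form_eqI:
  assumes "S \<in> index_sets" "represents A U" "submatrix A S UNIV = 1\<^sub>m r"
  shows "normal_form S U = A"
  unfolding normal_form_def
proof (rule the_equality)
  fix B assume B: "represents B U \<and> submatrix B S UNIV = 1\<^sub>m r"
  with assms(2) obtain G where G: "G \<in> carrier_mat r r" "B = A * G"
    by (metis represents_unique_upto)
  have A: "A \<in> carrier_mat n r" using assms by (simp add: represents_iff)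
  from submatrix_mult[OF assms(1) A G(1)] B G assms(3) have "G = 1\<^sub>m r" by simp
  with A G show "B = A" by simp
qed (use assms in simp)

text \<open>A chart asks for some representative with invertible \<open>S\<close>-submatrix. Passing
  to another representative multiplies the determinant by that of \<open>G\<close>, so any
  representative decides.\<close>

lemma chart_iff_det:
  assumes "S \<in> index_sets" "U \<in> Gr" "represents A U"
  shows "U \<in> chart S \<longleftrightarrow> det (submatrix A S UNIV) \<noteq> 0"
proof
  have A: "A \<in> carrier_mat n r" using assms by (simp add: represents_iff)
  note sA = submatrix_carrier[OF assms(1) A]
  {
    assume "U \<in> chart S"
    then obtain B where B: "represents B U" "invertible_mat (submatrix B S UNIV)"
      by (auto simp: chart_def)
    with assms(3) obtain G where G: "G \<in> carrier_mat r r" "B = A * G"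
      by (metis represents_unique_upto)
    from B have sB: "submatrix B S UNIV \<in> carrier_mat r r"
      using submatrix_carrier[OF assms(1)] unfolding represents_iff by blast
    have "det (submatrix B S UNIV) = det (submatrix A S UNIV) * det G"
      using G submatrix_mult[OF assms(1) A G(1)] det_mult[OF sA G(1)] by simp
    with invertible_mat_imp_det_nonzero[OF sB B(2)] show "det (submatrix A S UNIV) \<noteq> 0" by auto
  }
  assume "det (submatrix A S UNIV) \<noteq> 0"
  with det_nonzero_imp_invertible_mat[OF sA] assms(2,3) show "U \<in> chart S"
    by (auto simp: chart_def)
qed

text \<open>A representative is normalised by the inverse of its \<open>S\<close>-submatrix. With an
  arbitrary \<open>A\<close> this yields the existence of normal forms; with the normal form of
  another chart as \<open>A\<close> it is the coordinate change between the charts.\<close>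

lemma normal_form_transition:
  assumes "S \<in> index_sets" "U \<in> chart S" "represents A U"
  shows "normal_form S U = A * (inverse (det (submatrix A S UNIV)) \<cdot>\<^sub>m adj_mat (submatrix A S UNIV))"
    (is "_ = A * ?G")
proof (rule normal_form_eqI[OF assms(1)])
  have A: "A \<in> carrier_mat n r" using assms by (simp add: represents_iff)
  have "U \<in> Gr" using assms by (simp add: chart_def)
  with assms have "det (submatrix A S UNIV) \<noteq> 0" by (simp add: chart_iff_det)
  note G = det_nonzero_inverse[OF submatrix_carrier[OF assms(1) A] this]
  show "represents (A * ?G) U"
    by (rule represents_mult[OF assms(3) G(1) submatrix_carrier[OF assms(1) A] G(3)])
  show "submatrix (A * ?G) S UNIV = 1\<^sub>m r"
    by (simp only: submatrix_mult[OF assms(1) A G(1)] G(2))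
qed

lemma normal_form:
  assumes "S \<in> index_sets" "U \<in> chart S"
  shows "represents (normal_form S U) U" "submatrix (normal_form S U) S UNIV = 1\<^sub>m r"
proof -
  obtain A where A: "represents A U" using assms by (auto simp: chart_def)
  then have A': "A \<in> carrier_mat n r" by (simp add: represents_iff)
  have "U \<in> Gr" using assms by (simp add: chart_def)
  with assms A have "det (submatrix A S UNIV) \<noteq> 0" by (simp add: chart_iff_det)
  note G = det_nonzero_inverse[OF submatrix_carrier[OF assms(1) A'] this]
  show "represents (normal_form S U) U"
    unfolding normal_form_transition[OF assms A]
    by (rule represents_mult[OF A G(1) submatrix_carrier[OF assms(1) A'] G(3)])
  show "submatrix (normal_form S U) S UNIV = 1\<^sub>m r"
    unfolding normal_form_transition[OF assms A]
    by (simp only: submatrix_mult[OF assms(1) A' G(1)] G(2))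
qed

lemma normal_form_carrier:
  assumes "S \<in> index_sets" "U \<in> chart S"
  shows "normal_form S U \<in> carrier_mat n r"
  using normal_form(1)[OF assms] by (simp add: represents_iff)

text \<open>Row reduction of \<open>U\<close> against the basis vectors \<open>x i\<close>: the
  pivots give \<open>S\<close>, and the reduced rows, written as columns, give a representative
  whose \<open>S\<close>-submatrix is already the identity.\<close>

lemma charts_cover:
  assumes "U \<in> Gr"
  obtains S where "S \<in> index_sets" "U \<in> chart S"
proof -
  have U: "U \<subseteq> alg.span (x ` {..<n})" "alg.subspace U" "alg.dim U = r"
    using assms V_eq by (auto simp: planes_def)
  obtain A y where ech: "echelon alg_scale (x ` {..<n}) A y" and span: "alg.span (y ` A) = U"
    and y: "y ` A \<subseteq> U"
    by (rule alg.echelon_basis[OF indep_x finite_imageI[OF finite_lessThan] U(1,2)])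
  define S where "S = {i. i < n \<and> x i \<in> A}"
  have "A = x ` S" using ech by (auto simp: S_def echelon_def)
  moreover have inj: "inj_on x S" using inj_x by (auto simp: S_def inj_on_def)
  ultimately have "card S = card A" by (simp add: card_image)
  also have "\<dots> = r" using alg.dim_echelon[OF ech] span U(3) by simp
  finally have S: "S \<in> index_sets" by (auto simp: index_sets_def S_def)
  note cards = index_sets_card[OF S]
  \<comment> \<open>The columns follow the order of \<open>pick S\<close>, in which
    \<open>submatrix\<close> also enumerates the rows indexed by \<open>S\<close>.\<close>
  define M where
    "M = mat n r (\<lambda>(i, j). alg.representation (x ` {..<n}) (y (x (pick S j))) (x i))"
  have M: "M \<in> carrier_mat n r" by (simp add: M_def)
  have col: "column M j = y (x (pick S j))" if j: "j < r" for j
  proof -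
    have "y (x (pick S j)) \<in> alg.span (x ` {..<n})"
      using pick_index_set[OF S j] y U(1) by (auto simp: S_def)
    then have "(\<Sum>b\<in>x ` {..<n}. alg_scale (alg.representation (x ` {..<n}) (y (x (pick S j))) b) b)
        = y (x (pick S j))"
      by (intro alg.sum_representation_eq indep_x) auto
    then show ?thesis using j by (simp add: sum.reindex[OF inj_x] column_def M_def)
  qed
  have "y ` A = (\<lambda>j. y (x (pick S j))) ` {..<r}"
    using \<open>A = x ` S\<close> pick_image[OF S] by (metis image_image)
  also have "\<dots> = column M ` {..<r}" using col by (intro image_cong) auto
  finally have "represents M U" using span M by (simp add: represents_iff)
  moreover have "submatrix M S UNIV = 1\<^sub>m r"
  proof (rule eq_matI)
    fix i j assume "i < dim_row (1\<^sub>m r :: 'k mat)" "j < dim_col (1\<^sub>m r :: 'k mat)"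
    then have ij: "i < r" "j < r" by auto
    have "x (pick S i) = x (pick S j) \<longleftrightarrow> pick S i = pick S j"
      using inj pick_index_set[OF S] ij by (auto simp: inj_on_def)
    also have "\<dots> \<longleftrightarrow> i = j"
      using ij cards by (metis linorder_neq_iff pick_mono)
    finally have "x (pick S i) = x (pick S j) \<longleftrightarrow> i = j" .
    moreover have "x (pick S i) \<in> A" "x (pick S j) \<in> A"
      using ij pick_index_set(1)[OF S] \<open>A = x ` S\<close> by auto
    moreover have "submatrix M S UNIV $$ (i, j)
        = alg.representation (x ` {..<n}) (y (x (pick S j))) (x (pick S i))"
      using ij pick_index_set(2)[OF S] by (simp add: submatrix_entry[OF S M ij]) (simp add: M_def)
    ultimately show "submatrix M S UNIV $$ (i, j) = 1\<^sub>m r $$ (i, j)"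
      using ij ech by (auto simp: echelon_def)
  qed (use submatrix_carrier[OF S M] in auto)
  ultimately have "U \<in> chart S"
    using assms chart_iff_det[OF S assms] by simp
  with S show thesis by (rule that)
qed

end

section \<open>Regular functions\<close>

context grassmannian_basis
begin

text \<open>\<open>coord_ring S\<close> contains only functions restricted to the chart. Restricting
  inside the predicate lets polynomials be combined as ordinary functions, whatever their values
  elsewhere.\<close>

definition polynomial_on :: "nat set \<Rightarrow> (('e \<Rightarrow>\<^sub>0 'k) set \<Rightarrow> 'k) \<Rightarrow> bool" where
  "polynomial_on S f \<longleftrightarrow> restrict f (chart S) \<in> coord_ring S"

lemma polynomial_const: "polynomial_on S (\<lambda>U. c)"
  unfolding polynomial_on_def by (rule coord_ring.const)

lemma polynomial_add:
  assumes "polynomial_on S f" "polynomial_on S g"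
  shows "polynomial_on S (\<lambda>U. f U + g U)"
  using coord_ring.add[OF assms[unfolded polynomial_on_def]]
  by (simp add: polynomial_on_def cong: restrict_cong)

lemma polynomial_mult:
  assumes "polynomial_on S f" "polynomial_on S g"
  shows "polynomial_on S (\<lambda>U. f U * g U)"
  using coord_ring.mult[OF assms[unfolded polynomial_on_def]]
  by (simp add: polynomial_on_def cong: restrict_cong)

lemma polynomial_cong:
  assumes "\<And>U. U \<in> chart S \<Longrightarrow> f U = g U"
  shows "polynomial_on S f \<longleftrightarrow> polynomial_on S g"
  using assms by (simp add: polynomial_on_def cong: restrict_cong)

lemma polynomial_sum:
  "(\<And>i. i \<in> I \<Longrightarrow> polynomial_on S (f i)) \<Longrightarrow> polynomial_on S (\<lambda>U. \<Sum>i\<in>I. f i U)"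
  by (induction I rule: infinite_finite_induct) (simp_all add: polynomial_const polynomial_add)

lemma polynomial_prod:
  "(\<And>i. i \<in> I \<Longrightarrow> polynomial_on S (f i)) \<Longrightarrow> polynomial_on S (\<lambda>U. \<Prod>i\<in>I. f i U)"
  by (induction I rule: infinite_finite_induct) (simp_all add: polynomial_const polynomial_mult)

lemma coord_ring_restrict:
  assumes "f \<in> coord_ring S"
  shows "restrict f (chart S) = f"
  using assms by cases (simp_all add: restrict_def fun_eq_iff)

lemma coord_ring_polynomial: "f \<in> coord_ring S \<Longrightarrow> polynomial_on S f"
  by (simp add: polynomial_on_def coord_ring_restrict)

text \<open>Only the entries in rows outside \<open>S\<close> are generators of the coordinate ring;
  the rows in \<open>S\<close> form an identity matrix, so their entries are constants.\<close>

lemma polynomial_normal_form: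
  assumes "S \<in> index_sets" "i < n" "j < r"
  shows "polynomial_on S (\<lambda>U. normal_form S U $$ (i, j))"
proof (cases "i \<in> S")
  case False
  then show ?thesis
    unfolding polynomial_on_def Y_normal_form[symmetric] by (rule coord_ring.coord[OF assms(2) _ assms(3)])
next
  case True
  then obtain k where k: "k < r" "i = pick S k" using pick_image[OF assms(1)] by auto
  have "normal_form S U $$ (i, j) = (1\<^sub>m r :: 'k mat) $$ (k, j)" if "U \<in> chart S" for U
    using submatrix_entry[OF assms(1) normal_form_carrier[OF assms(1) that] k(1) assms(3)]
      normal_form(2)[OF assms(1) that] k by simp
  then show ?thesis
    using polynomial_cong[of S "\<lambda>U. normal_form S U $$ (i, j)" "\<lambda>U. (1\<^sub>m r :: 'k mat) $$ (k, j)"]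
      polynomial_const by blast
qed

lemma polynomial_det:
  assumes "\<And>U. U \<in> chart S \<Longrightarrow> M U \<in> carrier_mat d d"
    and "\<And>i j. i < d \<Longrightarrow> j < d \<Longrightarrow> polynomial_on S (\<lambda>U. M U $$ (i, j))"
  shows "polynomial_on S (\<lambda>U. det (M U))"
proof -
  have "polynomial_on S (\<lambda>U. \<Sum>p\<in>{p. p permutes {0..<d}}. signof p * (\<Prod>i = 0..<d. M U $$ (i, p i)))"
    by (intro polynomial_sum polynomial_mult polynomial_const polynomial_prod assms(2))
      (auto dest: permutes_in_image)
  then show ?thesis
    using polynomial_cong[of S "\<lambda>U. det (M U)"] det_def'[OF assms(1)] by simp
qed

lemma polynomial_adj_mat:
  assumes M: "\<And>U. U \<in> chart S \<Longrightarrow> M U \<in> carrier_mat d d"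
    and p: "\<And>i j. i < d \<Longrightarrow> j < d \<Longrightarrow> polynomial_on S (\<lambda>U. M U $$ (i, j))"
    and ij: "i < d" "j < d"
  shows "polynomial_on S (\<lambda>U. adj_mat (M U) $$ (i, j))"
proof -
  have "polynomial_on S (\<lambda>U. det (mat_delete (M U) j i))"
  proof (rule polynomial_det)
    show "mat_delete (M U) j i \<in> carrier_mat (d - 1) (d - 1)" if "U \<in> chart S" for U
      using mat_delete_carrier[OF M[OF that]] .
    fix k l assume kl: "k < d - 1" "l < d - 1"
    have "polynomial_on S (\<lambda>U. M U $$ (if k < j then k else Suc k, if l < i then l else Suc l))"
      using kl by (intro p) auto
    then show "polynomial_on S (\<lambda>U. mat_delete (M U) j i $$ (k, l))"
      using kl polynomial_cong[of S "\<lambda>U. mat_delete (M U) j i $$ (k, l)"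
          "\<lambda>U. M U $$ (if k < j then k else Suc k, if l < i then l else Suc l)"]
      by (simp add: mat_delete_def carrier_matD[OF M])
  qed
  then have "polynomial_on S (\<lambda>U. (- 1) ^ (j + i) * det (mat_delete (M U) j i))"
    by (intro polynomial_mult polynomial_const)
  then show ?thesis
    using ij polynomial_cong[of S "\<lambda>U. adj_mat (M U) $$ (i, j)"
        "\<lambda>U. (- 1) ^ (j + i) * det (mat_delete (M U) j i)"]
    by (simp add: adj_mat_def cofactor_def carrier_matD[OF M])
qed

text \<open>The denominator comes from \<open>\<delta>\<close>, the determinant of the
  \<open>S'\<close>-rows of the normal form for \<open>S\<close>, which is nonzero exactly on the
  overlap. Along the generation of \<open>f\<close> from coordinates, sums and products multiply
  denominators and so keep their zero set.\<close>

lemma polynomial_transition: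
  assumes "S \<in> index_sets" "S' \<in> index_sets" "polynomial_on S' f"
  obtains a b where "polynomial_on S a" "polynomial_on S b"
    "\<forall>U\<in>chart S. b U \<noteq> 0 \<longleftrightarrow> U \<in> chart S'"
    "\<forall>U\<in>chart S \<inter> chart S'. f U = a U / b U"
proof -
  define N where "N U = submatrix (normal_form S U) S' UNIV" for U
  define \<delta> where "\<delta> U = det (N U)" for U
  have N: "N U \<in> carrier_mat r r" if "U \<in> chart S" for U
    unfolding N_def by (intro submatrix_carrier assms normal_form_carrier that)
  have pN: "polynomial_on S (\<lambda>U. N U $$ (i, j))" if "i < r" "j < r" for i j
  proof -
    have "N U $$ (i, j) = normal_form S U $$ (pick S' i, j)" if "U \<in> chart S" for U
      unfolding N_def
      by (intro submatrix_entry assms normal_form_carrier that \<open>i < r\<close> \<open>j < r\<close>)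
    then show ?thesis
      using polynomial_cong[of S "\<lambda>U. N U $$ (i, j)"] polynomial_normal_form[OF assms(1)]
        pick_index_set(2)[OF assms(2)] that by simp
  qed
  have p\<delta>: "polynomial_on S \<delta>"
    unfolding \<delta>_def by (rule polynomial_det[OF N pN])
  have \<delta>: "\<delta> U \<noteq> 0 \<longleftrightarrow> U \<in> chart S'" if "U \<in> chart S" for U
    using chart_iff_det[OF assms(2) _ normal_form(1)[OF assms(1) that]] that
    by (simp add: \<delta>_def N_def chart_def)
  have "\<exists>a b. polynomial_on S a \<and> polynomial_on S b \<and> (\<forall>U\<in>chart S. b U \<noteq> 0 \<longleftrightarrow> U \<in> chart S') \<and>
      (\<forall>U\<in>chart S \<inter> chart S'. g U = a U / b U)" if "g \<in> coord_ring S'" for g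
    using that
  proof (induction rule: coord_ring.induct)
    case (const c)
    \<comment> \<open>Even a constant gets the denominator \<open>\<delta>\<close>, because
      nonvanishing of the denominator has to describe the overlap.\<close>
    show ?case
      using \<delta> by (intro exI[of _ "\<lambda>U. c * \<delta> U"] exI[of _ \<delta>])
        (auto intro!: polynomial_mult polynomial_const p\<delta>)
  next
    case (coord i j)
    \<comment> \<open>An entry of the normal form for \<open>S\<close> times the adjugate; divided
      by \<open>\<delta>\<close> it is the entry of the normal form for \<open>S'\<close>.\<close>
    define a where "a U = (\<Sum>k<r. normal_form S U $$ (i, k) * adj_mat (N U) $$ (k, j))" for U
    have "polynomial_on S a"
      unfolding a_def using coord assms(1)
      by (intro polynomial_sum polynomial_mult polynomial_normal_form polynomial_adj_mat[OF N pN]) auto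
    moreover have "(\<lambda>U\<in>chart S'. Y S' i j U) U = a U / \<delta> U" if U: "U \<in> chart S \<inter> chart S'" for U
    proof -
      have nf: "normal_form S U \<in> carrier_mat n r" using U normal_form_carrier[OF assms(1)] by blast
      have adj: "adj_mat (N U) \<in> carrier_mat r r" using U adj_mat(1)[OF N] by blast
      have "normal_form S' U = normal_form S U * (inverse (\<delta> U) \<cdot>\<^sub>m adj_mat (N U))"
        using U normal_form_transition[OF assms(2) _ normal_form(1)[OF assms(1)]]
        by (simp add: \<delta>_def N_def)
      then have "normal_form S' U $$ (i, j)
          = (\<Sum>k<r. normal_form S U $$ (i, k) * (inverse (\<delta> U) * adj_mat (N U) $$ (k, j)))"
        using nf adj coord by (simp add: scalar_prod_def lessThan_atLeast0)
      also have "\<dots> = a U / \<delta> U"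
        by (simp add: a_def divide_inverse sum_distrib_left ac_simps)
      finally show ?thesis using U by (simp add: Y_normal_form)
    qed
    ultimately show ?case using p\<delta> \<delta> by blast
  next
    case (add f g)
    then obtain a b a' b' where ab: "polynomial_on S a" "polynomial_on S b"
      "\<forall>U\<in>chart S. (b U \<noteq> 0) = (U \<in> chart S')" "\<forall>U\<in>chart S \<inter> chart S'. f U = a U / b U"
      and ab': "polynomial_on S a'" "polynomial_on S b'"
      "\<forall>U\<in>chart S. (b' U \<noteq> 0) = (U \<in> chart S')" "\<forall>U\<in>chart S \<inter> chart S'. g U = a' U / b' U"
      by auto
    have "polynomial_on S (\<lambda>U. a U * b' U + a' U * b U)" "polynomial_on S (\<lambda>U. b U * b' U)"
      by (intro polynomial_add polynomial_mult ab ab')+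
    moreover have "\<forall>U\<in>chart S. (b U * b' U \<noteq> 0) = (U \<in> chart S')" using ab(3) ab'(3) by simp
    moreover have "\<forall>U\<in>chart S \<inter> chart S'. (\<lambda>U\<in>chart S'. f U + g U) U
        = (a U * b' U + a' U * b U) / (b U * b' U)"
      using ab(3,4) ab'(3,4) by (simp add: add_frac_eq)
    ultimately show ?case by blast
  next
    case (mult f g)
    then obtain a b a' b' where ab: "polynomial_on S a" "polynomial_on S b"
      "\<forall>U\<in>chart S. (b U \<noteq> 0) = (U \<in> chart S')" "\<forall>U\<in>chart S \<inter> chart S'. f U = a U / b U"
      and ab': "polynomial_on S a'" "polynomial_on S b'"
      "\<forall>U\<in>chart S. (b' U \<noteq> 0) = (U \<in> chart S')" "\<forall>U\<in>chart S \<inter> chart S'. g U = a' U / b' U"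
      by auto
    have "polynomial_on S (\<lambda>U. a U * a' U)" "polynomial_on S (\<lambda>U. b U * b' U)"
      by (intro polynomial_mult ab ab')+
    moreover have "\<forall>U\<in>chart S. (b U * b' U \<noteq> 0) = (U \<in> chart S')" using ab(3) ab'(3) by simp
    moreover have "\<forall>U\<in>chart S \<inter> chart S'. (\<lambda>U\<in>chart S'. f U * g U) U
        = (a U * a' U) / (b U * b' U)"
      using ab(4) ab'(4) by simp
    ultimately show ?case by blast
  qed
  from this[OF assms(3)[unfolded polynomial_on_def]] obtain a b where
    "polynomial_on S a" "polynomial_on S b" "\<forall>U\<in>chart S. b U \<noteq> 0 \<longleftrightarrow> U \<in> chart S'"
    "\<forall>U\<in>chart S \<inter> chart S'. restrict f (chart S') U = a U / b U" by blast
  then show thesis by (intro that[of a b]) auto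
qed

section \<open>Principal open sets and the Zariski topology\<close>

lemma principal_open_mult:
  "principal_open S (\<lambda>U. f U * g U) = principal_open S f \<inter> principal_open S g"
  by (auto simp: principal_open_def)

lemma principal_open_restrict: "principal_open S (restrict f (chart S)) = principal_open S f"
  by (auto simp: principal_open_def)

text \<open>The definition of \<open>zopen\<close> wants a principal neighbourhood in every chart
  through a point. One chart suffices, since a polynomial of one chart becomes a fraction on the
  other.\<close>

lemma zopen_iff:
  "zopen W \<longleftrightarrow> W \<subseteq> Gr \<and>
     (\<forall>P\<in>W. \<exists>S\<in>index_sets. \<exists>b. polynomial_on S b \<and> P \<in> principal_open S b \<and> principal_open S b \<subseteq> W)"
  (is "_ \<longleftrightarrow> _ \<and> ?local")
proof
  assume W: "zopen W"
  have ?local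
  proof
    fix P assume "P \<in> W"
    moreover from this W have "P \<in> Gr" by (auto simp: zopen_def)
    ultimately obtain S where "S \<in> index_sets" "P \<in> W \<inter> chart S" using charts_cover by blast
    with W show "\<exists>S\<in>index_sets. \<exists>b. polynomial_on S b \<and> P \<in> principal_open S b \<and> principal_open S b \<subseteq> W"
      unfolding zopen_def using coord_ring_polynomial by blast
  qed
  with W show "W \<subseteq> Gr \<and> ?local" by (simp add: zopen_def)
next
  assume W: "W \<subseteq> Gr \<and> ?local"
  show "zopen W"
    unfolding zopen_def
  proof (intro conjI ballI)
    show "W \<subseteq> Gr" using W by blast
    fix S P assume S: "S \<in> index_sets" and P: "P \<in> W \<inter> chart S"
    with W obtain S' b where S': "S' \<in> index_sets" and b: "polynomial_on S' b"
      "P \<in> principal_open S' b" "principal_open S' b \<subseteq> W" by blast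
    obtain a c where ac: "polynomial_on S a" "polynomial_on S c"
      "\<forall>U\<in>chart S. c U \<noteq> 0 \<longleftrightarrow> U \<in> chart S'"
      "\<forall>U\<in>chart S \<inter> chart S'. b U = a U / c U"
      by (rule polynomial_transition[OF S S' b(1)])
    \<comment> \<open>The factor \<open>c\<close> keeps the set inside the overlap of the charts;
      there \<open>a\<close> and \<open>b\<close> have the same zeros.\<close>
    have "principal_open S (\<lambda>U. a U * c U) \<subseteq> principal_open S' b"
      using ac(3,4) by (auto simp: principal_open_def)
    moreover have "P \<in> principal_open S (\<lambda>U. a U * c U)"
      using P b(2) ac(3,4) by (auto simp: principal_open_def)
    moreover have "restrict (\<lambda>U. a U * c U) (chart S) \<in> coord_ring S"
      using polynomial_mult[OF ac(1,2)] by (simp add: polynomial_on_def)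
    ultimately show "\<exists>g\<in>coord_ring S. P \<in> principal_open S g \<and> principal_open S g \<subseteq> W"
      using b(3) by (metis (no_types, lifting) principal_open_restrict order_trans)
  qed
qed

lemma zopen_principal_open:
  assumes "S \<in> index_sets" "polynomial_on S b"
  shows "zopen (principal_open S b)"
  using assms by (auto simp: zopen_iff principal_open_def chart_def)

lemma zopen_neighbourhood:
  assumes "zopen W" "P \<in> W" "S \<in> index_sets" "P \<in> chart S"
  obtains b where "polynomial_on S b" "P \<in> principal_open S b" "principal_open S b \<subseteq> W"
  using assms coord_ring_polynomial unfolding zopen_def by blast

lemma zopen_chart:
  assumes "S \<in> index_sets"
  shows "zopen (chart S)"
  using zopen_principal_open[OF assms polynomial_const[of S 1]] by (simp add: principal_open_def)

lemma zopen_Int: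
  assumes "zopen W" "zopen W'"
  shows "zopen (W \<inter> W')"
  unfolding zopen_iff
proof (intro conjI ballI)
  show "W \<inter> W' \<subseteq> Gr" using assms by (auto simp: zopen_def)
  fix P assume P: "P \<in> W \<inter> W'"
  with assms have "P \<in> Gr" by (auto simp: zopen_def)
  then obtain S where S: "S \<in> index_sets" "P \<in> chart S" by (rule charts_cover)
  from P obtain b where b: "polynomial_on S b" "P \<in> principal_open S b" "principal_open S b \<subseteq> W"
    using zopen_neighbourhood[OF assms(1) _ S] by blast
  from P obtain b' where b': "polynomial_on S b'" "P \<in> principal_open S b'" "principal_open S b' \<subseteq> W'"
    using zopen_neighbourhood[OF assms(2) _ S] by blast
  have "polynomial_on S (\<lambda>U. b U * b' U)" by (intro polynomial_mult b b')
  moreover have "P \<in> principal_open S (\<lambda>U. b U * b' U)"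
    "principal_open S (\<lambda>U. b U * b' U) \<subseteq> W \<inter> W'"
    using b b' by (auto simp: principal_open_mult)
  ultimately show "\<exists>S\<in>index_sets. \<exists>b. polynomial_on S b \<and> P \<in> principal_open S b \<and>
      principal_open S b \<subseteq> W \<inter> W'"
    using S(1) by blast
qed

text \<open>Members of \<open>\<O> W\<close> are extensional, so the function is cut down to
  \<open>W\<close> first. Including \<open>zopen W\<close> makes regularity carry the openness of
  the domain, as \<open>opn_nonzero\<close> requires.\<close>

definition regular :: "('e \<Rightarrow>\<^sub>0 'k) set set \<Rightarrow> (('e \<Rightarrow>\<^sub>0 'k) set \<Rightarrow> 'k) \<Rightarrow> bool" where
  "regular W f \<longleftrightarrow> zopen W \<and> restrict f W \<in> \<O> W"

text \<open>The denominator also cuts out the neighbourhood, so it never vanishes where the fraction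
  is used. Shrinking amounts to multiplying numerator and denominator by a further
  polynomial.\<close>

definition fraction_at ::
    "nat set \<Rightarrow> ('e \<Rightarrow>\<^sub>0 'k) set set \<Rightarrow> (('e \<Rightarrow>\<^sub>0 'k) set \<Rightarrow> 'k) \<Rightarrow> ('e \<Rightarrow>\<^sub>0 'k) set \<Rightarrow> bool" where
  "fraction_at S W f P \<longleftrightarrow> (\<exists>a b. polynomial_on S a \<and> polynomial_on S b \<and>
     P \<in> principal_open S b \<and> principal_open S b \<subseteq> W \<and>
     (\<forall>Q\<in>principal_open S b. f Q = a Q / b Q))"

text \<open>The quotient of \<open>a1 / c1\<close> by \<open>b1 / c2\<close> is cleared to
  \<open>a1 * c2\<close> over \<open>b1 * c1\<close>. The factor \<open>c1\<close> confines the
  neighbourhood to the overlap of the charts.\<close>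

lemma fraction_at_transition:
  assumes S: "S \<in> index_sets" and S': "S' \<in> index_sets" and P: "P \<in> chart S"
    and f: "fraction_at S' W f P"
  shows "fraction_at S W f P"
proof -
  from f obtain a b where ab: "polynomial_on S' a" "polynomial_on S' b" "P \<in> principal_open S' b"
    "principal_open S' b \<subseteq> W" "\<And>Q. Q \<in> principal_open S' b \<Longrightarrow> f Q = a Q / b Q"
    by (auto simp: fraction_at_def)
  obtain a1 c1 where a1: "polynomial_on S a1" "polynomial_on S c1"
    "\<forall>U\<in>chart S. c1 U \<noteq> 0 \<longleftrightarrow> U \<in> chart S'"
    "\<forall>U\<in>chart S \<inter> chart S'. a U = a1 U / c1 U"
    by (rule polynomial_transition[OF S S' ab(1)])
  obtain b1 c2 where b1: "polynomial_on S b1" "polynomial_on S c2"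
    "\<forall>U\<in>chart S. c2 U \<noteq> 0 \<longleftrightarrow> U \<in> chart S'"
    "\<forall>U\<in>chart S \<inter> chart S'. b U = b1 U / c2 U"
    by (rule polynomial_transition[OF S S' ab(2)])
  have Q: "Q \<in> principal_open S' b" "f Q = a1 Q * c2 Q / (b1 Q * c1 Q)"
    if "Q \<in> principal_open S (\<lambda>U. b1 U * c1 U)" for Q
  proof -
    from that have "Q \<in> chart S" "b1 Q \<noteq> 0" "c1 Q \<noteq> 0" by (auto simp: principal_open_def)
    with a1(3) b1(3) have cc: "Q \<in> chart S'" "c2 Q \<noteq> 0" by auto
    with \<open>Q \<in> chart S\<close> a1(4) b1(4) have *: "a Q = a1 Q / c1 Q" "b Q = b1 Q / c2 Q" by auto
    with \<open>b1 Q \<noteq> 0\<close> cc show "Q \<in> principal_open S' b" by (simp add: principal_open_def)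
    from ab(5)[OF this] show "f Q = a1 Q * c2 Q / (b1 Q * c1 Q)"
      using * by (simp add: mult.commute)
  qed
  have "P \<in> principal_open S (\<lambda>U. b1 U * c1 U)"
    using P ab(3) a1(3) b1(4) by (auto simp: principal_open_def)
  with Q ab(4) a1(1,2) b1(1,2) show ?thesis
    unfolding fraction_at_def
    by (intro exI[of _ "\<lambda>U. a1 U * c2 U"] exI[of _ "\<lambda>U. b1 U * c1 U"])
      (auto intro!: polynomial_mult)
qed

text \<open>\<open>\<O>\<close> speaks of fractions in every chart, on arbitrary open
  neighbourhoods; one chart and a principal neighbourhood suffice. The change of chart bridges the
  first gap, and expanding a fraction by a polynomial that defines a smaller neighbourhood the
  second.\<close>

lemma regular_iff:
  "regular W f \<longleftrightarrow> zopen W \<and> (\<forall>P\<in>W. \<exists>S\<in>index_sets. fraction_at S W f P)"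
proof
  assume reg: "regular W f"
  then have W: "zopen W" by (simp add: regular_def)
  moreover have "\<exists>S\<in>index_sets. fraction_at S W f P" if P: "P \<in> W" for P
  proof -
    have "P \<in> Gr" using W P by (auto simp: zopen_def)
    then obtain S where S: "S \<in> index_sets" "P \<in> chart S" by (rule charts_cover)
    with reg P obtain W' a b where W': "zopen W'" "P \<in> W'" "W' \<subseteq> W"
      and ab: "a \<in> coord_ring S" "b \<in> coord_ring S"
      and f: "\<forall>Q\<in>W'. b Q \<noteq> 0 \<and> restrict f W Q = a Q / b Q"
      unfolding regular_def \<O>_def by blast
    obtain g where g: "polynomial_on S g" "P \<in> principal_open S g" "principal_open S g \<subseteq> W'"
      using zopen_neighbourhood[OF W'(1,2) S] .
    have "\<forall>Q\<in>principal_open S (\<lambda>U. b U * g U). f Q = a Q * g Q / (b Q * g Q)"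
    proof
      fix Q assume "Q \<in> principal_open S (\<lambda>U. b U * g U)"
      then have "Q \<in> principal_open S g" "g Q \<noteq> 0" by (auto simp: principal_open_def)
      with g(3) W'(3) have "Q \<in> W'" "Q \<in> W" by auto
      with f \<open>g Q \<noteq> 0\<close> show "f Q = a Q * g Q / (b Q * g Q)" by auto
    qed
    moreover have "polynomial_on S (\<lambda>U. a U * g U)" "polynomial_on S (\<lambda>U. b U * g U)"
      by (intro polynomial_mult coord_ring_polynomial ab g)+
    moreover have "P \<in> principal_open S (\<lambda>U. b U * g U)"
      using f g W' S by (auto simp: principal_open_def)
    moreover have "principal_open S (\<lambda>U. b U * g U) \<subseteq> W"
      using g W' by (auto simp: principal_open_mult)
    ultimately show ?thesis unfolding fraction_at_def using S by blast
  qed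
  ultimately show "zopen W \<and> (\<forall>P\<in>W. \<exists>S\<in>index_sets. fraction_at S W f P)" by blast
next
  assume f: "zopen W \<and> (\<forall>P\<in>W. \<exists>S\<in>index_sets. fraction_at S W f P)"
  have "\<exists>W'. zopen W' \<and> P \<in> W' \<and> W' \<subseteq> W \<inter> chart S \<and>
       (\<exists>a\<in>coord_ring S. \<exists>b\<in>coord_ring S. \<forall>Q\<in>W'. b Q \<noteq> 0 \<and> restrict f W Q = a Q / b Q)"
    if S: "S \<in> index_sets" and P: "P \<in> W \<inter> chart S" for S P
  proof -
    from f P fraction_at_transition[OF S] have "fraction_at S W f P" by blast
    then obtain a b where ab: "polynomial_on S a" "polynomial_on S b" "P \<in> principal_open S b"
      "principal_open S b \<subseteq> W" "\<And>Q. Q \<in> principal_open S b \<Longrightarrow> f Q = a Q / b Q"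
      by (auto simp: fraction_at_def)
    have *: "\<forall>Q\<in>principal_open S b. restrict b (chart S) Q \<noteq> 0 \<and>
        restrict f W Q = restrict a (chart S) Q / restrict b (chart S) Q"
      using ab(4,5) by (auto simp: principal_open_def subset_iff)
    show ?thesis
      using zopen_principal_open[OF S ab(2)] ab(1-4) *
      unfolding polynomial_on_def
      by (intro exI[of _ "principal_open S b"] conjI bexI[of _ "restrict a (chart S)"]
          bexI[of _ "restrict b (chart S)"]) (auto simp: principal_open_def)
  qed
  with f show "regular W f" by (auto simp: regular_def \<O>_def)
qed

lemma regular_fraction_at:
  assumes "regular W f" "P \<in> W" "S \<in> index_sets" "P \<in> chart S"
  shows "fraction_at S W f P"
  using assms fraction_at_transition unfolding regular_iff by blast

lemma regular_const:
  assumes "zopen W"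
  shows "regular W (\<lambda>U. c)"
  unfolding regular_iff
proof (intro conjI ballI assms)
  fix P assume "P \<in> W"
  with assms obtain S b where S: "S \<in> index_sets" and b: "polynomial_on S b"
    "P \<in> principal_open S b" "principal_open S b \<subseteq> W" unfolding zopen_iff by blast
  then have "fraction_at S W (\<lambda>U. c) P"
    unfolding fraction_at_def
    by (intro exI[of _ "\<lambda>U. c * b U"] exI[of _ b])
      (auto intro!: polynomial_mult polynomial_const simp: principal_open_def)
  with S show "\<exists>S\<in>index_sets. fraction_at S W (\<lambda>U. c) P" by blast
qed

lemma regular_add_mult:
  assumes f: "regular W f" and g: "regular W g"
  shows "regular W (\<lambda>U. f U + g U)" and "regular W (\<lambda>U. f U * g U)"
proof -
  have W: "zopen W" using f by (simp add: regular_iff)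
  have "\<exists>S\<in>index_sets. fraction_at S W (\<lambda>U. f U + g U) P \<and> fraction_at S W (\<lambda>U. f U * g U) P"
    if P: "P \<in> W" for P
  proof -
    have "P \<in> Gr" using W P by (auto simp: zopen_def)
    then obtain S where S: "S \<in> index_sets" "P \<in> chart S" by (rule charts_cover)
    from regular_fraction_at[OF f P S] obtain a b
      where a: "polynomial_on S a" "polynomial_on S b" "P \<in> principal_open S b"
        "principal_open S b \<subseteq> W" "\<And>Q. Q \<in> principal_open S b \<Longrightarrow> f Q = a Q / b Q"
      by (auto simp: fraction_at_def)
    from regular_fraction_at[OF g P S] obtain c d
      where c: "polynomial_on S c" "polynomial_on S d" "P \<in> principal_open S d"
        "principal_open S d \<subseteq> W" "\<And>Q. Q \<in> principal_open S d \<Longrightarrow> g Q = c Q / d Q"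
      by (auto simp: fraction_at_def)
    have "fraction_at S W (\<lambda>U. f U + g U) P"
      unfolding fraction_at_def
    proof (intro exI conjI ballI)
      show "polynomial_on S (\<lambda>U. a U * d U + c U * b U)" "polynomial_on S (\<lambda>U. b U * d U)"
        by (intro polynomial_add polynomial_mult a c)+
      show "P \<in> principal_open S (\<lambda>U. b U * d U)" "principal_open S (\<lambda>U. b U * d U) \<subseteq> W"
        using a c by (auto simp: principal_open_mult)
      show "f Q + g Q = (a Q * d Q + c Q * b Q) / (b Q * d Q)"
        if "Q \<in> principal_open S (\<lambda>U. b U * d U)" for Q
        using that a(5) c(5) by (auto simp: principal_open_mult) (auto simp: principal_open_def add_frac_eq)
    qed
    moreover have "fraction_at S W (\<lambda>U. f U * g U) P"
      unfolding fraction_at_def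
    proof (intro exI conjI ballI)
      show "polynomial_on S (\<lambda>U. a U * c U)" "polynomial_on S (\<lambda>U. b U * d U)"
        by (intro polynomial_mult a c)+
      show "P \<in> principal_open S (\<lambda>U. b U * d U)" "principal_open S (\<lambda>U. b U * d U) \<subseteq> W"
        using a c by (auto simp: principal_open_mult)
      show "f Q * g Q = (a Q * c Q) / (b Q * d Q)"
        if "Q \<in> principal_open S (\<lambda>U. b U * d U)" for Q
        using that a(5) c(5) by (auto simp: principal_open_mult)
    qed
    ultimately show ?thesis using S(1) by blast
  qed
  with W show "regular W (\<lambda>U. f U + g U)" and "regular W (\<lambda>U. f U * g U)"
    unfolding regular_iff by blast+
qed

lemma regular_local:
  assumes "zopen W" "\<And>P. P \<in> W \<Longrightarrow> \<exists>W'. P \<in> W' \<and> W' \<subseteq> W \<and> regular W' f"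
  shows "regular W f"
  unfolding regular_iff
proof (intro conjI ballI assms(1))
  fix P assume "P \<in> W"
  then obtain W' where "P \<in> W'" "W' \<subseteq> W" "regular W' f" using assms(2) by blast
  then show "\<exists>S\<in>index_sets. fraction_at S W f P"
    unfolding regular_iff fraction_at_def by (meson order_trans)
qed

lemma regular_mono:
  assumes "regular W f" "zopen W'" "W' \<subseteq> W"
  shows "regular W' f"
  unfolding regular_iff
proof (intro conjI ballI assms(2))
  fix P assume P: "P \<in> W'"
  with assms obtain S where S: "S \<in> index_sets" and "fraction_at S W f P"
    unfolding regular_iff by blast
  then obtain a b where ab: "polynomial_on S a" "polynomial_on S b" "P \<in> principal_open S b"
    "principal_open S b \<subseteq> W" "\<And>Q. Q \<in> principal_open S b \<Longrightarrow> f Q = a Q / b Q"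
    by (auto simp: fraction_at_def)
  then have "P \<in> chart S" by (simp add: principal_open_def)
  then obtain g where g: "polynomial_on S g" "P \<in> principal_open S g" "principal_open S g \<subseteq> W'"
    using zopen_neighbourhood[OF assms(2) P S] by blast
  have "fraction_at S W' f P"
    unfolding fraction_at_def
  proof (intro exI conjI ballI)
    show "polynomial_on S (\<lambda>U. a U * g U)" "polynomial_on S (\<lambda>U. b U * g U)"
      by (intro polynomial_mult ab g)+
    show "P \<in> principal_open S (\<lambda>U. b U * g U)" "principal_open S (\<lambda>U. b U * g U) \<subseteq> W'"
      using ab g by (auto simp: principal_open_mult)
    show "f Q = a Q * g Q / (b Q * g Q)" if "Q \<in> principal_open S (\<lambda>U. b U * g U)" for Q
      using that ab(5) by (auto simp: principal_open_mult) (auto simp: principal_open_def)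
  qed
  with S show "\<exists>S\<in>index_sets. fraction_at S W' f P" by blast
qed

lemma regular_cong:
  assumes "\<And>Q. Q \<in> W \<Longrightarrow> f Q = g Q"
  shows "regular W f \<longleftrightarrow> regular W g"
  using assms by (simp add: regular_def cong: restrict_cong)

text \<open>Where \<open>f\<close> is a fraction \<open>a / b\<close>, its nonzero locus is locally
  the principal open set of \<open>a * b\<close>.\<close>

lemma regular_inverse:
  assumes f: "regular W f"
  shows "zopen {Q\<in>W. f Q \<noteq> 0}" and "regular {Q\<in>W. f Q \<noteq> 0} (\<lambda>Q. inverse (f Q))"
proof -
  let ?D = "{Q\<in>W. f Q \<noteq> 0}"
  have *: "\<exists>S\<in>index_sets. (\<exists>b. polynomial_on S b \<and> P \<in> principal_open S b \<and> principal_open S b \<subseteq> ?D)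
      \<and> fraction_at S ?D (\<lambda>Q. inverse (f Q)) P" if "P \<in> ?D" for P
  proof -
    from that f obtain S where S: "S \<in> index_sets" and "fraction_at S W f P"
      unfolding regular_iff by blast
    then obtain a b where ab: "polynomial_on S a" "polynomial_on S b" "P \<in> principal_open S b"
      "principal_open S b \<subseteq> W" and f: "\<And>Q. Q \<in> principal_open S b \<Longrightarrow> f Q = a Q / b Q"
      by (auto simp: fraction_at_def)
    have D: "principal_open S (\<lambda>U. a U * b U) \<subseteq> ?D"
      using ab(4) f by (auto simp: principal_open_mult) (auto simp: principal_open_def)
    have P: "P \<in> principal_open S (\<lambda>U. a U * b U)"
      using ab(3) f[of P] that by (auto simp: principal_open_def)
    \<comment> \<open>The inverse \<open>b / a\<close> is expanded by \<open>b\<close> so that its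
      denominator cuts out a set on which \<open>f\<close> is known to be the fraction.\<close>
    have "\<forall>Q\<in>principal_open S (\<lambda>U. a U * b U). inverse (f Q) = (b Q * b Q) / (a Q * b Q)"
      using f by (auto simp: principal_open_mult)
    moreover have "polynomial_on S (\<lambda>U. b U * b U)" "polynomial_on S (\<lambda>U. a U * b U)"
      by (intro polynomial_mult ab)+
    ultimately show ?thesis using S P D unfolding fraction_at_def by blast
  qed
  have "W \<subseteq> Gr" using f by (auto simp: regular_iff zopen_def)
  then show D: "zopen ?D" unfolding zopen_iff using * by (intro conjI) blast+
  show "regular ?D (\<lambda>Q. inverse (f Q))"
    unfolding regular_iff using D * by (intro conjI ballI) blast+
qed

sublocale regular_functions zopen regular
  by (rule regular_functions.intro)
    (fact regular_const regular_add_mult regular_mono regular_inverse)+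

lemma polynomial_regular:
  assumes "S \<in> index_sets" "polynomial_on S f" "zopen W" "W \<subseteq> chart S"
  shows "regular W f"
proof (rule regular_mono[OF _ assms(3,4)])
  have "fraction_at S (chart S) f P" if "P \<in> chart S" for P
    unfolding fraction_at_def using assms(2) that
    by (intro exI[of _ f] exI[of _ "\<lambda>U. 1"]) (auto simp: polynomial_const principal_open_def)
  then show "regular (chart S) f"
    unfolding regular_iff using zopen_chart assms(1) by blast
qed

text \<open>In \<open>assoc_sheaf\<close> a vector-valued section is divided by a single function,
  so its finitely many coordinates need one denominator near \<open>P\<close>. Each new function
  multiplies the denominator, and the earlier numerators absorb the same factor.\<close>

lemma common_denominator:
  assumes "finite C" "zopen W" "P \<in> W" "S \<in> index_sets" "P \<in> chart S"
    and "\<And>c. c \<in> C \<Longrightarrow> regular W (f c)"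
  shows "\<exists>b \<alpha>. polynomial_on S b \<and> (\<forall>c\<in>C. polynomial_on S (\<alpha> c)) \<and> P \<in> principal_open S b \<and>
     principal_open S b \<subseteq> W \<and> (\<forall>c\<in>C. \<forall>Q\<in>principal_open S b. f c Q = \<alpha> c Q / b Q)"
  using assms(1,6)
proof (induction C)
  case empty
  show ?case using zopen_neighbourhood[OF assms(2-5)] by auto
next
  case (insert c0 C)
  from insert.IH[OF insert.prems[OF insertI2]]
  obtain b \<alpha> where b: "polynomial_on S b" "P \<in> principal_open S b" "principal_open S b \<subseteq> W"
    and \<alpha>: "\<forall>c\<in>C. polynomial_on S (\<alpha> c)"
    and f: "\<forall>c\<in>C. \<forall>Q\<in>principal_open S b. f c Q = \<alpha> c Q / b Q"
    by blast
  have "fraction_at S W (f c0) P" using insert.prems assms(3-5) by (intro regular_fraction_at) auto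
  then obtain a0 b0 where a0: "polynomial_on S a0" "polynomial_on S b0" "P \<in> principal_open S b0"
    "principal_open S b0 \<subseteq> W" "\<And>Q. Q \<in> principal_open S b0 \<Longrightarrow> f c0 Q = a0 Q / b0 Q"
    by (auto simp: fraction_at_def)
  define \<beta> where "\<beta> c = (if c = c0 then (\<lambda>U. a0 U * b U) else (\<lambda>U. \<alpha> c U * b0 U))" for c
  show ?case
  proof (intro exI conjI ballI)
    show "polynomial_on S (\<lambda>U. b U * b0 U)" by (intro polynomial_mult b a0)
    show "polynomial_on S (\<beta> c)" if "c \<in> insert c0 C" for c
      using that \<alpha> by (auto simp: \<beta>_def intro!: polynomial_mult b a0)
    show "P \<in> principal_open S (\<lambda>U. b U * b0 U)" "principal_open S (\<lambda>U. b U * b0 U) \<subseteq> W"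
      using b a0 by (auto simp: principal_open_mult)
    show "f c Q = \<beta> c Q / (b Q * b0 Q)"
      if "c \<in> insert c0 C" "Q \<in> principal_open S (\<lambda>U. b U * b0 U)" for c Q
      using that a0(5) f insert.hyps(2)
      by (auto simp: \<beta>_def principal_open_mult) (auto simp: principal_open_def)
  qed
qed

end

section \<open>Subsheaves given by their fibres\<close>

lemma vector_space_restr_scale:
  fixes act :: "('e::ab_group_add \<Rightarrow>\<^sub>0 'k::field) \<Rightarrow> 'm::ab_group_add \<Rightarrow> 'm"
  assumes "Modules.module act"
  shows "vector_space (restr_scale act)"
proof -
  interpret a: Modules.module act by (rule assms)
  show ?thesis
    by unfold_locales (simp_all add: restr_scale_def a.scale_right_distrib a.scale_left_distrib
        single_add mult_single)
qed

locale grassmannian_module = grassmannian_basis V x n r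
  for V :: "('e::ab_group_add \<Rightarrow>\<^sub>0 'k::field) set" and x :: "nat \<Rightarrow> 'e \<Rightarrow>\<^sub>0 'k" and n r :: nat +
  fixes act :: "('e \<Rightarrow>\<^sub>0 'k) \<Rightarrow> 'm::ab_group_add \<Rightarrow> 'm" and B :: "'m set"
  assumes module_act: "Modules.module act"
    and finite_B: "finite B"
    and indep_B: "\<not> Modules.module.dependent (restr_scale act) B"
    and span_B: "Modules.module.span (restr_scale act) B = UNIV"
begin

sublocale m: vector_space "restr_scale act"
  by (rule vector_space_restr_scale[OF module_act])

sublocale act: Modules.module act
  by (rule module_act)

abbreviation sc :: "'k \<Rightarrow> 'm \<Rightarrow> 'm" where "sc \<equiv> restr_scale act"

text \<open>The order of arguments makes \<open>cf b\<close> the linear form dual to a basis vector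
  \<open>b\<close>.\<close>

definition cf :: "'m \<Rightarrow> 'm \<Rightarrow> 'k" where
  "cf b u = m.representation B u b"

lemma cf_add: "cf b (u + v) = cf b u + cf b v"
  by (simp add: cf_def m.representation_add[OF indep_B] span_B)

lemma cf_zero: "cf b 0 = 0"
  by (simp add: cf_def m.representation_zero)

lemma cf_scale: "cf b (sc c u) = c * cf b u"
  by (simp add: cf_def m.representation_scale[OF indep_B] span_B)

lemma cf_sum: "cf b (\<Sum>i\<in>I. f i) = (\<Sum>i\<in>I. cf b (f i))"
  by (simp add: cf_def m.representation_sum[OF indep_B] span_B)

lemma cf_basis: "b \<in> B \<Longrightarrow> cf c b = (if c = b then 1 else 0)"
  by (simp add: cf_def m.representation_basis[OF indep_B])

lemma cf_expand: "(\<Sum>b\<in>B. sc (cf b u) b) = u"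
  unfolding cf_def by (rule m.sum_representation_eq) (simp_all add: indep_B span_B finite_B)

lemma cf_eqI:
  assumes "\<And>b. b \<in> B \<Longrightarrow> cf b u = cf b v"
  shows "u = v"
proof -
  have "(\<Sum>b\<in>B. sc (cf b u) b) = (\<Sum>b\<in>B. sc (cf b v) b)" using assms by simp
  then show ?thesis by (simp add: cf_expand)
qed

text \<open>Expansion in \<open>B\<close> turns elements of the tensor product into vectors of
  functions in \<open>R\<close>. The ring is left abstract because this serves both
  \<open>\<O>\<close> on an open set and the coordinate ring of a chart.\<close>

lemma tensor_iff:
  assumes const: "\<And>c. (\<lambda>P\<in>D. c) \<in> R"
    and add: "\<And>f g. f \<in> R \<Longrightarrow> g \<in> R \<Longrightarrow> (\<lambda>P\<in>D. f P + g P) \<in> R"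
    and mult: "\<And>f g. f \<in> R \<Longrightarrow> g \<in> R \<Longrightarrow> (\<lambda>P\<in>D. f P * g P) \<in> R"
  shows "s \<in> tensor act R D \<longleftrightarrow> s \<in> extensional D \<and> (\<forall>b\<in>B. (\<lambda>P\<in>D. cf b (s P)) \<in> R)"
proof
  assume "s \<in> tensor act R D"
  then obtain N :: nat and f m where f: "\<forall>a<N. f a \<in> R"
    and s: "s = (\<lambda>P\<in>D. \<Sum>a<N. sc (f a P) (m a))"
    unfolding tensor_def by blast
  have "(\<lambda>P\<in>D. cf b (s P)) \<in> R" for b
  proof -
    \<comment> \<open>The closure assumptions concern restricted functions, two at a time, hence the
      induction on the number of summands.\<close>
    have "(\<lambda>P\<in>D. \<Sum>a<k. f a P * cf b (m a)) \<in> R" if "k \<le> N" for k :: nat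
      using that
    proof (induction k)
      case 0
      show ?case using const[of 0] by (simp only: lessThan_0 sum.empty)
    next
      case (Suc k)
      have "(\<lambda>P\<in>D. \<Sum>a<Suc k. f a P * cf b (m a)) =
          (\<lambda>P\<in>D. (\<lambda>P\<in>D. \<Sum>a<k. f a P * cf b (m a)) P
          + (\<lambda>P\<in>D. f k P * (\<lambda>P\<in>D. cf b (m k)) P) P)"
        by (rule restrict_ext) simp
      also have "\<dots> \<in> R"
        using f Suc.prems by (intro add mult const Suc.IH) auto
      finally show ?case .
    qed
    from this[of N] show ?thesis by (simp add: s cf_sum cf_scale cong: restrict_cong)
  qed
  then show "s \<in> extensional D \<and> (\<forall>b\<in>B. (\<lambda>P\<in>D. cf b (s P)) \<in> R)" by (simp add: s)
next
  assume s: "s \<in> extensional D \<and> (\<forall>b\<in>B. (\<lambda>P\<in>D. cf b (s P)) \<in> R)"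
  \<comment> \<open>\<open>tensor\<close> indexes its sums by natural numbers, hence an enumeration
    of the basis.\<close>
  obtain e where e: "bij_betw e {..<card B} B"
    using ex_bij_betw_nat_finite[OF finite_B] by (auto simp: lessThan_atLeast0)
  define f where "f a = (\<lambda>P\<in>D. cf (e a) (s P))" for a
  have "f a \<in> R" if "a < card B" for a
    using s bij_betwE[OF e] that by (auto simp: f_def)
  moreover have "s = (\<lambda>P\<in>D. \<Sum>a<card B. sc (f a P) (e a))"
  proof
    fix P
    have "(\<Sum>a<card B. sc (cf (e a) (s P)) (e a)) = s P"
      by (subst sum.reindex_bij_betw[OF e, of "\<lambda>b. sc (cf b (s P)) b"]) (rule cf_expand)
    then show "s P = (\<lambda>P\<in>D. \<Sum>a<card B. sc (f a P) (e a)) P"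
      using s by (simp add: f_def extensional_def)
  qed
  ultimately show "s \<in> tensor act R D" unfolding tensor_def by blast
qed

lemma \<O>_iff: "zopen W \<Longrightarrow> f \<in> \<O> W \<longleftrightarrow> f \<in> extensional W \<and> regular W f"
proof -
  have "f \<in> \<O> W \<Longrightarrow> f \<in> extensional W" by (simp add: \<O>_def)
  then show "zopen W \<Longrightarrow> f \<in> \<O> W \<longleftrightarrow> f \<in> extensional W \<and> regular W f"
    by (auto simp: regular_def extensional_restrict)
qed

lemma restrict_\<O>: "regular W f \<Longrightarrow> restrict f W \<in> \<O> W"
  by (simp add: regular_def)

definition regular_section :: "('e \<Rightarrow>\<^sub>0 'k) set set \<Rightarrow> (('e \<Rightarrow>\<^sub>0 'k) set \<Rightarrow> 'm) \<Rightarrow> bool" where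
  "regular_section W s \<longleftrightarrow> (\<forall>b\<in>B. regular W (\<lambda>P. cf b (s P)))"

lemma M\<O>_iff:
  assumes "zopen W"
  shows "s \<in> M\<O> act W \<longleftrightarrow> s \<in> extensional W \<and> regular_section W s"
proof -
  have "s \<in> M\<O> act W \<longleftrightarrow> s \<in> extensional W \<and> (\<forall>b\<in>B. (\<lambda>P\<in>W. cf b (s P)) \<in> \<O> W)"
    using assms
    by (intro tensor_iff restrict_\<O> reg_const reg_add reg_mult) (auto simp: \<O>_iff)
  then show ?thesis using assms by (simp add: regular_section_def regular_def)
qed

lemma tensor_coord_ring_iff:
  "s \<in> tensor act (coord_ring S) (chart S) \<longleftrightarrow>
     s \<in> extensional (chart S) \<and> (\<forall>b\<in>B. polynomial_on S (\<lambda>P. cf b (s P)))"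
  unfolding polynomial_on_def
  by (rule tensor_iff) (auto intro: coord_ring.intros)

lemma regular_section_sum:
  assumes "zopen W" "\<And>i. i \<in> I \<Longrightarrow> regular W (f i)" "\<And>i. i \<in> I \<Longrightarrow> regular_section W (s i)"
  shows "regular_section W (\<lambda>P. \<Sum>i\<in>I. sc (f i P) (s i P))"
  using assms unfolding regular_section_def cf_sum cf_scale
  by (intro ballI reg_sum reg_mult) auto

lemma regular_section_mono:
  "regular_section W s \<Longrightarrow> zopen W' \<Longrightarrow> W' \<subseteq> W \<Longrightarrow> regular_section W' s"
  unfolding regular_section_def using reg_mono by blast

lemma regular_section_cong:
  assumes "\<And>P. P \<in> W \<Longrightarrow> s P = t P"
  shows "regular_section W s \<longleftrightarrow> regular_section W t"
  unfolding regular_section_def using assms by (intro ball_cong refl regular_cong) auto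

text \<open>The empty value off the open sets copies the normalisation in \<open>subsheaf\<close>;
  only so can this be the unique solution as a function on all sets.\<close>

definition fiber_sheaf ::
    "(('e \<Rightarrow>\<^sub>0 'k) set \<Rightarrow> 'm set) \<Rightarrow> ('e \<Rightarrow>\<^sub>0 'k) set set \<Rightarrow> (('e \<Rightarrow>\<^sub>0 'k) set \<Rightarrow> 'm) set" where
  "fiber_sheaf E W = (if zopen W then {s \<in> M\<O> act W. \<forall>P\<in>W. s P \<in> E P} else {})"

lemma fiber_sheaf_iff:
  "s \<in> fiber_sheaf E W \<longleftrightarrow>
     zopen W \<and> s \<in> extensional W \<and> regular_section W s \<and> (\<forall>P\<in>W. s P \<in> E P)"
  by (auto simp: fiber_sheaf_def M\<O>_iff)

lemma restrict_fiber_sheaf: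
  assumes "zopen W" "regular_section W s" "\<And>P. P \<in> W \<Longrightarrow> s P \<in> E P"
  shows "restrict s W \<in> fiber_sheaf E W"
  using assms regular_section_cong[of W s "restrict s W"] by (simp add: fiber_sheaf_iff)

lemma zopen_subset_Gr: "zopen W \<Longrightarrow> P \<in> W \<Longrightarrow> P \<in> Gr"
  by (auto simp: zopen_def)

text \<open>Gluing costs nothing: the glued section is given as a section of
  \<open>M\<O> act W\<close>, and lying in the fibres is a pointwise condition.\<close>

lemma subsheaf_fiber_sheaf:
  assumes E: "\<And>P. P \<in> Gr \<Longrightarrow> m.subspace (E P)"
  shows "subsheaf act (fiber_sheaf E)"
  unfolding subsheaf_def
proof (intro conjI allI impI ballI)
  fix W assume "\<not> zopen W" then show "fiber_sheaf E W = {}" by (simp add: fiber_sheaf_def)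
next
  fix W assume W: "zopen W"
  have sub: "m.subspace (E P)" if "P \<in> W" for P using E zopen_subset_Gr[OF W that] .
  show "fiber_sheaf E W \<subseteq> M\<O> act W" by (auto simp: fiber_sheaf_def)
  show "(\<lambda>P\<in>W. 0) \<in> fiber_sheaf E W"
    using W sub m.subspace_0
    by (intro restrict_fiber_sheaf) (auto simp: regular_section_def cf_zero reg_const)
  show "section_add W s t \<in> fiber_sheaf E W" if "s \<in> fiber_sheaf E W" "t \<in> fiber_sheaf E W" for s t
    unfolding section_add_def using that sub m.subspace_add
    by (intro restrict_fiber_sheaf) (auto simp: fiber_sheaf_iff regular_section_def cf_add intro!: reg_add)
  show "section_scale sc W f s \<in> fiber_sheaf E W" if "f \<in> \<O> W" "s \<in> fiber_sheaf E W" for f s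
    unfolding section_scale_def using that sub m.subspace_scale W
    by (intro restrict_fiber_sheaf)
      (auto simp: fiber_sheaf_iff regular_section_def cf_scale \<O>_iff intro!: reg_mult)
  show "restrict s W' \<in> fiber_sheaf E W'" if "zopen W' \<and> W' \<subseteq> W" "s \<in> fiber_sheaf E W" for W' s
    using that regular_section_mono by (intro restrict_fiber_sheaf) (auto simp: fiber_sheaf_iff)
  show "s \<in> fiber_sheaf E W"
    if s: "s \<in> M\<O> act W"
      and loc: "\<forall>P\<in>W. \<exists>W'. zopen W' \<and> P \<in> W' \<and> W' \<subseteq> W \<and> restrict s W' \<in> fiber_sheaf E W'" for s
  proof -
    have "s P \<in> E P" if "P \<in> W" for P
    proof -
      from loc that obtain W' where "P \<in> W'" "restrict s W' \<in> fiber_sheaf E W'" by blast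
      then show ?thesis by (auto simp: fiber_sheaf_iff)
    qed
    with s W show ?thesis by (simp add: fiber_sheaf_def)
  qed
qed

lemma subsheafD:
  assumes "subsheaf act F" "zopen W"
  shows "F W \<subseteq> M\<O> act W"
    and "s \<in> F W \<Longrightarrow> zopen W' \<Longrightarrow> W' \<subseteq> W \<Longrightarrow> restrict s W' \<in> F W'"
    and "s \<in> M\<O> act W \<Longrightarrow>
      \<forall>P\<in>W. \<exists>W'. zopen W' \<and> P \<in> W' \<and> W' \<subseteq> W \<and> restrict s W' \<in> F W' \<Longrightarrow> s \<in> F W"
proof -
  note * = assms(1)[unfolded subsheaf_def, THEN conjunct2, THEN spec, THEN mp, OF assms(2)]
  show "F W \<subseteq> M\<O> act W" by (rule *[THEN conjunct1])
  note ** = *[THEN conjunct2, THEN conjunct2, THEN conjunct2, THEN conjunct2]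
  show "restrict s W' \<in> F W'" if "s \<in> F W" "zopen W'" "W' \<subseteq> W"
    using **[THEN conjunct1] that by blast
  show "s \<in> F W" if "s \<in> M\<O> act W"
      "\<forall>P\<in>W. \<exists>W'. zopen W' \<and> P \<in> W' \<and> W' \<subseteq> W \<and> restrict s W' \<in> F W'"
    using **[THEN conjunct2, THEN bspec, OF that(1)] that(2) by (rule mp)
qed

text \<open>For uniqueness, a competing sheaf agrees with the fibre sheaf on open subsets of charts.
  After \<open>W\<close> is cut by the charts, restriction gives one inclusion and the gluing axiom
  the other.\<close>

lemma glued_sheaf_eq_fiber_sheaf:
  assumes E: "\<And>P. P \<in> Gr \<Longrightarrow> m.subspace (E P)"
    and N: "\<And>S W. S \<in> index_sets \<Longrightarrow> zopen W \<Longrightarrow> W \<subseteq> chart S \<Longrightarrow>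
       fiber_sheaf E W = assoc_sheaf act (coord_ring S) (N S) W"
  shows "glued_sheaf act N = fiber_sheaf E"
  unfolding glued_sheaf_def
proof (rule the_equality)
  show "subsheaf act (fiber_sheaf E) \<and> (\<forall>S\<in>index_sets. \<forall>W. zopen W \<and> W \<subseteq> chart S \<longrightarrow>
      fiber_sheaf E W = assoc_sheaf act (coord_ring S) (N S) W)"
    using subsheaf_fiber_sheaf[of E, OF E] N by blast
  fix F assume F: "subsheaf act F \<and> (\<forall>S\<in>index_sets. \<forall>W. zopen W \<and> W \<subseteq> chart S \<longrightarrow>
      F W = assoc_sheaf act (coord_ring S) (N S) W)"
  then have sheaf: "subsheaf act F" ..
  have chart: "F W = fiber_sheaf E W" if "S \<in> index_sets" "zopen W" "W \<subseteq> chart S" for S W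
    using F N that by blast
  show "F = fiber_sheaf E"
  proof
    fix W
    show "F W = fiber_sheaf E W"
    proof (cases "zopen W")
      case False
      then show ?thesis using sheaf by (simp add: subsheaf_def fiber_sheaf_def)
    next
      case True
      have nbhd: "\<exists>S\<in>index_sets. P \<in> chart S \<and> zopen (W \<inter> chart S)" if "P \<in> W" for P
        using charts_cover[OF zopen_subset_Gr[OF True that]] zopen_Int[OF True zopen_chart] by metis
      show ?thesis
      proof (intro equalityI subsetI)
        fix s assume s: "s \<in> F W"
        have "s P \<in> E P" if P: "P \<in> W" for P
        proof -
          from nbhd[OF P] obtain S where S: "S \<in> index_sets" "P \<in> chart S" "zopen (W \<inter> chart S)"
            by blast
          then have "restrict s (W \<inter> chart S) \<in> F (W \<inter> chart S)"
            using subsheafD(2)[OF sheaf True s] by simp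
          with chart[OF S(1,3)] have "restrict s (W \<inter> chart S) \<in> fiber_sheaf E (W \<inter> chart S)"
            by blast
          with P S(2) show ?thesis by (auto simp: fiber_sheaf_iff)
        qed
        moreover have "s \<in> M\<O> act W" using subsheafD(1)[OF sheaf True] s by (rule subsetD)
        ultimately show "s \<in> fiber_sheaf E W" using True by (simp add: fiber_sheaf_def)
      next
        fix s assume s: "s \<in> fiber_sheaf E W"
        have "\<exists>W'. zopen W' \<and> P \<in> W' \<and> W' \<subseteq> W \<and> restrict s W' \<in> F W'" if P: "P \<in> W" for P
        proof -
          from nbhd[OF P] obtain S where S: "S \<in> index_sets" "P \<in> chart S" "zopen (W \<inter> chart S)"
            by blast
          have "restrict s (W \<inter> chart S) \<in> fiber_sheaf E (W \<inter> chart S)"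
            using s S(3) regular_section_mono
            by (intro restrict_fiber_sheaf) (auto simp: fiber_sheaf_iff)
          with chart[OF S(1,3)] S P show ?thesis by (intro exI[of _ "W \<inter> chart S"]) auto
        qed
        then show "s \<in> F W"
          using s by (intro subsheafD(3)[OF sheaf True]) (auto simp: fiber_sheaf_def True)
      qed
    qed
  qed
qed

text \<open>
  A frame of \<open>E\<close> in reduced echelon form: the coordinates of a section with respect to \<open>b\<close> are
  then some of its coordinates with respect to the basis \<open>B\<close> of \<open>M\<close>, hence regular.
\<close>

definition local_frame ::
    "(('e \<Rightarrow>\<^sub>0 'k) set \<Rightarrow> 'm set) \<Rightarrow> ('e \<Rightarrow>\<^sub>0 'k) set set \<Rightarrow> 'm set \<Rightarrow>
     ('m \<Rightarrow> ('e \<Rightarrow>\<^sub>0 'k) set \<Rightarrow> 'm) \<Rightarrow> bool" where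
  "local_frame E W A b \<longleftrightarrow> zopen W \<and> A \<subseteq> B \<and> (\<forall>a\<in>A. regular_section W (b a)) \<and>
     (\<forall>P\<in>W. \<forall>a\<in>A. b a P \<in> E P) \<and>
     (\<forall>P\<in>W. \<forall>a\<in>A. \<forall>c\<in>A. cf c (b a P) = (if a = c then 1 else 0)) \<and>
     (\<forall>P\<in>W. \<forall>u\<in>E P. u = (\<Sum>a\<in>A. sc (cf a u) (b a P)))"

text \<open>The isomorphism sends coefficients to the corresponding combination of the frame. Its
  inverse reads off pivot coordinates and so preserves regularity without any division.\<close>

lemma local_frame_iso_free:
  assumes E: "\<And>P. P \<in> Gr \<Longrightarrow> m.subspace (E P)" and fr: "local_frame E W A b"
  shows "\<exists>\<phi>. iso_free act (fiber_sheaf E) W (card A) \<phi>"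
proof -
  from fr have A: "A \<subseteq> B" and W: "zopen W"
    and reg: "\<And>a. a \<in> A \<Longrightarrow> regular_section W (b a)"
    and bE: "\<And>P a. P \<in> W \<Longrightarrow> a \<in> A \<Longrightarrow> b a P \<in> E P"
    and unit: "\<And>P a c. P \<in> W \<Longrightarrow> a \<in> A \<Longrightarrow> c \<in> A \<Longrightarrow> cf c (b a P) = (if a = c then 1 else 0)"
    and span: "\<And>P u. P \<in> W \<Longrightarrow> u \<in> E P \<Longrightarrow> u = (\<Sum>a\<in>A. sc (cf a u) (b a P))"
    unfolding local_frame_def by auto
  have "finite A" using A finite_B finite_subset by blast
  then obtain e where e: "bij_betw e {..<card A} A"
    using ex_bij_betw_nat_finite by (auto simp: lessThan_atLeast0)
  have eA: "e i \<in> A" if "i < card A" for i using bij_betwE[OF e] that by blast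
  have eB: "e i \<in> B" if "i < card A" for i using eA[OF that] A by blast
  have e_eq: "e i = e j \<longleftrightarrow> i = j" if "i < card A" "j < card A" for i j
    using e that by (auto simp: bij_betw_def inj_on_def)
  define \<phi> where "\<phi> W' f = (\<lambda>Q\<in>W'. \<Sum>i<card A. sc (f i Q) (b (e i) Q))"
    for W' and f :: "nat \<Rightarrow> ('e \<Rightarrow>\<^sub>0 'k) set \<Rightarrow> 'k"
  have "iso_free act (fiber_sheaf E) W (card A) \<phi>"
    unfolding iso_free_def
  proof (intro allI impI conjI ballI)
    fix W' assume "zopen W' \<and> W' \<subseteq> W"
    then have W': "zopen W'" "W' \<subseteq> W" by auto
    define \<psi> where "\<psi> s = (\<lambda>i\<in>{..<card A}. \<lambda>Q\<in>W'. cf (e i) (s Q))"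
      for s :: "('e \<Rightarrow>\<^sub>0 'k) set \<Rightarrow> 'm"
    show "bij_betw (\<phi> W') ({..<card A} \<rightarrow>\<^sub>E \<O> W') (fiber_sheaf E W')"
    proof (rule bij_betwI[where g = \<psi>])
      show "\<phi> W' \<in> ({..<card A} \<rightarrow>\<^sub>E \<O> W') \<rightarrow> fiber_sheaf E W'"
      proof
        fix f assume f: "f \<in> {..<card A} \<rightarrow>\<^sub>E \<O> W'"
        then have "regular W' (f i)" if "i < card A" for i
          using that W' by (auto simp: \<O>_iff PiE_iff)
        moreover have "regular_section W' (b (e i))" if "i < card A" for i
          using regular_section_mono[OF reg[OF eA[OF that]] W'] .
        moreover have "(\<Sum>i<card A. sc (f i Q) (b (e i) Q)) \<in> E Q" if "Q \<in> W'" for Q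
          using that W' E zopen_subset_Gr[OF W'(1) that] bE eA
          by (intro m.subspace_sum m.subspace_scale) auto
        ultimately show "\<phi> W' f \<in> fiber_sheaf E W'"
          unfolding \<phi>_def using W' by (intro restrict_fiber_sheaf regular_section_sum) auto
      qed
      show "\<psi> \<in> fiber_sheaf E W' \<rightarrow> ({..<card A} \<rightarrow>\<^sub>E \<O> W')"
        using eB by (auto simp: \<psi>_def fiber_sheaf_iff regular_section_def intro!: restrict_\<O>)
      show "\<psi> (\<phi> W' f) = f" if f: "f \<in> {..<card A} \<rightarrow>\<^sub>E \<O> W'" for f
      proof (intro ext)
        fix i Q
        show "\<psi> (\<phi> W' f) i Q = f i Q"
        proof (cases "i < card A")
          case True
          then have fi: "f i \<in> \<O> W'" using f by auto
          show ?thesis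
          proof (cases "Q \<in> W'")
            case True
            have "\<psi> (\<phi> W' f) i Q = (\<Sum>j<card A. f j Q * (if i = j then 1 else 0))"
              using True \<open>i < card A\<close> W' eA e_eq
              by (auto simp: \<psi>_def \<phi>_def cf_sum cf_scale unit subset_iff intro!: sum.cong)
            then show ?thesis
              using \<open>i < card A\<close> by (simp add: if_distrib[of "(*) _"] cong: if_cong)
          next
            \<comment> \<open>Off \<open>W'\<close> both sides are \<open>undefined\<close>, since
              members of \<open>\<O> W'\<close> are extensional.\<close>
            case False
            then show ?thesis
              using fi W' \<open>i < card A\<close> by (simp add: \<psi>_def \<O>_iff extensional_def)
          qed
        next
          case False
          then show ?thesis using f by (simp add: \<psi>_def PiE_iff extensional_def)
        qed
      qed
      show "\<phi> W' (\<psi> s) = s" if s: "s \<in> fiber_sheaf E W'" for s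
      proof
        fix Q
        show "\<phi> W' (\<psi> s) Q = s Q"
        proof (cases "Q \<in> W'")
          case True
          then have "s Q \<in> E Q" "Q \<in> W" using s W' by (auto simp: fiber_sheaf_iff)
          from span[OF this(2,1)]
          have "(\<Sum>i<card A. sc (cf (e i) (s Q)) (b (e i) Q)) = s Q"
            by (subst sum.reindex_bij_betw[OF e, of "\<lambda>a. sc (cf a (s Q)) (b a Q)"]) simp
          then show ?thesis using True by (simp add: \<phi>_def \<psi>_def)
        next
          case False
          then show ?thesis using s by (simp add: \<phi>_def fiber_sheaf_iff extensional_def)
        qed
      qed
    qed
    show "\<phi> W' (\<lambda>i\<in>{..<card A}. section_add W' (f i) (g i)) = section_add W' (\<phi> W' f) (\<phi> W' g)" for f g
      by (auto simp: \<phi>_def section_add_def m.scale_left_distrib sum.distrib)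
    show "\<phi> W' (\<lambda>i\<in>{..<card A}. section_scale (*) W' a (f i)) = section_scale sc W' a (\<phi> W' f)" for a f
      by (auto simp: \<phi>_def section_scale_def m.scale_sum_right)
    show "\<phi> W'' (\<lambda>i\<in>{..<card A}. restrict (f i) W'') = restrict (\<phi> W' f) W''"
      if "zopen W'' \<and> W'' \<subseteq> W'" for W'' f
      using that by (auto simp: \<phi>_def subset_iff fun_eq_iff)
  qed
  then show ?thesis by blast
qed

text \<open>The generators are the frame itself, restricted to a principal open set inside its
  domain. A section is recovered from its pivot coordinates, brought to a common denominator;
  conversely, quotients of combinations of the frame stay regular and in the fibres.\<close>

lemma local_frame_coherent:
  assumes E: "\<And>P. P \<in> Gr \<Longrightarrow> m.subspace (E P)"
    and fr: "\<And>P. P \<in> Gr \<Longrightarrow> \<exists>W A b. P \<in> W \<and> local_frame E W A b"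
  shows "coherent act (fiber_sheaf E)"
  unfolding coherent_def
proof
  fix P assume P: "P \<in> Gr"
  from fr[OF this] obtain D A b where D: "P \<in> D" and fr: "local_frame E D A b" by blast
  then have A: "A \<subseteq> B" and opn: "zopen D"
    and reg: "\<And>a. a \<in> A \<Longrightarrow> regular_section D (b a)"
    and bE: "\<And>P a. P \<in> D \<Longrightarrow> a \<in> A \<Longrightarrow> b a P \<in> E P"
    and unit: "\<And>P a c. P \<in> D \<Longrightarrow> a \<in> A \<Longrightarrow> c \<in> A \<Longrightarrow> cf c (b a P) = (if a = c then 1 else 0)"
    and span: "\<And>P u. P \<in> D \<Longrightarrow> u \<in> E P \<Longrightarrow> u = (\<Sum>a\<in>A. sc (cf a u) (b a P))"
    unfolding local_frame_def by auto
  have finA: "finite A" using A finite_B finite_subset by blast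
  obtain S where S: "S \<in> index_sets" "P \<in> chart S" using charts_cover[OF P] .
  obtain g where g: "polynomial_on S g" "P \<in> principal_open S g" "principal_open S g \<subseteq> D"
    using zopen_neighbourhood[OF opn D S] .
  define G where "G = principal_open S g"
  have G: "zopen G" "P \<in> G" "G \<subseteq> D" using zopen_principal_open[OF S(1) g(1)] g by (auto simp: G_def)
  define \<beta> where "\<beta> a = restrict (b a) G" for a
  \<comment> \<open>\<open>section_span\<close> sums over a set of sections, so frame members with
    equal restrictions would be merged; their pivot coordinates at \<open>P\<close> tell them
    apart.\<close>
  have inj: "inj_on \<beta> A"
  proof (rule inj_onI)
    fix a c assume ac: "a \<in> A" "c \<in> A" "\<beta> a = \<beta> c"
    then have "b a P = b c P" using G by (metis \<beta>_def restrict_apply')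
    with unit[OF D ac(1,2)] unit[OF D ac(2,2)] show "a = c" by (metis zero_neq_one)
  qed
  have reg\<beta>: "regular_section G (\<beta> a)" if "a \<in> A" for a
    using regular_section_mono[OF reg[OF that] G(1,3)] regular_section_cong[of G "\<beta> a" "b a"]
    by (simp add: \<beta>_def)
  have "\<beta> ` A \<subseteq> M\<O> act G"
    using reg\<beta> G by (auto simp: M\<O>_iff) (auto simp: \<beta>_def)
  moreover have "fiber_sheaf E W = assoc_sheaf act (\<O> G) (section_span act G (\<beta> ` A)) W"
    if W: "zopen W" "W \<subseteq> G" for W
  proof (intro equalityI subsetI)
    fix s assume s: "s \<in> fiber_sheaf E W"
    have "\<exists>W'. zopen W' \<and> Q \<in> W' \<and> W' \<subseteq> W \<and> (\<exists>t\<in>section_span act G (\<beta> ` A). \<exists>f\<in>\<O> G.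
        \<forall>R\<in>W'. f R \<noteq> 0 \<and> s R = sc (inverse (f R)) (t R))" if Q: "Q \<in> W" for Q
    proof -
      have QS: "Q \<in> chart S" using Q W by (auto simp: G_def principal_open_def)
      have "\<exists>d \<alpha>. polynomial_on S d \<and> (\<forall>a\<in>A. polynomial_on S (\<alpha> a)) \<and> Q \<in> principal_open S d \<and>
          principal_open S d \<subseteq> W \<and> (\<forall>a\<in>A. \<forall>R\<in>principal_open S d. cf a (s R) = \<alpha> a R / d R)"
        using s A by (intro common_denominator finA W(1) Q S(1) QS) (auto simp: fiber_sheaf_iff regular_section_def)
      then obtain d \<alpha> where d: "polynomial_on S d" "Q \<in> principal_open S d" "principal_open S d \<subseteq> W"
        and \<alpha>: "\<And>a. a \<in> A \<Longrightarrow> polynomial_on S (\<alpha> a)"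
        and s\<alpha>: "\<And>a R. a \<in> A \<Longrightarrow> R \<in> principal_open S d \<Longrightarrow> cf a (s R) = \<alpha> a R / d R"
        by blast
      have GS: "G \<subseteq> chart S" by (auto simp: G_def principal_open_def)
      \<comment> \<open>Coefficients belong to sections rather than to pivots here, hence the detour
        through the inverse of \<open>\<beta>\<close>.\<close>
      define c where "c = (\<lambda>\<sigma>. restrict (\<alpha> (inv_into A \<beta> \<sigma>)) G)"
      define t where "t = (\<lambda>R\<in>G. \<Sum>\<sigma>\<in>\<beta> ` A. sc (c \<sigma> R) (\<sigma> R))"
      have "c \<sigma> \<in> \<O> G" if "\<sigma> \<in> \<beta> ` A" for \<sigma>
        unfolding c_def using that inv_into_into[OF that]
        by (intro restrict_\<O> polynomial_regular[OF S(1) \<alpha> G(1) GS]) auto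
      then have "t \<in> section_span act G (\<beta> ` A)"
        unfolding section_span_def t_def by blast
      moreover have "restrict d G \<in> \<O> G"
        by (intro restrict_\<O> polynomial_regular[OF S(1) d(1) G(1) GS])
      moreover have "\<forall>R\<in>principal_open S d. restrict d G R \<noteq> 0 \<and>
          s R = sc (inverse (restrict d G R)) (t R)"
      proof
        fix R assume R: "R \<in> principal_open S d"
        then have RW: "R \<in> W" and dR: "d R \<noteq> 0" using d(3) by (auto simp: principal_open_def)
        with W G have RG: "R \<in> G" "R \<in> D" by auto
        have \<beta>R: "\<beta> a R = b a R" for a using RG by (simp add: \<beta>_def)
        have "s R = (\<Sum>a\<in>A. sc (cf a (s R)) (b a R))"
          using s RW by (intro span[OF RG(2)]) (auto simp: fiber_sheaf_iff)
        also have "\<dots> = (\<Sum>a\<in>A. sc (inverse (d R)) (sc (\<alpha> a R) (b a R)))"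
          using s\<alpha>[OF _ R] by (intro sum.cong refl) (simp add: divide_inverse mult.commute)
        also have "\<dots> = sc (inverse (d R)) (\<Sum>a\<in>A. sc (c (\<beta> a) R) (\<beta> a R))"
          unfolding m.scale_sum_right
          using RG inj by (intro sum.cong refl) (simp add: c_def inv_into_f_f \<beta>R)
        also have "(\<Sum>a\<in>A. sc (c (\<beta> a) R) (\<beta> a R)) = t R"
          using RG by (simp add: t_def sum.reindex[OF inj])
        finally show "restrict d G R \<noteq> 0 \<and> s R = sc (inverse (restrict d G R)) (t R)"
          using RG dR by simp
      qed
      ultimately show ?thesis using zopen_principal_open[OF S(1) d(1)] d(2,3) by blast
    qed
    with s show "s \<in> assoc_sheaf act (\<O> G) (section_span act G (\<beta> ` A)) W"
      by (auto simp: assoc_sheaf_def fiber_sheaf_iff)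
  next
    fix s assume s: "s \<in> assoc_sheaf act (\<O> G) (section_span act G (\<beta> ` A)) W"
    have loc: "\<exists>W'. zopen W' \<and> Q \<in> W' \<and> W' \<subseteq> W \<and> regular_section W' s \<and> s Q \<in> E Q" if Q: "Q \<in> W" for Q
    proof -
      from s Q obtain W' t f where W': "zopen W'" "Q \<in> W'" "W' \<subseteq> W"
        and t: "t \<in> section_span act G (\<beta> ` A)" and f: "f \<in> \<O> G"
        and st: "\<And>R. R \<in> W' \<Longrightarrow> f R \<noteq> 0 \<and> s R = sc (inverse (f R)) (t R)"
        unfolding assoc_sheaf_def by blast
      from t obtain c where c: "\<And>\<sigma>. \<sigma> \<in> \<beta> ` A \<Longrightarrow> c \<sigma> \<in> \<O> G"
        and tc: "t = (\<lambda>R\<in>G. \<Sum>\<sigma>\<in>\<beta> ` A. sc (c \<sigma> R) (\<sigma> R))"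
        unfolding section_span_def by blast
      have W'G: "W' \<subseteq> G" using W' W by blast
      have "regular_section W' (\<lambda>R. \<Sum>\<sigma>\<in>\<beta> ` A. sc (inverse (f R) * c \<sigma> R) (\<sigma> R))"
      proof (rule regular_section_sum[OF W'(1)])
        have "regular W' f" using f G(1) W'(1) W'G by (auto simp: \<O>_iff intro: reg_mono)
        moreover have "{R\<in>W'. f R \<noteq> 0} = W'" using st by blast
        ultimately have "regular W' (\<lambda>R. inverse (f R))" using reg_inverse[of W' f] by simp
        then show "regular W' (\<lambda>R. inverse (f R) * c \<sigma> R)" if "\<sigma> \<in> \<beta> ` A" for \<sigma>
          using c[OF that] G(1) W'(1) W'G by (intro reg_mult) (auto simp: \<O>_iff intro: reg_mono)
        show "regular_section W' \<sigma>" if "\<sigma> \<in> \<beta> ` A" for \<sigma>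
          using that reg\<beta> regular_section_mono[OF _ W'(1) W'G] by blast
      qed
      moreover have sR: "s R = (\<Sum>\<sigma>\<in>\<beta> ` A. sc (inverse (f R) * c \<sigma> R) (\<sigma> R))" if "R \<in> W'" for R
        using st[OF that] that W'G by (auto simp: tc m.scale_sum_right)
      ultimately have "regular_section W' s" using regular_section_cong[of W' s] by simp
      moreover have "s Q \<in> E Q"
      proof -
        have "Q \<in> G" using W'(2) W'G by blast
        then have "\<sigma> Q \<in> E Q" if "\<sigma> \<in> \<beta> ` A" for \<sigma>
          using that bE G by (auto simp: \<beta>_def)
        then show ?thesis
          unfolding sR[OF W'(2)] using E[OF zopen_subset_Gr[OF W'(1,2)]]
          by (intro m.subspace_sum m.subspace_scale) auto
      qed
      ultimately show ?thesis using W' by blast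
    qed
    have "regular_section W s"
      unfolding regular_section_def
    proof (intro ballI regular_local[OF W(1)])
      fix c Q assume "c \<in> B" "Q \<in> W"
      with loc[of Q] obtain W' where "Q \<in> W'" "W' \<subseteq> W" "regular_section W' s" by auto
      with \<open>c \<in> B\<close> show "\<exists>W'. Q \<in> W' \<and> W' \<subseteq> W \<and> regular W' (\<lambda>P. cf c (s P))"
        unfolding regular_section_def by blast
    qed
    with s W loc show "s \<in> fiber_sheaf E W" by (auto simp: fiber_sheaf_iff assoc_sheaf_def)
  qed
  moreover have "restrict g (chart S) \<in> coord_ring S" using g(1) by (simp add: polynomial_on_def)
  moreover have "principal_open S (restrict g (chart S)) = G" by (simp add: principal_open_restrict G_def)
  ultimately show "\<exists>S\<in>index_sets. \<exists>g\<in>coord_ring S. P \<in> principal_open S g \<and>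
     (\<exists>B. finite B \<and> B \<subseteq> M\<O> act (principal_open S g) \<and>
        (\<forall>W. zopen W \<and> W \<subseteq> principal_open S g \<longrightarrow>
           fiber_sheaf E W = assoc_sheaf act (\<O> (principal_open S g))
                   (section_span act (principal_open S g) B) W))"
    using S(1) G finA
    by (intro bexI[of _ S] bexI[of _ "restrict g (chart S)"] conjI exI[of _ "\<beta> ` A"]) auto
qed

lemma fiber_sheaf_vector_bundle:
  assumes E: "\<And>P. P \<in> Gr \<Longrightarrow> m.subspace (E P)"
    and fr: "\<And>P. P \<in> Gr \<Longrightarrow> \<exists>W A b. P \<in> W \<and> card A = d \<and> local_frame E W A b"
  shows "algebraic_vector_bundle act (fiber_sheaf E) \<and> has_rank act (fiber_sheaf E) d"
proof -
  have "has_rank act (fiber_sheaf E) d"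
    unfolding has_rank_def
  proof
    fix P assume "P \<in> Gr"
    then obtain W A b where "P \<in> W" "card A = d" and f: "local_frame E W A b" using fr by blast
    moreover from f have "zopen W" by (simp add: local_frame_def)
    ultimately show "\<exists>W \<phi>. zopen W \<and> P \<in> W \<and> iso_free act (fiber_sheaf E) W d \<phi>"
      using local_frame_iso_free[of E, OF E f] by blast
  qed
  moreover from this have "locally_free act (fiber_sheaf E)"
    unfolding has_rank_def locally_free_def by blast
  moreover have "coherent act (fiber_sheaf E)"
    by (rule local_frame_coherent[of E, OF E]) (use fr in blast)+
  ultimately show ?thesis
    using subsheaf_fiber_sheaf[of E, OF E] by (simp add: algebraic_vector_bundle_def)
qed

end

section \<open>Socles and radicals\<close>

text \<open>Bilinearity, by induction on both spans. It allows arbitrary vectors of a plane to be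
  replaced by spanning ones inside products.\<close>

lemma alg_span_mult:
  assumes "a \<in> alg.span X" "b \<in> alg.span Z"
  shows "a * b \<in> alg.span {x * z |x z. x \<in> X \<and> z \<in> Z}" (is "_ \<in> alg.span ?XZ")
  using assms(1)
proof (induction rule: alg.span_induct_alt)
  case base
  show ?case by (simp add: alg.span_zero)
next
  case (step c u v)
  have "u * b \<in> alg.span ?XZ"
    using assms(2)
  proof (induction rule: alg.span_induct_alt)
    case base
    show ?case by (simp add: alg.span_zero)
  next
    case (step c' z w)
    have "u * (alg_scale c' z + w) = alg_scale c' (u * z) + u * w"
      by (simp add: alg_scale_def algebra_simps)
    moreover have "u * z \<in> alg.span ?XZ" using \<open>u \<in> X\<close> step by (intro alg.span_base) auto
    ultimately show ?case using step by (simp add: alg.span_add alg.span_scale)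
  qed
  moreover have "(alg_scale c u + v) * b = alg_scale c (u * b) + v * b"
    by (simp add: alg_scale_def algebra_simps)
  ultimately show ?case using step by (simp add: alg.span_add alg.span_scale)
qed

context grassmannian_module
begin

section \<open>Linearity of the action\<close>

lemma act_sc: "act a (sc c u) = sc c (act a u)"
  by (simp add: restr_scale_def mult.commute)

lemma act_alg_scale: "act (alg_scale c a) u = sc c (act a u)"
  by (simp add: restr_scale_def alg_scale_def)

lemma act_expand: "act a u = (\<Sum>e\<in>B. sc (cf e u) (act a e))"
proof -
  have "act a u = act a (\<Sum>e\<in>B. sc (cf e u) e)" by (simp only: cf_expand)
  then show ?thesis by (simp add: act.scale_sum_right act_sc)
qed

lemma subspace_SocU: "m.subspace (SocU act l U)"
  by (rule m.subspaceI) (auto simp: SocU_def act.scale_right_distrib act_sc)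

lemma subspace_RadU: "m.subspace (RadU act l U)"
  by (simp add: RadU_def)

lemma finite_theta_tuples: "finite (theta_tuples l)"
  using finite_lists_length_eq[of "{..<r}" l] by (simp add: theta_tuples_def conj_commute)

text \<open>At the plane \<open>U\<close> the composite of the operators \<open>theta\<close>
  indexed by \<open>js\<close> is the action of this element, so that statements about the operators
  become statements about the group algebra.\<close>

definition monomial :: "nat set \<Rightarrow> ('e \<Rightarrow>\<^sub>0 'k) set \<Rightarrow> nat list \<Rightarrow> 'e \<Rightarrow>\<^sub>0 'k" where
  "monomial S U js = prod_list (map (column (normal_form S U)) js)"

lemma theta_eq:
  assumes "U \<in> chart S"
  shows "theta act S j s U = act (column (normal_form S U) j) (s U)"
  using assms by (simp add: theta_def Y_normal_form column_def act.scale_sum_left act_alg_scale)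

lemma foldr_theta:
  assumes "U \<in> chart S"
  shows "foldr (theta act S) js s U = act (monomial S U js) (s U)"
  using assms by (induction js) (simp_all add: monomial_def theta_eq)

lemma foldr_theta_extensional:
  "s \<in> extensional (chart S) \<Longrightarrow> foldr (theta act S) js s \<in> extensional (chart S)"
  by (induction js) (simp_all add: theta_def)

lemma plane_eq_span:
  assumes "S \<in> index_sets" "U \<in> chart S"
  shows "U = alg.span (column (normal_form S U) ` {..<r})"
  using normal_form(1)[OF assms] by (simp add: represents_iff)

text \<open>The columns of the normal form span \<open>U\<close>, so a product of vectors of
  \<open>U\<close> expands into products of columns. Finitely many monomials thus stand for all
  products from \<open>U\<close>.\<close>

lemma prod_list_in_span_monomials:
  assumes "S \<in> index_sets" "U \<in> chart S" "set us \<subseteq> U"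
  shows "prod_list us \<in> alg.span (monomial S U ` theta_tuples (length us))"
  using assms(3)
proof (induction us)
  case Nil
  show ?case by (intro alg.span_base) (auto simp: theta_tuples_def monomial_def)
next
  case (Cons u us)
  have "u \<in> alg.span (column (normal_form S U) ` {..<r})"
    using Cons.prems equalityD1[OF plane_eq_span[OF assms(1,2)]] by auto
  from alg_span_mult[OF this Cons.IH] Cons.prems
  have mem: "u * prod_list us \<in> alg.span {a * b |a b. a \<in> column (normal_form S U) ` {..<r} \<and>
      b \<in> monomial S U ` theta_tuples (length us)}" by simp
  have sub: "{a * b |a b. a \<in> column (normal_form S U) ` {..<r} \<and>
      b \<in> monomial S U ` theta_tuples (length us)} \<subseteq> monomial S U ` theta_tuples (length (u # us))"
  proof clarify
    fix j js assume "j < r" "js \<in> theta_tuples (length us)"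
    then have "j # js \<in> theta_tuples (length (u # us))" by (auto simp: theta_tuples_def)
    moreover have "column (normal_form S U) j * monomial S U js = monomial S U (j # js)"
      by (simp add: monomial_def)
    ultimately show "column (normal_form S U) j * monomial S U js
        \<in> monomial S U ` theta_tuples (length (u # us))" by blast
  qed
  show ?case unfolding prod_list.Cons by (rule subsetD[OF alg.span_mono[OF sub] mem])
qed

lemma monomial_product:
  assumes "S \<in> index_sets" "U \<in> chart S" "js \<in> theta_tuples l"
  obtains us where "length us = l" "set us \<subseteq> U" "monomial S U js = prod_list us"
proof -
  have "column (normal_form S U) j \<in> U" if "j < r" for j
    using that alg.span_base[of "column (normal_form S U) j" "column (normal_form S U) ` {..<r}"]
    by (intro subsetD[OF equalityD2[OF plane_eq_span[OF assms(1,2)]]]) auto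
  then have "set (map (column (normal_form S U)) js) \<subseteq> U"
    using assms(3) by (auto simp: theta_tuples_def)
  moreover have "length (map (column (normal_form S U)) js) = l"
    using assms(3) by (simp add: theta_tuples_def)
  ultimately show thesis by (intro that[of "map (column (normal_form S U)) js"]) (simp_all add: monomial_def)
qed

text \<open>The algebra elements that annihilate a given vector form a subspace; hence the spanning
  monomials decide.\<close>

lemma SocU_eq:
  assumes "S \<in> index_sets" "U \<in> chart S"
  shows "SocU act l U = {u. \<forall>js\<in>theta_tuples l. act (monomial S U js) u = 0}"
proof (intro equalityI subsetI CollectI ballI)
  fix u js assume u: "u \<in> SocU act l U" and js: "js \<in> theta_tuples l"
  obtain us where "length us = l" "set us \<subseteq> U" "monomial S U js = prod_list us"
    using monomial_product[OF assms js] .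
  with u show "act (monomial S U js) u = 0" by (simp add: SocU_def)
next
  fix u assume u: "u \<in> {u. \<forall>js\<in>theta_tuples l. act (monomial S U js) u = 0}"
  have "alg.subspace {a. act a u = 0}"
    by (rule alg.subspaceI) (auto simp: act.scale_left_distrib act_alg_scale)
  then have "alg.span (monomial S U ` theta_tuples l) \<subseteq> {a. act a u = 0}"
    using u by (intro alg.span_minimal) auto
  then show "u \<in> SocU act l U"
    using prod_list_in_span_monomials[OF assms] by (auto simp: SocU_def)
qed

lemma act_monomial_in_RadU:
  assumes "S \<in> index_sets" "U \<in> chart S" "js \<in> theta_tuples l"
  shows "act (monomial S U js) u \<in> RadU act l U"
proof -
  obtain us where "length us = l" "set us \<subseteq> U" "monomial S U js = prod_list us"
    using monomial_product[OF assms] .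
  then show ?thesis unfolding RadU_def by (intro m.span_base) auto
qed

text \<open>The monomials reduce the algebra elements to a finite set, and linearity of the action
  does so for the module elements. What results is a finite family of generators to which
  elimination applies.\<close>

lemma RadU_eq:
  assumes "S \<in> index_sets" "U \<in> chart S"
  shows "RadU act l U = m.span ((\<lambda>(js, e). act (monomial S U js) e) ` (theta_tuples l \<times> B))"
    (is "_ = m.span ?X")
proof (rule equalityI)
  show "m.span ?X \<subseteq> RadU act l U"
    using act_monomial_in_RadU[OF assms] by (intro m.span_minimal subspace_RadU) auto
  have "act (prod_list us) u \<in> m.span ?X" if us: "length us = l" "set us \<subseteq> U" for us u
  proof -
    have "alg.subspace {a. act a u \<in> m.span ?X}"
      by (rule alg.subspaceI)
        (auto simp: act.scale_left_distrib act_alg_scale m.span_zero m.span_add m.span_scale)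
    moreover have "act (monomial S U js) u \<in> m.span ?X" if "js \<in> theta_tuples l" for js
      unfolding act_expand[of _ u]
    proof (intro m.span_sum m.span_scale m.span_base)
      show "act (monomial S U js) e \<in> ?X" if "e \<in> B" for e
        using that \<open>js \<in> theta_tuples l\<close> by force
    qed
    ultimately have "alg.span (monomial S U ` theta_tuples l) \<subseteq> {a. act a u \<in> m.span ?X}"
      by (intro alg.span_minimal) auto
    then show ?thesis using prod_list_in_span_monomials[OF assms us(2)] us(1) by auto
  qed
  then show "RadU act l U \<subseteq> m.span ?X"
    unfolding RadU_def by (intro m.span_minimal m.subspace_span) auto
qed

text \<open>Each factor contributes entries of the normal form and the constants
  \<open>cf c (act (x i) e)\<close>, so induction on the factors keeps the coordinates
  polynomial.\<close>

lemma polynomial_act_monomial: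
  assumes "S \<in> index_sets" "set js \<subseteq> {..<r}" "\<And>c. c \<in> B \<Longrightarrow> polynomial_on S (\<lambda>U. cf c (s U))"
    and "c \<in> B"
  shows "polynomial_on S (\<lambda>U. cf c (act (monomial S U js) (s U)))"
  using assms(2,4)
proof (induction js arbitrary: c)
  case Nil
  then show ?case using assms(3) by (simp add: monomial_def)
next
  case (Cons j js)
  let ?u = "\<lambda>U. act (monomial S U js) (s U)"
  have "cf c (act (monomial S U (j # js)) (s U)) =
      (\<Sum>i<n. normal_form S U $$ (i, j) * (\<Sum>e\<in>B. cf e (?u U) * cf c (act (x i) e)))" for U
  proof -
    have "act (monomial S U (j # js)) (s U) = (\<Sum>i<n. sc (normal_form S U $$ (i, j)) (act (x i) (?u U)))"
      by (simp add: monomial_def column_def act.scale_sum_left act_alg_scale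
          flip: act.scale_scale)
    also have "cf c \<dots> = (\<Sum>i<n. normal_form S U $$ (i, j) * cf c (act (x i) (?u U)))"
      by (simp add: cf_sum cf_scale)
    also have "\<dots> = (\<Sum>i<n. normal_form S U $$ (i, j) * (\<Sum>e\<in>B. cf e (?u U) * cf c (act (x i) e)))"
      unfolding act_expand[of "x _" "?u U"] cf_sum cf_scale ..
    finally show ?thesis .
  qed
  then show ?case
    using Cons assms(1)
    by (simp only:) (intro polynomial_sum polynomial_mult polynomial_normal_form polynomial_const; simp)
qed

lemma local_frameI:
  assumes "zopen D" "\<And>a. a \<in> A \<Longrightarrow> regular_section D (b a)"
    and ech: "\<And>U. U \<in> D \<Longrightarrow> echelon sc B A (\<lambda>a. b a U)"
    and sub: "\<And>U. U \<in> D \<Longrightarrow> E U \<subseteq> m.span ((\<lambda>a. b a U) ` A)"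
    and mem: "\<And>U a. U \<in> D \<Longrightarrow> a \<in> A \<Longrightarrow> b a U \<in> E U"
    and "A \<subseteq> B"
  shows "local_frame E D A b"
  unfolding local_frame_def
proof (intro conjI ballI assms(1,2,6) mem)
  show "cf c (b a U) = (if a = c then 1 else 0)" if "U \<in> D" "a \<in> A" "c \<in> A" for U a c
    using ech[OF that(1)] that by (simp add: echelon_def cf_def)
  show "u = (\<Sum>a\<in>A. sc (cf a u) (b a U))" if "U \<in> D" "u \<in> E U" for U u
    unfolding cf_def using m.echelon_span[OF ech[OF that(1)]] sub[OF that(1)] that(2) by blast
qed

lemma echelonI:
  assumes "A \<subseteq> B" "\<And>a c. a \<in> A \<Longrightarrow> c \<in> A \<Longrightarrow> cf c (y a) = (if a = c then 1 else 0)"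
  shows "echelon sc B A y"
  using assms by (simp add: echelon_def indep_B finite_B span_B cf_def)

lemma subspace_eq_of_dim:
  assumes "m.subspace X" "m.subspace Z" "X \<subseteq> Z" "m.dim Z \<le> m.dim X"
  shows "X = Z"
proof -
  interpret fd: finite_dimensional_vector_space sc B
    by unfold_locales (simp_all add: finite_B indep_B span_B)
  show ?thesis using fd.subspace_dim_equal assms by blast
qed

text \<open>The reduced rows lie in the radical at every point of \<open>D\<close> and are
  independent. At \<open>P\<close> they span it, which fixes their number as \<open>d\<close>;
  elsewhere the dimension leaves no room for more. The coefficients \<open>\<gamma>\<close> are
  handed on because lifting sections back to the image module uses them.\<close>

lemma RadU_local_frame:
  assumes dim: "\<And>Q. Q \<in> Gr \<Longrightarrow> m.dim (RadU act l Q) = d"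
    and S: "S \<in> index_sets" and P: "P \<in> chart S"
  shows "\<exists>D A b \<gamma>. P \<in> D \<and> D \<subseteq> chart S \<and> card A = d \<and> local_frame (RadU act l) D A b \<and>
     (\<forall>a\<in>A. \<forall>i\<in>theta_tuples l \<times> B. regular D (\<gamma> a i)) \<and>
     (\<forall>U\<in>D. \<forall>a\<in>A. b a U = (\<Sum>(js, e)\<in>theta_tuples l \<times> B. sc (\<gamma> a (js, e) U) (act (monomial S U js) e)))"
proof -
  let ?I = "theta_tuples l \<times> B"
  define w where "w = (\<lambda>(js, e) U. act (monomial S U js) e)"
  define v where "v i c U = cf c (w i U)" for i c U
  have finI: "finite ?I" by (simp add: finite_theta_tuples finite_B)
  have pv: "polynomial_on S (v i c)" if "i \<in> ?I" "c \<in> B" for i c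
    using that polynomial_act_monomial[OF S, of "fst i" "\<lambda>_. snd i" c] polynomial_const
    by (auto simp: v_def[abs_def] w_def theta_tuples_def split_beta)
  have rv: "regular (chart S) (v i c)" if "i \<in> ?I" "c \<in> B" for i c
    using polynomial_regular[OF S pv[OF that] zopen_chart[OF S]] by simp
  from local_elimination[of ?I B "chart S" P v, OF finI finite_B zopen_chart[OF S] P rv]
  obtain D A \<rho> \<gamma> where D: "zopen D" "P \<in> D" "D \<subseteq> chart S"
    and red: "reduced_rows ?I B v D A \<rho> \<gamma>"
    and atP: "\<forall>i\<in>?I. \<forall>c\<in>B. v i c P = (\<Sum>a\<in>A. v i a P * \<rho> a c P)"
    by blast
  from red have A: "A \<subseteq> B"
    and r\<rho>: "\<And>a c. a \<in> A \<Longrightarrow> c \<in> B \<Longrightarrow> regular D (\<rho> a c)"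
    and r\<gamma>: "\<And>a i. a \<in> A \<Longrightarrow> i \<in> ?I \<Longrightarrow> regular D (\<gamma> a i)"
    and comb: "\<And>U a c. U \<in> D \<Longrightarrow> a \<in> A \<Longrightarrow> c \<in> B \<Longrightarrow> \<rho> a c U = (\<Sum>i\<in>?I. \<gamma> a i U * v i c U)"
    and unit: "\<And>U a c. U \<in> D \<Longrightarrow> a \<in> A \<Longrightarrow> c \<in> A \<Longrightarrow> \<rho> a c U = (if a = c then 1 else 0)"
    unfolding reduced_rows_def by auto
  define b where "b a U = (\<Sum>i\<in>?I. sc (\<gamma> a i U) (w i U))" for a U
  have cfb: "cf c (b a U) = \<rho> a c U" if "U \<in> D" "a \<in> A" "c \<in> B" for U a c
    using comb[OF that] by (simp add: b_def cf_sum cf_scale v_def)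
  have ech: "echelon sc B A (\<lambda>a. b a U)" if "U \<in> D" for U
    using A by (intro echelonI) (auto simp: cfb[OF that] unit[OF that] subset_iff)
  have wE: "w i U \<in> RadU act l U" if "U \<in> chart S" "i \<in> ?I" for U i
    using that act_monomial_in_RadU[OF S that(1)] by (auto simp: w_def)
  have bE: "b a U \<in> RadU act l U" if "U \<in> D" for a U
    unfolding b_def using D(3) that by (intro m.subspace_sum m.subspace_scale subspace_RadU wE) auto
  have chart_Gr: "U \<in> Gr" if "U \<in> chart S" for U using that by (simp add: chart_def)
  have "m.span ((\<lambda>a. b a P) ` A) = RadU act l P"
  proof (rule equalityI)
    show "m.span ((\<lambda>a. b a P) ` A) \<subseteq> RadU act l P"
      using bE[OF D(2)] by (intro m.span_minimal subspace_RadU) auto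
    have "w i P \<in> m.span ((\<lambda>a. b a P) ` A)" if i: "i \<in> ?I" for i
    proof -
      have "w i P = (\<Sum>a\<in>A. sc (cf a (w i P)) (b a P))"
      proof (rule cf_eqI)
        fix c assume c: "c \<in> B"
        have "cf c (w i P) = (\<Sum>a\<in>A. v i a P * \<rho> a c P)" using bspec[OF bspec[OF atP i] c] by (simp add: v_def)
        also have "\<dots> = cf c (\<Sum>a\<in>A. sc (cf a (w i P)) (b a P))"
          using c D(2) by (simp add: cf_sum cf_scale v_def cfb)
        finally show "cf c (w i P) = cf c (\<Sum>a\<in>A. sc (cf a (w i P)) (b a P))" .
      qed
      also have "\<dots> \<in> m.span ((\<lambda>a. b a P) ` A)"
        by (intro m.span_sum m.span_scale m.span_base imageI)
      finally show ?thesis .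
    qed
    then show "RadU act l P \<subseteq> m.span ((\<lambda>a. b a P) ` A)"
      unfolding RadU_eq[OF S P] by (intro m.span_minimal m.subspace_span) (auto simp: w_def)
  qed
  with m.dim_echelon[OF ech[OF D(2)]] dim[OF chart_Gr[OF P]] have card: "card A = d" by simp
  have "local_frame (RadU act l) D A b"
  proof (rule local_frameI[OF D(1) _ ech _ bE A])
    show "regular_section D (b a)" if "a \<in> A" for a
      unfolding regular_section_def
    proof
      fix c assume "c \<in> B"
      then show "regular D (\<lambda>U. cf c (b a U))"
        using r\<rho>[OF that] cfb that regular_cong[of D "\<lambda>U. cf c (b a U)" "\<rho> a c"] by simp
    qed
    show "RadU act l U \<subseteq> m.span ((\<lambda>a. b a U) ` A)" if U: "U \<in> D" for U
    proof -
      have "m.span ((\<lambda>a. b a U) ` A) = RadU act l U"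
      proof (rule subspace_eq_of_dim)
        show "m.span ((\<lambda>a. b a U) ` A) \<subseteq> RadU act l U"
          using bE[OF U] by (intro m.span_minimal subspace_RadU) auto
        show "m.dim (RadU act l U) \<le> m.dim (m.span ((\<lambda>a. b a U) ` A))"
          using m.dim_echelon[OF ech[OF U]] dim chart_Gr D(3) U card by auto
      qed (auto intro: subspace_RadU)
      then show ?thesis by simp
    qed
  qed
  moreover have "b a U = (\<Sum>(js, e)\<in>?I. sc (\<gamma> a (js, e) U) (act (monomial S U js) e))" for a U
    by (simp add: b_def w_def split_beta)
  ultimately show ?thesis
    using D card r\<gamma> by (intro exI[of _ D] exI[of _ A] exI[of _ b] exI[of _ \<gamma>]) auto
qed

text \<open>The equations of the socle are stacked into one matrix with rows \<open>(js, c)\<close>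
  and columns in \<open>B\<close>, and each free column yields a solution. The reduced equations
  follow from the original ones, so the socle lies in the span of these solutions; equality holds at
  \<open>P\<close>, and the constant dimension forces it nearby. The known inclusion is opposite to
  the one for the radical.\<close>

lemma SocU_local_frame:
  assumes dim: "\<And>Q. Q \<in> Gr \<Longrightarrow> m.dim (SocU act l Q) = d"
    and S: "S \<in> index_sets" and P: "P \<in> chart S"
  shows "\<exists>D A b. P \<in> D \<and> card A = d \<and> local_frame (SocU act l) D A b"
proof -
  let ?I = "theta_tuples l \<times> B"
  define v where "v = (\<lambda>(js, c) e U. cf c (act (monomial S U js) e))"
  have finI: "finite ?I" by (simp add: finite_theta_tuples finite_B)
  have pv: "polynomial_on S (v i e)" if "i \<in> ?I" "e \<in> B" for i e
    using that polynomial_act_monomial[OF S, of "fst i" "\<lambda>_. e" "snd i"] polynomial_const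
    by (auto simp: v_def theta_tuples_def split_beta)
  have rv: "regular (chart S) (v i e)" if "i \<in> ?I" "e \<in> B" for i e
    using polynomial_regular[OF S pv[OF that] zopen_chart[OF S]] by simp
  from local_elimination[of ?I B "chart S" P v, OF finI finite_B zopen_chart[OF S] P rv]
  obtain D A' \<rho> \<gamma> where D: "zopen D" "P \<in> D" "D \<subseteq> chart S"
    and red: "reduced_rows ?I B v D A' \<rho> \<gamma>"
    and atP: "\<forall>i\<in>?I. \<forall>e\<in>B. v i e P = (\<Sum>a\<in>A'. v i a P * \<rho> a e P)"
    by blast
  from red have A': "A' \<subseteq> B"
    and r\<rho>: "\<And>a e. a \<in> A' \<Longrightarrow> e \<in> B \<Longrightarrow> regular D (\<rho> a e)"
    and comb: "\<And>U a e. U \<in> D \<Longrightarrow> a \<in> A' \<Longrightarrow> e \<in> B \<Longrightarrow> \<rho> a e U = (\<Sum>i\<in>?I. \<gamma> a i U * v i e U)"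
    and unit: "\<And>U a c. U \<in> D \<Longrightarrow> a \<in> A' \<Longrightarrow> c \<in> A' \<Longrightarrow> \<rho> a c U = (if a = c then 1 else 0)"
    unfolding reduced_rows_def by auto
  have finA': "finite A'" using A' finite_B finite_subset by blast
  define A where "A = B - A'"
  have A: "A \<subseteq> B" "A \<inter> A' = {}" "B = A \<union> A'" "finite A" using A' finite_B by (auto simp: A_def)
  \<comment> \<open>The solution with free variable \<open>a\<close> set to 1, the other free
    variables set to 0 and the pivot variables solved from the reduced equations, hence the minus
    sign.\<close>
  define b where "b a U = a - (\<Sum>c\<in>A'. sc (\<rho> c a U) c)" for a U
  have b_add: "b a U + (\<Sum>c\<in>A'. sc (\<rho> c a U) c) = a" for a U by (simp add: b_def)
  have cfb: "cf c (b a U) = (if c = a then 1 else 0) - (if c \<in> A' then \<rho> c a U else 0)"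
    if "a \<in> A" "c \<in> B" for U a c
  proof -
    have "cf c (b a U) + (\<Sum>c'\<in>A'. \<rho> c' a U * cf c c') = (if c = a then 1 else 0)"
      using arg_cong[OF b_add[of a U], of "cf c"] that(1) A(1)
      by (auto simp: cf_add cf_sum cf_scale cf_basis)
    moreover have "(\<Sum>c'\<in>A'. \<rho> c' a U * cf c c') = (\<Sum>c'\<in>A'. \<rho> c' a U * (if c = c' then 1 else 0))"
      using A' by (intro sum.cong refl) (auto simp: cf_basis)
    ultimately show ?thesis
      using finA' by (simp add: if_distrib[of "(*) _"] eq_diff_eq cong: if_cong)
  qed
  have cfbA: "cf c (b a U) = (if c = a then 1 else 0)" if "a \<in> A" "c \<in> A" for U a c
  proof -
    have "c \<in> B" "c \<notin> A'" using that A(1,2) by auto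
    with cfb[OF that(1)] show ?thesis by simp
  qed
  have cfbA': "cf c (b a U) = - \<rho> c a U" if "a \<in> A" "c \<in> A'" for U a c
  proof -
    have "c \<in> B" "c \<noteq> a" using that A' A(2) by auto
    with cfb[OF that(1)] that(2) show ?thesis by simp
  qed
  have split: "(\<Sum>e\<in>B. g e) = (\<Sum>e\<in>A. g e) + (\<Sum>e\<in>A'. g e)" for g :: "'m \<Rightarrow> 'k"
    using sum.union_disjoint[OF A(4) finA' A(2), of g] A(3) by simp
  have ech: "echelon sc B A (\<lambda>a. b a U)" for U
    by (rule echelonI[OF A(1)]) (simp add: cfbA)
  have orth: "(\<Sum>e\<in>B. cf e (b a U) * \<rho> c e U) = 0" if "U \<in> D" "a \<in> A" "c \<in> A'" for U a c
  proof -
    have "(\<Sum>e\<in>B. cf e (b a U) * \<rho> c e U)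
        = (\<Sum>e\<in>A. cf e (b a U) * \<rho> c e U) + (\<Sum>e\<in>A'. cf e (b a U) * \<rho> c e U)"
      by (rule split)
    also have "(\<Sum>e\<in>A. cf e (b a U) * \<rho> c e U) = (\<Sum>e\<in>A. if e = a then \<rho> c e U else 0)"
      using that by (intro sum.cong refl) (simp add: cfbA)
    also have "\<dots> = \<rho> c a U" using that A(4) by simp
    also have "(\<Sum>e\<in>A'. cf e (b a U) * \<rho> c e U) = (\<Sum>e\<in>A'. if e = c then - \<rho> e a U else 0)"
      using that by (intro sum.cong refl) (simp add: cfbA' unit)
    also have "\<dots> = - \<rho> c a U" using that finA' by simp
    finally show ?thesis by simp
  qed
  \<comment> \<open>The reduced equations are combinations of the original ones on all of
    \<open>D\<close>, by \<open>comb\<close>.\<close>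
  have SocK: "(\<Sum>e\<in>B. cf e u * \<rho> c e U) = 0"
    if U: "U \<in> D" and u: "u \<in> SocU act l U" and c: "c \<in> A'" for U u c
  proof -
    have "(\<Sum>e\<in>B. cf e u * v i e U) = 0" if i: "i \<in> ?I" for i
    proof -
      obtain js c' where [simp]: "i = (js, c')" by fastforce
      have "(\<Sum>e\<in>B. cf e u * v i e U) = cf c' (act (monomial S U js) u)"
        unfolding act_expand[of _ u] by (simp add: v_def cf_sum cf_scale)
      also have "\<dots> = 0"
        using u i D(3) U SocU_eq[OF S, of U l] by (auto simp: cf_zero)
      finally show ?thesis .
    qed
    then have "0 = (\<Sum>i\<in>?I. \<gamma> c i U * (\<Sum>e\<in>B. cf e u * v i e U))" by simp
    also have "\<dots> = (\<Sum>e\<in>B. cf e u * (\<Sum>i\<in>?I. \<gamma> c i U * v i e U))"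
      unfolding sum_distrib_left by (subst sum.swap) (simp add: ac_simps)
    also have "\<dots> = (\<Sum>e\<in>B. cf e u * \<rho> c e U)" using comb[OF U c] by simp
    finally show ?thesis by simp
  qed
  have sub: "SocU act l U \<subseteq> m.span ((\<lambda>a. b a U) ` A)" if U: "U \<in> D" for U
  proof
    fix u assume u: "u \<in> SocU act l U"
    have "u = (\<Sum>a\<in>A. sc (cf a u) (b a U))"
    proof (rule cf_eqI)
      fix c assume c: "c \<in> B"
      show "cf c u = cf c (\<Sum>a\<in>A. sc (cf a u) (b a U))"
      proof (cases "c \<in> A'")
        case True
        have "0 = (\<Sum>e\<in>A. cf e u * \<rho> c e U) + (\<Sum>e\<in>A'. cf e u * \<rho> c e U)"
          using SocK[OF U u True] by (simp add: split)
        also have "(\<Sum>e\<in>A'. cf e u * \<rho> c e U) = (\<Sum>e\<in>A'. if e = c then cf e u else 0)"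
          using True by (intro sum.cong refl) (auto simp: unit[OF U])
        also have "\<dots> = cf c u" using True finA' by simp
        finally have "cf c u = - (\<Sum>e\<in>A. cf e u * \<rho> c e U)" by (simp add: eq_neg_iff_add_eq_0 add.commute)
        also have "\<dots> = (\<Sum>a\<in>A. cf a u * cf c (b a U))"
          using True unfolding sum_negf[symmetric]
          by (intro sum.cong refl) (simp add: cfbA')
        finally show ?thesis by (simp add: cf_sum cf_scale)
      next
        case False
        then have "c \<in> A" using c by (simp add: A_def)
        have "(\<Sum>a\<in>A. cf a u * cf c (b a U)) = (\<Sum>a\<in>A. if a = c then cf a u else 0)"
          using \<open>c \<in> A\<close> by (intro sum.cong refl) (simp add: cfbA)
        with \<open>c \<in> A\<close> A(4) show ?thesis by (simp add: cf_sum cf_scale)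
      qed
    qed
    also have "\<dots> \<in> m.span ((\<lambda>a. b a U) ` A)"
      by (intro m.span_sum m.span_scale m.span_base imageI)
    finally show "u \<in> m.span ((\<lambda>a. b a U) ` A)" .
  qed
  have chart_Gr: "U \<in> Gr" if "U \<in> chart S" for U using that by (simp add: chart_def)
  \<comment> \<open>Here the original equations must be recovered from the reduced ones, which
    \<open>atP\<close> allows at \<open>P\<close> alone; the other points wait for the dimension
    count.\<close>
  have bP: "b a P \<in> SocU act l P" if a: "a \<in> A" for a
    unfolding SocU_eq[OF S P]
  proof (intro CollectI ballI cf_eqI)
    fix js c assume js: "js \<in> theta_tuples l" and c: "c \<in> B"
    have "cf c (act (monomial S P js) (b a P)) = (\<Sum>e\<in>B. cf e (b a P) * v (js, c) e P)"
      unfolding act_expand[of _ "b a P"] by (simp add: v_def cf_sum cf_scale)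
    also have "\<dots> = (\<Sum>e\<in>B. cf e (b a P) * (\<Sum>c'\<in>A'. v (js, c) c' P * \<rho> c' e P))"
      using atP js c by simp
    also have "\<dots> = (\<Sum>c'\<in>A'. v (js, c) c' P * (\<Sum>e\<in>B. cf e (b a P) * \<rho> c' e P))"
      unfolding sum_distrib_left by (subst sum.swap) (simp add: ac_simps)
    also have "\<dots> = cf c 0" using orth[OF D(2) a] by (simp add: cf_zero)
    finally show "cf c (act (monomial S P js) (b a P)) = cf c 0" .
  qed
  have "m.span ((\<lambda>a. b a P) ` A) = SocU act l P"
    using sub[OF D(2)] bP
    by (intro equalityI m.span_minimal subspace_SocU) auto
  with m.dim_echelon[OF ech] dim[OF chart_Gr[OF P]] have card: "card A = d" by metis
  have "local_frame (SocU act l) D A b"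
  proof (rule local_frameI[OF D(1) _ ech sub _ A(1)])
    show "regular_section D (b a)" if a: "a \<in> A" for a
      unfolding regular_section_def
    proof
      fix c assume c: "c \<in> B"
      show "regular D (\<lambda>U. cf c (b a U))"
      proof (cases "c \<in> A'")
        case True
        have "regular D (\<lambda>U. 0 - \<rho> c a U)"
          using a A(1) by (intro reg_diff reg_const D(1) r\<rho>[OF True]) auto
        then show ?thesis by (simp add: cfbA'[OF a True])
      next
        case False
        then have "c \<in> A" using c by (simp add: A_def)
        then show ?thesis by (simp add: cfbA[OF a] reg_const D(1))
      qed
    qed
    show "b a U \<in> SocU act l U" if U: "U \<in> D" and a: "a \<in> A" for U a
    proof -
      have "SocU act l U = m.span ((\<lambda>a. b a U) ` A)"
      proof (rule subspace_eq_of_dim[OF subspace_SocU _ sub[OF U]])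
        show "m.dim (m.span ((\<lambda>a. b a U) ` A)) \<le> m.dim (SocU act l U)"
          using m.dim_echelon[OF ech, of U] dim chart_Gr D(3) U card by auto
      qed auto
      moreover have "b a U \<in> m.span ((\<lambda>a. b a U) ` A)"
        using a by (intro m.span_base imageI)
      ultimately show ?thesis by (simp only:)
    qed
  qed
  then show ?thesis using D(2) card by blast
qed

text \<open>The inclusion common to both sheaves: locally a section is an element of
  \<open>N\<close> over a nonvanishing polynomial, and the fibres, being subspaces, absorb the
  scalar.\<close>

lemma assoc_sheaf_subset_fiber_sheaf:
  assumes S: "S \<in> index_sets" and W: "zopen W" "W \<subseteq> chart S"
    and E: "\<And>P. P \<in> Gr \<Longrightarrow> m.subspace (E P)"
    and N: "\<And>t c. t \<in> N \<Longrightarrow> c \<in> B \<Longrightarrow> polynomial_on S (\<lambda>U. cf c (t U))"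
      "\<And>t U. t \<in> N \<Longrightarrow> U \<in> chart S \<Longrightarrow> t U \<in> E U"
  shows "assoc_sheaf act (coord_ring S) N W \<subseteq> fiber_sheaf E W"
proof
  fix s assume s: "s \<in> assoc_sheaf act (coord_ring S) N W"
  have loc: "s Q \<in> E Q \<and> (\<exists>W'. Q \<in> W' \<and> W' \<subseteq> W \<and> regular_section W' s)" if Q: "Q \<in> W" for Q
  proof -
    from s Q obtain W' t f where W': "zopen W'" "Q \<in> W'" "W' \<subseteq> W" and t: "t \<in> N"
      and f: "f \<in> coord_ring S"
      and st: "\<And>R. R \<in> W' \<Longrightarrow> f R \<noteq> 0 \<and> s R = sc (inverse (f R)) (t R)"
      unfolding assoc_sheaf_def by blast
    have W'S: "W' \<subseteq> chart S" using W'(3) W(2) by blast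
    have "s Q \<in> E Q"
      using st[OF W'(2)] N(2)[OF t] W'S W'(2) m.subspace_scale[OF E[OF zopen_subset_Gr[OF W'(1,2)]]]
      by auto
    moreover have "regular_section W' s"
      unfolding regular_section_def
    proof
      fix c assume c: "c \<in> B"
      have "regular W' f"
        by (rule polynomial_regular[OF S coord_ring_polynomial[OF f] W'(1) W'S])
      moreover have "{R\<in>W'. f R \<noteq> 0} = W'" using st by blast
      ultimately have "regular W' (\<lambda>R. inverse (f R))" using reg_inverse[of W' f] by simp
      moreover have "regular W' (\<lambda>R. cf c (t R))"
        by (rule polynomial_regular[OF S N(1)[OF t c] W'(1) W'S])
      ultimately have "regular W' (\<lambda>R. inverse (f R) * cf c (t R))" by (rule reg_mult)
      then show "regular W' (\<lambda>R. cf c (s R))"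
        using st regular_cong[of W' "\<lambda>R. cf c (s R)" "\<lambda>R. inverse (f R) * cf c (t R)"]
        by (simp add: cf_scale)
    qed
    ultimately show ?thesis using W' by blast
  qed
  have "regular_section W s"
    unfolding regular_section_def
  proof (intro ballI regular_local[OF W(1)])
    fix c Q assume "c \<in> B" "Q \<in> W"
    with loc[of Q] obtain W' where "Q \<in> W'" "W' \<subseteq> W" "regular_section W' s" by auto
    with \<open>c \<in> B\<close> show "\<exists>W'. Q \<in> W' \<and> W' \<subseteq> W \<and> regular W' (\<lambda>P. cf c (s P))"
      unfolding regular_section_def by blast
  qed
  with s W(1) loc show "s \<in> fiber_sheaf E W" by (auto simp: fiber_sheaf_iff assoc_sheaf_def)
qed

text \<open>Equality of restricted functions is equality at every point of the chart, and there the
  composite of the operators acts as a monomial.\<close>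

lemma Ker_module_fiber:
  assumes S: "S \<in> index_sets" and t: "t \<in> tensor act (coord_ring S) (chart S)"
  shows "t \<in> Ker_module act l S \<longleftrightarrow> (\<forall>U\<in>chart S. t U \<in> SocU act l U)"
proof -
  have ext: "t \<in> extensional (chart S)" using t by (simp add: tensor_coord_ring_iff)
  have "foldr (theta act S) js t = (\<lambda>U\<in>chart S. 0) \<longleftrightarrow>
      (\<forall>U\<in>chart S. act (monomial S U js) (t U) = 0)" for js
  proof
    assume "foldr (theta act S) js t = (\<lambda>U\<in>chart S. 0)"
    then show "\<forall>U\<in>chart S. act (monomial S U js) (t U) = 0"
      by (metis foldr_theta restrict_apply')
  next
    assume "\<forall>U\<in>chart S. act (monomial S U js) (t U) = 0"
    then show "foldr (theta act S) js t = (\<lambda>U\<in>chart S. 0)"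
      by (intro extensionalityI[OF foldr_theta_extensional[OF ext] restrict_extensional])
        (simp add: foldr_theta)
  qed
  then show ?thesis
    using t SocU_eq[OF S] by (auto simp: Ker_module_def)
qed

text \<open>
  A section \<open>t/b\<close> with values in \<open>SocU\<close> on the open set \<open>b \<noteq> 0\<close> is rewritten as
  \<open>(b t)/b\<^sup>2\<close>, whose numerator has values in \<open>SocU\<close> on the whole chart.
\<close>

lemma assoc_sheaf_Ker_module:
  assumes S: "S \<in> index_sets" and W: "zopen W" "W \<subseteq> chart S"
  shows "fiber_sheaf (SocU act l) W = assoc_sheaf act (coord_ring S) (Ker_module act l S) W"
proof (rule equalityI)
  have ten: "t \<in> tensor act (coord_ring S) (chart S)" if "t \<in> Ker_module act l S" for t
    using that by (simp add: Ker_module_def)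
  show "assoc_sheaf act (coord_ring S) (Ker_module act l S) W \<subseteq> fiber_sheaf (SocU act l) W"
  proof (rule assoc_sheaf_subset_fiber_sheaf[OF S W subspace_SocU])
    show "polynomial_on S (\<lambda>U. cf c (t U))" if "t \<in> Ker_module act l S" "c \<in> B" for t c
      using ten[OF that(1)] that(2) by (simp add: tensor_coord_ring_iff)
    show "t U \<in> SocU act l U" if "t \<in> Ker_module act l S" "U \<in> chart S" for t U
      using Ker_module_fiber[OF S ten[OF that(1)]] that by blast
  qed
  show "fiber_sheaf (SocU act l) W \<subseteq> assoc_sheaf act (coord_ring S) (Ker_module act l S) W"
  proof
    fix s assume s: "s \<in> fiber_sheaf (SocU act l) W"
    have "\<exists>W'. zopen W' \<and> P \<in> W' \<and> W' \<subseteq> W \<and> (\<exists>t\<in>Ker_module act l S. \<exists>f\<in>coord_ring S.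
        \<forall>Q\<in>W'. f Q \<noteq> 0 \<and> s Q = sc (inverse (f Q)) (t Q))" if P: "P \<in> W" for P
    proof -
      have PS: "P \<in> chart S" using P W by blast
      have "\<exists>b \<alpha>. polynomial_on S b \<and> (\<forall>c\<in>B. polynomial_on S (\<alpha> c)) \<and> P \<in> principal_open S b \<and>
          principal_open S b \<subseteq> W \<and> (\<forall>c\<in>B. \<forall>Q\<in>principal_open S b. cf c (s Q) = \<alpha> c Q / b Q)"
        using s by (intro common_denominator finite_B W(1) P S PS)
          (auto simp: fiber_sheaf_iff regular_section_def)
      then obtain b \<alpha> where b: "polynomial_on S b" "P \<in> principal_open S b" "principal_open S b \<subseteq> W"
        and \<alpha>: "\<And>c. c \<in> B \<Longrightarrow> polynomial_on S (\<alpha> c)"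
        and s\<alpha>: "\<And>c Q. c \<in> B \<Longrightarrow> Q \<in> principal_open S b \<Longrightarrow> cf c (s Q) = \<alpha> c Q / b Q"
        by blast
      define t where "t = (\<lambda>U\<in>chart S. \<Sum>c\<in>B. sc (b U * \<alpha> c U) c)"
      have cft: "cf c (t U) = b U * \<alpha> c U" if "c \<in> B" "U \<in> chart S" for c U
        using that finite_B
        by (simp add: t_def cf_sum cf_scale cf_basis if_distrib[of "(*) _"] cong: if_cong)
      have ts: "t U = sc (b U * b U) (s U)" if "U \<in> principal_open S b" for U
      proof (rule cf_eqI)
        fix c assume "c \<in> B"
        with that show "cf c (t U) = cf c (sc (b U * b U) (s U))"
          using s\<alpha>[OF _ that] by (simp add: cft cf_scale principal_open_def)
      qed
      have t0: "t U = 0" if "U \<in> chart S" "b U = 0" for U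
        using that by (simp add: t_def)
      have "t \<in> tensor act (coord_ring S) (chart S)"
        unfolding tensor_coord_ring_iff
      proof (intro conjI ballI)
        show "t \<in> extensional (chart S)" by (simp add: t_def)
        fix c assume c: "c \<in> B"
        have "polynomial_on S (\<lambda>U. b U * \<alpha> c U)" by (intro polynomial_mult b \<alpha> c)
        then show "polynomial_on S (\<lambda>U. cf c (t U))"
          using polynomial_cong[of S "\<lambda>U. cf c (t U)" "\<lambda>U. b U * \<alpha> c U"] cft[OF c] by simp
      qed
      moreover have "t U \<in> SocU act l U" if U: "U \<in> chart S" for U
      proof (cases "b U = 0")
        case True
        then show ?thesis using t0[OF U] m.subspace_0[OF subspace_SocU] by simp
      next
        case False
        then have "U \<in> principal_open S b" using U by (simp add: principal_open_def)
        moreover from this b(3) have "U \<in> W" by blast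
        ultimately show ?thesis
          using ts s m.subspace_scale[OF subspace_SocU] by (auto simp: fiber_sheaf_iff)
      qed
      ultimately have "t \<in> Ker_module act l S" using Ker_module_fiber[OF S] by blast
      moreover have "restrict (\<lambda>U. b U * b U) (chart S) \<in> coord_ring S"
        using polynomial_mult[OF b(1,1)] by (simp add: polynomial_on_def)
      moreover have "\<forall>Q\<in>principal_open S b. restrict (\<lambda>U. b U * b U) (chart S) Q \<noteq> 0 \<and>
          s Q = sc (inverse (restrict (\<lambda>U. b U * b U) (chart S) Q)) (t Q)"
      proof
        fix Q assume Q: "Q \<in> principal_open S b"
        then have QS: "Q \<in> chart S" and "b Q * b Q \<noteq> 0" by (auto simp: principal_open_def)
        from left_inverse[OF this(2)] have "s Q = sc (inverse (b Q * b Q)) (t Q)"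
          by (simp only: ts[OF Q] m.scale_scale m.scale_one)
        with QS \<open>b Q * b Q \<noteq> 0\<close>
        show "restrict (\<lambda>U. b U * b U) (chart S) Q \<noteq> 0 \<and>
          s Q = sc (inverse (restrict (\<lambda>U. b U * b U) (chart S) Q)) (t Q)" by simp
      qed
      ultimately show ?thesis using zopen_principal_open[OF S b(1)] b(2,3) by blast
    qed
    with s show "s \<in> assoc_sheaf act (coord_ring S) (Ker_module act l S) W"
      by (auto simp: assoc_sheaf_def fiber_sheaf_iff)
  qed
qed

text \<open>The difficult inclusion lifts a section with values in the radicals to the module. Near
  a point the section is a combination of the frame, and through \<open>\<gamma>\<close> the frame
  is a combination of monomials applied to basis vectors; the composite coefficients are regular and
  are put over one polynomial.\<close>

lemma assoc_sheaf_Im_module: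
  assumes dim: "\<And>Q. Q \<in> Gr \<Longrightarrow> m.dim (RadU act l Q) = d"
    and S: "S \<in> index_sets" and W: "zopen W" "W \<subseteq> chart S"
  shows "fiber_sheaf (RadU act l) W = assoc_sheaf act (coord_ring S) (Im_module act l S) W"
proof (rule equalityI)
  show "assoc_sheaf act (coord_ring S) (Im_module act l S) W \<subseteq> fiber_sheaf (RadU act l) W"
  proof (rule assoc_sheaf_subset_fiber_sheaf[OF S W subspace_RadU])
    fix s assume "s \<in> Im_module act l S"
    then obtain t where t: "\<forall>js\<in>theta_tuples l. t js \<in> tensor act (coord_ring S) (chart S)"
      and s: "s = (\<lambda>U\<in>chart S. \<Sum>js\<in>theta_tuples l. foldr (theta act S) js (t js) U)"
      unfolding Im_module_def by blast
    have s_eq: "s U = (\<Sum>js\<in>theta_tuples l. act (monomial S U js) (t js U))" if "U \<in> chart S" for U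
      using that by (simp add: s foldr_theta)
    show "polynomial_on S (\<lambda>U. cf c (s U))" if c: "c \<in> B" for c
    proof -
      have "polynomial_on S (\<lambda>U. cf c (act (monomial S U js) (t js U)))"
        if "js \<in> theta_tuples l" for js
        using that t c by (intro polynomial_act_monomial[OF S])
          (auto simp: theta_tuples_def tensor_coord_ring_iff)
      then have "polynomial_on S (\<lambda>U. \<Sum>js\<in>theta_tuples l. cf c (act (monomial S U js) (t js U)))"
        by (rule polynomial_sum)
      then show ?thesis
        using polynomial_cong[of S "\<lambda>U. cf c (s U)"] s_eq by (simp add: cf_sum)
    qed
    show "s U \<in> RadU act l U" if U: "U \<in> chart S" for U
      unfolding s_eq[OF U] by (intro m.subspace_sum subspace_RadU act_monomial_in_RadU S U)
  qed
  show "fiber_sheaf (RadU act l) W \<subseteq> assoc_sheaf act (coord_ring S) (Im_module act l S) W"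
  proof
    fix s assume s: "s \<in> fiber_sheaf (RadU act l) W"
    let ?I = "theta_tuples l \<times> B"
    have finI: "finite ?I" by (simp add: finite_theta_tuples finite_B)
    have "\<exists>W'. zopen W' \<and> P \<in> W' \<and> W' \<subseteq> W \<and> (\<exists>t\<in>Im_module act l S. \<exists>f\<in>coord_ring S.
        \<forall>Q\<in>W'. f Q \<noteq> 0 \<and> s Q = sc (inverse (f Q)) (t Q))" if P: "P \<in> W" for P
    proof -
      have PS: "P \<in> chart S" using P W by blast
      from RadU_local_frame[OF dim S PS] obtain D A b \<gamma> where D: "P \<in> D"
        and fr: "local_frame (RadU act l) D A b"
        and r\<gamma>: "\<forall>a\<in>A. \<forall>i\<in>?I. regular D (\<gamma> a i)"
        and b: "\<forall>U\<in>D. \<forall>a\<in>A. b a U = (\<Sum>(js, e)\<in>?I. sc (\<gamma> a (js, e) U) (act (monomial S U js) e))"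
        by blast
      from fr have opn: "zopen D" and A: "A \<subseteq> B"
        and span: "\<And>Q u. Q \<in> D \<Longrightarrow> u \<in> RadU act l Q \<Longrightarrow> u = (\<Sum>a\<in>A. sc (cf a u) (b a Q))"
        unfolding local_frame_def by auto
      define G where "G = W \<inter> D"
      have G: "zopen G" "P \<in> G" "G \<subseteq> W" "G \<subseteq> D"
        using zopen_Int[OF W(1) opn] P D by (auto simp: G_def)
      \<comment> \<open>The pivot coordinates of \<open>s\<close> composed with the recorded row
        operations.\<close>
      define h where "h i U = (\<Sum>a\<in>A. cf a (s U) * \<gamma> a i U)" for i U
      have rs: "regular G (\<lambda>U. cf a (s U))" if "a \<in> A" for a
        using s that A G(1,3) by (auto simp: fiber_sheaf_iff regular_section_def intro: reg_mono)
      have rh: "regular G (h i)" if "i \<in> ?I" for i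
        unfolding h_def using r\<gamma> that G(1,4) by (intro reg_sum reg_mult rs) (auto intro: reg_mono)
      have sh: "s U = (\<Sum>(js, e)\<in>?I. sc (h (js, e) U) (act (monomial S U js) e))" if U: "U \<in> G" for U
      proof -
        have "s U = (\<Sum>a\<in>A. sc (cf a (s U)) (b a U))"
          using s U G by (intro span) (auto simp: fiber_sheaf_iff)
        also have "\<dots> = (\<Sum>a\<in>A. \<Sum>i\<in>?I. sc (cf a (s U) * \<gamma> a i U) (act (monomial S U (fst i)) (snd i)))"
          using b U G(4) by (intro sum.cong refl) (auto simp: m.scale_sum_right split_beta)
        also have "\<dots> = (\<Sum>i\<in>?I. sc (h i U) (act (monomial S U (fst i)) (snd i)))"
          by (subst sum.swap) (simp add: h_def m.scale_sum_left)
        finally show ?thesis by (simp add: split_beta)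
      qed
      from common_denominator[of ?I G P S h, OF finI G(1,2) S PS rh]
      obtain d \<alpha> where d: "polynomial_on S d" "P \<in> principal_open S d" "principal_open S d \<subseteq> G"
        and \<alpha>: "\<forall>i\<in>?I. polynomial_on S (\<alpha> i)"
        and h\<alpha>: "\<forall>i\<in>?I. \<forall>Q\<in>principal_open S d. h i Q = \<alpha> i Q / d Q"
        by blast
      \<comment> \<open>One preimage for each tuple, gathering over \<open>e\<close> the numerators
        that belong to the pairs \<open>(js, e)\<close>. The denominator \<open>d\<close> stays
        outside, since preimages must have polynomial coordinates.\<close>
      define t where "t js = (\<lambda>U\<in>chart S. \<Sum>e\<in>B. sc (\<alpha> (js, e) U) e)" for js
      define T where "T = (\<lambda>U\<in>chart S. \<Sum>js\<in>theta_tuples l. foldr (theta act S) js (t js) U)"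
      have "t js \<in> tensor act (coord_ring S) (chart S)" if js: "js \<in> theta_tuples l" for js
        unfolding tensor_coord_ring_iff
      proof (intro conjI ballI)
        show "t js \<in> extensional (chart S)" by (simp add: t_def)
        fix c assume c: "c \<in> B"
        then have "cf c (t js U) = \<alpha> (js, c) U" if "U \<in> chart S" for U
          using that finite_B
          by (simp add: t_def cf_sum cf_scale cf_basis if_distrib[of "(*) _"] cong: if_cong)
        then show "polynomial_on S (\<lambda>U. cf c (t js U))"
          using polynomial_cong[of S "\<lambda>U. cf c (t js U)" "\<alpha> (js, c)"] \<alpha> js c by simp
      qed
      then have "T \<in> Im_module act l S" unfolding Im_module_def T_def by blast
      moreover have "restrict d (chart S) \<in> coord_ring S" using d(1) by (simp add: polynomial_on_def)
      moreover have "\<forall>Q\<in>principal_open S d. restrict d (chart S) Q \<noteq> 0 \<and>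
          s Q = sc (inverse (restrict d (chart S) Q)) (T Q)"
      proof
        fix Q assume Q: "Q \<in> principal_open S d"
        then have QS: "Q \<in> chart S" and dQ: "d Q \<noteq> 0" by (auto simp: principal_open_def)
        have "T Q = (\<Sum>js\<in>theta_tuples l. \<Sum>e\<in>B. sc (\<alpha> (js, e) Q) (act (monomial S Q js) e))"
          using QS by (simp add: T_def foldr_theta t_def act.scale_sum_right act_sc)
        also have "\<dots> = (\<Sum>(js, e)\<in>?I. sc (\<alpha> (js, e) Q) (act (monomial S Q js) e))"
          by (rule sum.cartesian_product)
        finally have "sc (inverse (d Q)) (T Q)
            = (\<Sum>(js, e)\<in>?I. sc (\<alpha> (js, e) Q / d Q) (act (monomial S Q js) e))"
          by (simp add: m.scale_sum_right split_beta divide_inverse mult.commute)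
        also have "\<dots> = (\<Sum>(js, e)\<in>?I. sc (h (js, e) Q) (act (monomial S Q js) e))"
          using h\<alpha> Q by (intro sum.cong refl) auto
        also have "\<dots> = s Q" using sh Q d(3) by auto
        finally show "restrict d (chart S) Q \<noteq> 0 \<and> s Q = sc (inverse (restrict d (chart S) Q)) (T Q)"
          using QS dQ by simp
      qed
      ultimately show ?thesis using zopen_principal_open[OF S d(1)] d(2,3) G(3) by blast
    qed
    with s show "s \<in> assoc_sheaf act (coord_ring S) (Im_module act l S) W"
      by (auto simp: assoc_sheaf_def fiber_sheaf_iff)
  qed
qed

section \<open>The kernel and image bundles\<close>

lemma Ker_sheaf_vector_bundle:
  assumes dim: "\<And>Q. Q \<in> Gr \<Longrightarrow> m.dim (SocU act l Q) = d"
  shows "algebraic_vector_bundle act (Ker_sheaf act l) \<and> has_rank act (Ker_sheaf act l) d"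
proof -
  have "Ker_sheaf act l = fiber_sheaf (SocU act l)"
    unfolding Ker_sheaf_def
    by (rule glued_sheaf_eq_fiber_sheaf[OF subspace_SocU assoc_sheaf_Ker_module])
  moreover have "\<exists>W A b. P \<in> W \<and> card A = d \<and> local_frame (SocU act l) W A b" if P: "P \<in> Gr" for P
    using charts_cover[OF P] SocU_local_frame[OF dim] by metis
  ultimately show ?thesis
    using fiber_sheaf_vector_bundle[of "SocU act l" d, OF subspace_SocU] by simp
qed

lemma Im_sheaf_vector_bundle:
  assumes dim: "\<And>Q. Q \<in> Gr \<Longrightarrow> m.dim (RadU act l Q) = d"
  shows "algebraic_vector_bundle act (Im_sheaf act l) \<and> has_rank act (Im_sheaf act l) d"
proof -
  have "Im_sheaf act l = fiber_sheaf (RadU act l)"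
    unfolding Im_sheaf_def
    by (rule glued_sheaf_eq_fiber_sheaf[OF subspace_RadU assoc_sheaf_Im_module[OF dim]])
  moreover have "\<exists>W A b. P \<in> W \<and> card A = d \<and> local_frame (RadU act l) W A b" if P: "P \<in> Gr" for P
  proof -
    obtain S where "S \<in> index_sets" "P \<in> chart S" using charts_cover[OF P] .
    from RadU_local_frame[OF dim this] show ?thesis by blast
  qed
  ultimately show ?thesis
    using fiber_sheaf_vector_bundle[of "RadU act l" d, OF subspace_RadU] by simp
qed

end

theorem theorem6p2:
  fixes V :: "('e::{ab_group_add,finite} \<Rightarrow>\<^sub>0 'k::alg_closed_field) set"
    and x :: "nat \<Rightarrow> 'e \<Rightarrow>\<^sub>0 'k"
    and act :: "('e \<Rightarrow>\<^sub>0 'k) \<Rightarrow> 'm::ab_group_add \<Rightarrow> 'm"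
    and U :: "('e \<Rightarrow>\<^sub>0 'k) set"
    and p n r l :: nat
  assumes "CHAR('k) = p" and "p > 0"
    and "elementary_abelian TYPE('e) p n" and "n \<ge> 1"
    and "inj_on x {..<n}"
    and "\<not> Modules.module.dependent alg_scale (x ` {..<n})"
    and "V = Modules.module.span alg_scale (x ` {..<n})"
    and "V \<subseteq> Rad"
    and "bij_betw (coset Rad2) V (coset Rad2 ` Rad)"
    and "fin_dim_module act"
    and "1 \<le> r" and "r \<le> n"
    and "U \<in> planes V r"
    and "1 \<le> l" and "l \<le> (p - 1) * r"
  shows "(constant_Soc_rank act V r l \<longrightarrow>
            grassmannian.algebraic_vector_bundle V x n r act (grassmannian.Ker_sheaf V x n r act l) \<and>
            grassmannian.has_rank V x n r act (grassmannian.Ker_sheaf V x n r act l)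
              (vector_space.dim (restr_scale act) (SocU act l U))) \<and>
         (constant_Rad_rank act V r l \<longrightarrow>
            grassmannian.algebraic_vector_bundle V x n r act (grassmannian.Im_sheaf V x n r act l) \<and>
            grassmannian.has_rank V x n r act (grassmannian.Im_sheaf V x n r act l)
              (vector_space.dim (restr_scale act) (RadU act l U)))"
proof -
  from \<open>fin_dim_module act\<close> obtain X where "Modules.module act" and X: "finite X"
    "Modules.module.span (restr_scale act) X = UNIV"
    by (auto simp: fin_dim_module_def)
  interpret m: vector_space "restr_scale act"
    by (rule vector_space_restr_scale[OF \<open>Modules.module act\<close>])
  \<comment> \<open>A basis chosen inside the finite spanning set is finite, and supplies the
    coordinates \<open>cf\<close>.\<close>
  obtain B where B: "B \<subseteq> X" "\<not> m.dependent B" "X \<subseteq> m.span B"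
    using m.basis_exists[of X] by metis
  have "m.span B = UNIV"
    using X(2) m.span_minimal[OF B(3) m.subspace_span] by blast
  then interpret grassmannian_module V x n r act B
    by (intro grassmannian_module.intro grassmannian_basis.intro grassmannian_module_axioms.intro
        assms(5-7) \<open>Modules.module act\<close> B(2) finite_subset[OF B(1) X(1)])
  \<comment> \<open>The rank is taken to be the dimension at the given plane \<open>U\<close>;
    constancy makes it the dimension at every plane.\<close>
  show ?thesis
    using Ker_sheaf_vector_bundle[of l] Im_sheaf_vector_bundle[of l] assms(13)
    unfolding constant_Soc_rank_def constant_Rad_rank_def by blast
qed

end
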